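(* Let $G$ and $\Gamma$ be isomorphic LCA groups, and let $h:G\to\Gamma$ be a topological isomorphism (homeomorphic group homomorphism) with modulus $\mu(h)$. Let $X$ be a Lévy process on $G$ with $L^2$-generator $\mathscr{L}$ that satisfies Dalang's condition (D), let $\sigma:\mathbf{R}\to\mathbf{R}$ be Lipschitz continuous, suppose that either $G$ is compact or $\sigma(0)=0$, let $\lambda>0$, and let $\xi$ be space--time white noise on $\mathbf{R}_+\times G$. Suppose $u_0\in L^2(G)$ is nonrandom, and let $u$ denote the mild solution of $\partial_tu=\mathscr{L}u+\lambda\sigma(u)\xi$ on $(0,\infty)\times G$ with initial value $u_0$. Then $v_t:=u_t\circ h^{-1}$ defines the unique mild solution to the stochastic heat equation $$\frac{\partial v_t(x)}{\partial t}=(\mathscr{L}^{h\circ X}v_t)(x)+\lambda\sqrt{\mu(h)}\,\sigma(v_t(x))\,\xi_h,\qquad v_0=u_0\circ h^{-1},$$ viewed as an SPDE on $\Gamma=h(G)$, for $x\in\Gamma$ and $t>0$, where $\mathscr{L}^{h\circ X}$ is the $L^2$-generator of the Lévy process $h\circ X:=\{h(X_t)\}_{t\ge0}$ on $\Gamma$ and $\xi_h$ is the white noise on $\mathbf{R}_+\times\Gamma$ given by $\xi_h(A\times B)=\sqrt{\mu(h)}\,\xi(A\times h^{-1}(B))$.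
   Context: Groups. An LCA group is a locally compact Hausdorff Abelian topological group, written multiplicatively, with identity $e_G$. $G^*$ is its dual (character) group and $(x,\chi):=\chi(x)$. $m_G,m_{G^*}$ are Haar measures, normalized so that the Fourier transform $\hat f(\chi)=\int_G (x,\chi)f(x)\,m_G(dx)$ extends to an isometry $L^2(G)\to L^2(G^* )$, with $m_G(G)=1$ if $G$ is compact and $m_G$ = counting measure if $G$ is discrete (either choice if $G$ is finite). $L^2(G)=L^2(m_G)$. The modulus $\mu(h)\in(0,\infty)$ of a topological isomorphism $h:G\to\Gamma$ is defined by $m_\Gamma\circ h=\mu(h)m_G$, i.e. $m_\Gamma(h(A))=\mu(h)m_G(A)$. Lévy processes (on any LCA group $G$). A Lévy process on $G$ is a $G$-valued process $X=\{X_t\}_{t\ge0}$ with $X_0=e_G$, such that $X_{t+s}X_s^{-1}$ is independent of $\{X_r\}_{r\in[0,s]}$ and has the law of $X_t$ ($s,t\ge 0$), and $t\mapsto X_t$ is a.s. right continuous with left limits. Its characteristic exponent $\Psi:G^*\to\mathbf{C}$ is the continuous function with $\mathrm{E}(X_t,\chi)=e^{-t\Psi(\chi)}$. Its semigroup is $(P_tf)(x)=\mathrm{E}f(xX_t)$, and its $L^2$-generator is $\mathscr{L}f=\lim_{t\downarrow0}t^{-1}(P_tf-f)$ in $L^2(G)$, with domain those $f\in L^2(G)$ for which the limit exists. Dalang's condition (D): $\int_{G^*}(\beta+\operatorname{Re}\Psi(\chi))^{-1}m_{G^*}(d\chi)<\infty$ for one, hence all, $\beta>0$. Under (D), $X_t$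 ($t>0$) has the continuous transition density $p_t(x)=\int_{G^*}(x^{-1},\chi)e^{-t\Psi(\chi)}m_{G^*}(d\chi)$, so that $(P_tf)(x)=\int_G f(xy)p_t(y)\,m_G(dy)$. Noise. Space--time white noise on $\mathbf{R}_+\times G$ is a centered Gaussian random field $\xi$ indexed by Borel subsets of $\mathbf{R}_+\times G$ of finite $(\mathrm{Leb}\times m_G)$-measure, with covariance $\mathrm{Cov}(\xi(E),\xi(F))=(\mathrm{Leb}\times m_G)(E\cap F)$; $\int\cdot\,d\xi$ of nonrandom $L^2$ functions is the Wiener integral. $\mathscr{F}_t$ is the $\sigma$-algebra generated by $\int_{(0,s)\times G}\varphi(y)\,\xi(dr\,dy)$, $s\in[0,t]$, $\varphi\in L^2(G)$, with the filtration completed and made right continuous. Stochastic convolution. A random field is a real-valued process $Z_t(x)(\omega)$ ($t\ge0$, $x\in G$) that is product measurable in $(\omega,t,x)$; $\mathcal{N}_\beta(Z;G)=\sup_{t\ge0}\{e^{-2\beta t}\mathrm{E}(\|Z_t\|_{L^2(G)}^2)\}^{1/2}$. An elementary random field is $Z_t(x)=Y\mathbf{1}_{[a,b)}(t)\psi(x)$ with $0\le a<b$, $\psi\in C_c(G)$, $Y\in L^2(\mathrm{P})$ $\mathscr{F}_a$-measurable; a simple random field is a finite sum of these. $\mathcal{P}^2_\beta(G)$ is the completion of the simple random fields in the norm $\mathcal{N}_\beta$ (versions being identified). $\mathcal{L}^2_\beta(G)$ is the space of nonrandom measurable $K:(0,\infty)\times G\to\mathbf{R}$ with $\|K\|^2_{\mathcal{L}^2_\beta(G)}=\int_0^\infty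 e^{-2\beta s}\|K_s\|^2_{L^2(G)}ds<\infty$. For $K\in\mathcal{L}^2_\beta(G)$ and an elementary random field $Z_t(x)=Y\mathbf{1}_{[a,b)}(t)\psi(x)$ with $0\le a<b$, $\psi\in C_c(G)$ and $Y\in L^2(\mathrm{P})$ $\mathscr{F}_a$-measurable, $(K\circledast Z)_t(x)=Y\int_{(0,t)\times G}\mathbf{1}_{[a,b)}(s)K_{t-s}(yx^{-1})\psi(y)\,\xi(ds\,dy)$; this is extended by linearity to simple $Z$ and then by continuity (using $\mathcal{N}_\beta(K\circledast Z)\le\mathcal{N}_\beta(Z)\|K\|_{\mathcal{L}^2_\beta(G)}$) to all $Z\in\mathcal{P}^2_\beta(G)$, with $K\circledast Z\in\mathcal{P}^2_\beta(G)$. Mild solution. A mild solution of $\partial_tu=\mathscr{L}u+\lambda\sigma(u)\xi$ with initial value $u_0$ is an $L^2(G)$-valued process $u=\{u_t\}_{t\ge0}$, belonging to $\mathcal{P}^2_\beta(G)$ for some sufficiently large $\beta$, such that $u_t=P_tu_0+\lambda(p\circledast\sigma(u))_t$ a.s. for all $t>0$, as an identity in $L^2(G)$. Under the stated hypotheses a mild solution with $\mathrm{E}(\|u_t\|^2_{L^2(G)})\le c_1e^{c_2t}$ ($t\ge 0$) for some finite $c_1,c_2>0$ exists and is unique up to modification among mild solutions satisfying such a bound; "the (unique) mild solution" refers to it. The same definitions are used on $\Gamma$, with $h\circ X$, its semigroup and transition densities, the noise $\xi_h$ and noise level $\lambda\sqrt{\mu(h)}$. For $f\in L^2(G)$, $f\circ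 h^{-1}$ is the element of $L^2(\Gamma)$ obtained by composing any representative of $f$ with $h^{-1}$. *)

theory Defs
  imports "HOL-Probability.Probability"
begin

section \<open>Locally compact Abelian groups, dual groups and Haar measures\<close>

text \<open>The library's class of topological Abelian groups is additive, so the group operation,
  the inverse and the identity are written \<open>x + y\<close>, \<open>- x\<close> and \<open>0\<close>.\<close>

class lca_group = topological_ab_group_add + t2_space +
  assumes locally_compact: "\<exists>U K. open U \<and> x \<in> U \<and> U \<subseteq> K \<and> compact K"

definition topological_isomorphism :: "('g::lca_group \<Rightarrow> 'k::lca_group) \<Rightarrow> bool" where
  "topological_isomorphism h \<longleftrightarrow>
     homeomorphism UNIV UNIV h (inv h) \<and> (\<forall>x y. h (x + y) = h x + h y)"

definition characters :: "('g::lca_group \<Rightarrow> complex) set" where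
  "characters = {\<eta>. continuous_on UNIV \<eta> \<and> (\<forall>x. norm (\<eta> x) = 1) \<and>
                    (\<forall>x y. \<eta> (x + y) = \<eta> x * \<eta> y)}"

text \<open>The compact-open topology.\<close>

definition dual_topology :: "('g::lca_group \<Rightarrow> complex) topology" where
  "dual_topology = topology_generated_by
     {{\<eta> \<in> characters. \<eta> ` K \<subseteq> U} | K U. compact K \<and> open U}"

definition borel_of :: "'a topology \<Rightarrow> 'a measure" where
  "borel_of T = sigma (topspace T) {U. openin T U}"

text \<open>Haar measures are Radon measures. The groups need not be \<open>\<sigma>\<close>-compact, and the convention
  is outer regularity on Borel sets and inner regularity on open sets. The argument \<open>T\<close> is the
  topology and \<open>mul\<close> is the group operation on \<open>topspace T\<close>.\<close>

definition haar_measure :: "'a topology \<Rightarrow> ('a \<Rightarrow> 'a \<Rightarrow> 'a) \<Rightarrow> 'a measure \<Rightarrow> bool" where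
  "haar_measure T mul m \<longleftrightarrow>
     sets m = sets (borel_of T) \<and>
     emeasure m (topspace T) \<noteq> 0 \<and>
     (\<forall>a\<in>topspace T. \<forall>A\<in>sets m. emeasure m (mul a ` A) = emeasure m A) \<and>
     (\<forall>K. compactin T K \<longrightarrow> emeasure m K < \<infinity>) \<and>
     (\<forall>A\<in>sets m. emeasure m A = (INF U\<in>{U. openin T U \<and> A \<subseteq> U}. emeasure m U)) \<and>
     (\<forall>U. openin T U \<longrightarrow> emeasure m U = (SUP K\<in>{K. compactin T K \<and> K \<subseteq> U}. emeasure m K))"

definition sq_norm :: "'a measure \<Rightarrow> ('a \<Rightarrow> real) \<Rightarrow> ennreal" where
  "sq_norm m f = (\<integral>\<^sup>+x. ennreal ((f x)\<^sup>2) \<partial>m)"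

text \<open>Elements of real \<open>L\<^sup>2\<close> spaces are handled through measurable representatives;
  identities in \<open>L\<^sup>2\<close> are stated almost everywhere.\<close>

definition sq_integrable :: "'a measure \<Rightarrow> ('a \<Rightarrow> real) set" where
  "sq_integrable m = {f \<in> borel_measurable m. sq_norm m f < \<infinity>}"

definition fourier :: "'g measure \<Rightarrow> ('g::lca_group \<Rightarrow> complex) \<Rightarrow> ('g \<Rightarrow> complex) \<Rightarrow> complex" where
  "fourier m f \<eta> = (\<integral>x. \<eta> x * f x \<partial>m)"

text \<open>A normalized pair of Haar measures on a group and its dual: the Fourier transform is
  isometric on \<open>L\<^sup>1 \<inter> L\<^sup>2\<close>, which is dense in \<open>L\<^sup>2\<close>. The last conjunct fixes the scale for compact
  and for discrete groups, and permits either choice for finite (compact and discrete) groups.\<close>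

definition normalized_haar_pair ::
    "'g::lca_group measure \<Rightarrow> ('g \<Rightarrow> complex) measure \<Rightarrow> bool" where
  "normalized_haar_pair m md \<longleftrightarrow>
     haar_measure euclidean (+) m \<and>
     haar_measure dual_topology (\<lambda>\<eta> \<eta>' x. \<eta> x * \<eta>' x) md \<and>
     (\<forall>f :: 'g \<Rightarrow> complex. integrable m f \<longrightarrow> integrable m (\<lambda>x. (norm (f x))\<^sup>2) \<longrightarrow>
        (\<integral>\<^sup>+\<eta>. ennreal ((norm (fourier m f \<eta>))\<^sup>2) \<partial>md) = (\<integral>\<^sup>+x. ennreal ((norm (f x))\<^sup>2) \<partial>m)) \<and>
     (compact (UNIV :: 'g set) \<or> open {0 :: 'g} \<longrightarrow>
        compact (UNIV :: 'g set) \<and> emeasure m UNIV = 1 \<or>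
        open {0 :: 'g} \<and> (\<forall>A. emeasure m A = emeasure (count_space UNIV) A))"

definition is_modulus ::
    "'g::lca_group measure \<Rightarrow> 'k::lca_group measure \<Rightarrow> ('g \<Rightarrow> 'k) \<Rightarrow> real \<Rightarrow> bool" where
  "is_modulus mG m\<Gamma> h \<mu> \<longleftrightarrow>
     0 < \<mu> \<and> (\<forall>A\<in>sets borel. emeasure m\<Gamma> (h ` A) = ennreal \<mu> * emeasure mG A)"


section \<open>Levy processes\<close>

definition levy_process :: "'a measure \<Rightarrow> (real \<Rightarrow> 'a \<Rightarrow> 'g::lca_group) \<Rightarrow> bool" where
  "levy_process N X \<longleftrightarrow>
     (\<forall>t\<ge>0. X t \<in> borel_measurable N) \<and>
     (AE \<omega> in N. X 0 \<omega> = 0) \<and>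
     (\<forall>s\<ge>0. \<forall>t\<ge>0.
        (\<lambda>\<omega>. X (t + s) \<omega> - X s \<omega>) \<in> borel_measurable N \<and>
        distr N borel (\<lambda>\<omega>. X (t + s) \<omega> - X s \<omega>) = distr N borel (X t) \<and>
        prob_space.indep_set N
          {(\<lambda>\<omega>. X (t + s) \<omega> - X s \<omega>) -` B \<inter> space N | B. B \<in> sets borel}
          (sigma_sets (space N) {X r -` B \<inter> space N | r B. r \<in> {0..s} \<and> B \<in> sets borel})) \<and>
     (AE \<omega> in N. \<forall>t\<ge>0. ((\<lambda>s. X s \<omega>) \<longlongrightarrow> X t \<omega>) (at_right t) \<and>
        (t > 0 \<longrightarrow> (\<exists>l. ((\<lambda>s. X s \<omega>) \<longlongrightarrow> l) (at_left t))))"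

text \<open>For a Levy process the defining equation has exactly one solution \<open>z\<close>, for each
  character \<open>\<eta>\<close>, because \<open>t \<mapsto> E \<eta>(X\<^sub>t)\<close> is a right-continuous multiplicative semigroup.\<close>

definition char_exponent ::
    "'a measure \<Rightarrow> (real \<Rightarrow> 'a \<Rightarrow> 'g::lca_group) \<Rightarrow> ('g \<Rightarrow> complex) \<Rightarrow> complex" where
  "char_exponent N X \<eta> =
     (THE z. \<forall>t\<ge>0. (\<integral>\<omega>. \<eta> (X t \<omega>) \<partial>N) = exp (- (complex_of_real t * z)))"

text \<open>The integral is finite for one \<open>\<beta> > 0\<close> if and only if it is finite for all of them.\<close>

definition dalang ::
    "('g \<Rightarrow> complex) measure \<Rightarrow> 'a measure \<Rightarrow> (real \<Rightarrow> 'a \<Rightarrow> 'g::lca_group) \<Rightarrow> bool" where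
  "dalang md N X \<longleftrightarrow>
     (\<exists>\<beta>>0. (\<integral>\<^sup>+\<eta>. ennreal (1 / (\<beta> + Re (char_exponent N X \<eta>))) \<partial>md) < \<infinity>)"

definition semigroup_op ::
    "'a measure \<Rightarrow> (real \<Rightarrow> 'a \<Rightarrow> 'g::lca_group) \<Rightarrow> real \<Rightarrow> ('g \<Rightarrow> real) \<Rightarrow> 'g \<Rightarrow> real" where
  "semigroup_op N X t f x = (\<integral>\<omega>. f (x + X t \<omega>) \<partial>N)"

text \<open>The generator as a graph: the set of pairs \<open>(f, g)\<close> where \<open>f\<close> represents an element of
  the domain and \<open>g\<close> represents its image.\<close>

definition L2_generator ::
    "'g measure \<Rightarrow> 'a measure \<Rightarrow> (real \<Rightarrow> 'a \<Rightarrow> 'g::lca_group) \<Rightarrow> (('g \<Rightarrow> real) \<times> ('g \<Rightarrow> real)) set" where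
  "L2_generator m N X = {(f, g). f \<in> sq_integrable m \<and> g \<in> sq_integrable m \<and>
     ((\<lambda>t. sq_norm m (\<lambda>x. (semigroup_op N X t f x - f x) / t - g x)) \<longlongrightarrow> 0) (at_right 0)}"

text \<open>The integral is real, since the exponent at the conjugate character is the conjugate of
  the exponent; \<open>Re\<close> only adjusts the type.\<close>

definition trans_density ::
    "('g \<Rightarrow> complex) measure \<Rightarrow> 'a measure \<Rightarrow> (real \<Rightarrow> 'a \<Rightarrow> 'g::lca_group) \<Rightarrow> real \<Rightarrow> 'g \<Rightarrow> real" where
  "trans_density md N X t x =
     Re (\<integral>\<eta>. \<eta> (- x) * exp (- (complex_of_real t * char_exponent N X \<eta>)) \<partial>md)"


section \<open>Space-time white noise\<close>

abbreviation time_borel :: "real measure" where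
  "time_borel \<equiv> restrict_space borel {0..}"

text \<open>The product of Lebesgue measure on the half-line and \<open>m\<close>. The library's product measure is
  only meaningful when its right factor is \<open>\<sigma>\<close>-finite, which \<open>m\<close> need not be; hence the product is
  formed in the other order and then swapped. As the half-line is second countable, the
  measurable sets are all Borel subsets of the topological product.\<close>

definition spacetime :: "'g::lca_group measure \<Rightarrow> (real \<times> 'g) measure" where
  "spacetime m = distr (m \<Otimes>\<^sub>M restrict_space lborel {0..}) (time_borel \<Otimes>\<^sub>M borel) (\<lambda>(x, t). (t, x))"

lemma emeasure_spacetime_Times:
  assumes m: "sets m = sets borel" and A: "A \<in> sets borel" "A \<subseteq> {0..}" and B: "B \<in> sets borel"
  shows "emeasure (spacetime m) (A \<times> B) = emeasure lborel A * emeasure m B"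
proof -
  interpret L: sigma_finite_measure "restrict_space lborel {0::real..}"
    by (rule sigma_finite_measure_restrict_space) (auto intro: lborel.sigma_finite_measure_axioms)
  have sp: "space m = UNIV"
    using sets_eq_imp_space_eq[OF m] by simp
  have mL: "sets (m \<Otimes>\<^sub>M restrict_space lborel {0::real..}) = sets (borel \<Otimes>\<^sub>M time_borel)"
    by (intro sets_pair_measure_cong m sets_restrict_space_cong) simp
  have swap: "(\<lambda>(x, t). (t, x)) \<in> m \<Otimes>\<^sub>M restrict_space lborel {0..} \<rightarrow>\<^sub>M time_borel \<Otimes>\<^sub>M borel"
    unfolding measurable_cong_sets[OF mL refl] by (rule measurable_pair_swap')
  have A': "A \<in> sets time_borel" "A \<in> sets (restrict_space lborel {0..})"
    using A by (auto simp: sets_restrict_space_iff)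
  have "(\<lambda>(x, t). (t, x)) -` (A \<times> B) \<inter> space (m \<Otimes>\<^sub>M restrict_space lborel {0..}) = B \<times> A"
    using A(2) by (auto simp: space_pair_measure sp space_restrict_space)
  moreover have "A \<times> B \<in> sets (time_borel \<Otimes>\<^sub>M borel)"
    using A' B by auto
  ultimately have "emeasure (spacetime m) (A \<times> B) =
      emeasure (m \<Otimes>\<^sub>M restrict_space lborel {0..}) (B \<times> A)"
    unfolding spacetime_def using swap by (subst emeasure_distr) auto
  also have "\<dots> = emeasure m B * emeasure (restrict_space lborel {0..}) A"
    using B m A' by (intro L.emeasure_pair_measure_Times) auto
  also have "emeasure (restrict_space lborel {0..}) A = emeasure lborel A"
    using A by (intro emeasure_restrict_space) auto
  finally show ?thesis
    by (simp add: mult.commute)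
qed

definition finite_sets :: "'a measure \<Rightarrow> 'a set set" where
  "finite_sets m = {E \<in> sets m. emeasure m E < \<infinity>}"

definition centered_gaussian :: "'w measure \<Rightarrow> ('w \<Rightarrow> real) \<Rightarrow> bool" where
  "centered_gaussian M Y \<longleftrightarrow> Y \<in> borel_measurable M \<and>
     ((AE \<omega> in M. Y \<omega> = 0) \<or>
      (\<exists>s>0. distributed M lborel Y (\<lambda>x. ennreal (normal_density 0 s x))))"

definition white_noise ::
    "'w measure \<Rightarrow> 'g::lca_group measure \<Rightarrow> ((real \<times> 'g) set \<Rightarrow> 'w \<Rightarrow> real) \<Rightarrow> bool" where
  "white_noise M m \<xi> \<longleftrightarrow>
     (\<forall>I c. finite I \<and> I \<subseteq> finite_sets (spacetime m) \<longrightarrow>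
        centered_gaussian M (\<lambda>\<omega>. \<Sum>E\<in>I. c E * \<xi> E \<omega>)) \<and>
     (\<forall>E\<in>finite_sets (spacetime m). \<forall>F\<in>finite_sets (spacetime m).
        (\<integral>\<omega>. \<xi> E \<omega> * \<xi> F \<omega> \<partial>M) = measure (spacetime m) (E \<inter> F))"

text \<open>\<open>wiener_integral M m \<xi> \<phi> I\<close>: the random variable \<open>I\<close> is a version of the Wiener integral of
  \<open>\<phi>\<close>, i.e. an \<open>L\<^sup>2\<close>-limit of the integrals of step functions that converge to \<open>\<phi>\<close> in \<open>L\<^sup>2\<close>.
  A list of pairs \<open>(c, E)\<close> stands for the step function \<open>\<Sum> c 1\<^sub>E\<close>.\<close>

definition wiener_integral ::
    "'w measure \<Rightarrow> 'g::lca_group measure \<Rightarrow> ((real \<times> 'g) set \<Rightarrow> 'w \<Rightarrow> real) \<Rightarrow>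
     (real \<times> 'g \<Rightarrow> real) \<Rightarrow> ('w \<Rightarrow> real) \<Rightarrow> bool" where
  "wiener_integral M m \<xi> \<phi> I \<longleftrightarrow>
     \<phi> \<in> sq_integrable (spacetime m) \<and> I \<in> sq_integrable M \<and>
     (\<exists>S :: nat \<Rightarrow> (real \<times> (real \<times> 'g) set) list.
        (\<forall>n. \<forall>(c, E)\<in>set (S n). E \<in> finite_sets (spacetime m)) \<and>
        (\<lambda>n. sq_norm (spacetime m) (\<lambda>z. \<phi> z - (\<Sum>(c, E)\<leftarrow>S n. c * indicator E z))) \<longlonglongrightarrow> 0 \<and>
        (\<lambda>n. sq_norm M (\<lambda>\<omega>. I \<omega> - (\<Sum>(c, E)\<leftarrow>S n. c * \<xi> E \<omega>))) \<longlonglongrightarrow> 0)"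

definition raw_filtration ::
    "'w measure \<Rightarrow> 'g::lca_group measure \<Rightarrow> ((real \<times> 'g) set \<Rightarrow> 'w \<Rightarrow> real) \<Rightarrow> real \<Rightarrow> 'w measure" where
  "raw_filtration M m \<xi> t = sigma (space M)
     ({I -` B \<inter> space M | I B s \<phi>. B \<in> sets borel \<and> s \<in> {0..t} \<and> \<phi> \<in> sq_integrable m \<and>
         wiener_integral M m \<xi> (\<lambda>(r, y). indicator {0<..<s} r * \<phi> y) I} \<union> null_sets M)"

definition noise_filtration ::
    "'w measure \<Rightarrow> 'g::lca_group measure \<Rightarrow> ((real \<times> 'g) set \<Rightarrow> 'w \<Rightarrow> real) \<Rightarrow> real \<Rightarrow> 'w measure" where
  "noise_filtration M m \<xi> t = sigma (space M) (\<Inter>r\<in>{t<..}. sets (raw_filtration M m \<xi> r))"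

text \<open>The noise that is induced on the target group by a topological isomorphism \<open>h\<close> with
  modulus \<open>\<mu>\<close>.\<close>

definition push_noise ::
    "('g \<Rightarrow> 'k) \<Rightarrow> real \<Rightarrow> ((real \<times> 'g) set \<Rightarrow> 'w \<Rightarrow> real) \<Rightarrow> (real \<times> 'k) set \<Rightarrow> 'w \<Rightarrow> real" where
  "push_noise h \<mu> \<xi> E \<omega> = sqrt \<mu> * \<xi> (map_prod id h -` E) \<omega>"

lemma push_noise_Times: "push_noise h \<mu> \<xi> (A \<times> B) \<omega> = sqrt \<mu> * \<xi> (A \<times> h -` B) \<omega>"
proof -
  have "map_prod id h -` (A \<times> B) = A \<times> h -` B"
    by auto
  then show ?thesis
    by (simp add: push_noise_def)
qed


section \<open>Stochastic convolution\<close>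

text \<open>Random fields are written \<open>Z t x \<omega>\<close>; only \<open>t \<ge> 0\<close> is relevant.\<close>

type_synonym ('g, 'w) field = "real \<Rightarrow> 'g \<Rightarrow> 'w \<Rightarrow> real"

definition random_field :: "'w measure \<Rightarrow> ('g::lca_group, 'w) field \<Rightarrow> bool" where
  "random_field M Z \<longleftrightarrow>
     (\<lambda>(\<omega>, t, x). Z t x \<omega>) \<in> borel_measurable (M \<Otimes>\<^sub>M (time_borel \<Otimes>\<^sub>M borel))"

definition second_moment :: "'w measure \<Rightarrow> 'g measure \<Rightarrow> ('g, 'w) field \<Rightarrow> real \<Rightarrow> ennreal" where
  "second_moment M m Z t = (\<integral>\<^sup>+\<omega>. sq_norm m (\<lambda>x. Z t x \<omega>) \<partial>M)"

text \<open>The square of the norm \<open>\<N>\<^sub>\<beta>\<close>.\<close>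

definition N_sq :: "'w measure \<Rightarrow> 'g measure \<Rightarrow> real \<Rightarrow> ('g, 'w) field \<Rightarrow> ennreal" where
  "N_sq M m \<beta> Z = (SUP t\<in>{0..}. ennreal (exp (- 2 * \<beta> * t)) * second_moment M m Z t)"

text \<open>The tuple \<open>(Y, a, b, \<psi>)\<close> represents the elementary field \<open>Y 1\<^bsub>[a,b)\<^esub>(t) \<psi>(x)\<close>, and a list of
  such tuples represents the sum of the corresponding fields.\<close>

type_synonym ('g, 'w) elem = "('w \<Rightarrow> real) \<times> real \<times> real \<times> ('g \<Rightarrow> real)"

fun elementary ::
    "'w measure \<Rightarrow> 'g::lca_group measure \<Rightarrow> ((real \<times> 'g) set \<Rightarrow> 'w \<Rightarrow> real) \<Rightarrow> ('g, 'w) elem \<Rightarrow> bool" where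
  "elementary M m \<xi> (Y, a, b, \<psi>) \<longleftrightarrow>
     0 \<le> a \<and> a < b \<and>
     continuous_on UNIV \<psi> \<and> compact (closure {x. \<psi> x \<noteq> 0}) \<and>
     Y \<in> sq_integrable M \<and> Y \<in> borel_measurable (noise_filtration M m \<xi> a)"

definition simple_field :: "('g, 'w) elem list \<Rightarrow> ('g, 'w) field" where
  "simple_field es t x \<omega> = (\<Sum>(Y, a, b, \<psi>)\<leftarrow>es. Y \<omega> * indicator {a..<b} t * \<psi> x)"

text \<open>The completion \<open>\<P>\<^sup>2\<^sub>\<beta>\<close>, realized by the random fields that are \<open>\<N>\<^sub>\<beta>\<close>-limits of
  simple ones. Fields at \<open>\<N>\<^sub>\<beta>\<close>-distance zero represent the same element.\<close>

definition P2 ::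
    "'w measure \<Rightarrow> 'g::lca_group measure \<Rightarrow> ((real \<times> 'g) set \<Rightarrow> 'w \<Rightarrow> real) \<Rightarrow> real \<Rightarrow> ('g, 'w) field set" where
  "P2 M m \<xi> \<beta> = {Z. random_field M Z \<and>
     (\<exists>S. (\<forall>n. list_all (elementary M m \<xi>) (S n)) \<and>
        (\<lambda>n::nat. N_sq M m \<beta> (\<lambda>t x \<omega>. Z t x \<omega> - simple_field (S n) t x \<omega>)) \<longlonglongrightarrow> 0)}"

definition kernel_space :: "'g::lca_group measure \<Rightarrow> real \<Rightarrow> (real \<Rightarrow> 'g \<Rightarrow> real) set" where
  "kernel_space m \<beta> = {K.
     (\<lambda>(s, x). K s x) \<in> borel_measurable (restrict_space borel {0<..} \<Otimes>\<^sub>M borel) \<and>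
     (\<integral>\<^sup>+s. ennreal (exp (- 2 * \<beta> * s)) * sq_norm m (K s) * indicator {0<..} s \<partial>lborel) < \<infinity>}"

text \<open>In the following three definitions the last argument \<open>W\<close> is a version of the stochastic
  convolution. As the Wiener integral is determined only almost surely for each \<open>(t, x)\<close>, versions
  are required to be jointly measurable elements of \<open>\<P>\<^sup>2\<^sub>\<beta>\<close>.\<close>

fun conv_elementary ::
    "'w measure \<Rightarrow> 'g::lca_group measure \<Rightarrow> ((real \<times> 'g) set \<Rightarrow> 'w \<Rightarrow> real) \<Rightarrow> real \<Rightarrow>
     (real \<Rightarrow> 'g \<Rightarrow> real) \<Rightarrow> ('g, 'w) elem \<Rightarrow> ('g, 'w) field \<Rightarrow> bool" where
  "conv_elementary M m \<xi> \<beta> K (Y, a, b, \<psi>) W \<longleftrightarrow>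
     W \<in> P2 M m \<xi> \<beta> \<and>
     (\<forall>t\<ge>0. \<forall>x. \<exists>I.
        wiener_integral M m \<xi>
          (\<lambda>(s, y). indicator {0<..<t} s * indicator {a..<b} s * K (t - s) (y - x) * \<psi> y) I \<and>
        (AE \<omega> in M. W t x \<omega> = Y \<omega> * I \<omega>))"

definition conv_simple ::
    "'w measure \<Rightarrow> 'g::lca_group measure \<Rightarrow> ((real \<times> 'g) set \<Rightarrow> 'w \<Rightarrow> real) \<Rightarrow> real \<Rightarrow>
     (real \<Rightarrow> 'g \<Rightarrow> real) \<Rightarrow> ('g, 'w) elem list \<Rightarrow> ('g, 'w) field \<Rightarrow> bool" where
  "conv_simple M m \<xi> \<beta> K es W \<longleftrightarrow>
     (\<exists>Ws. list_all2 (conv_elementary M m \<xi> \<beta> K) es Ws \<and>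
        (\<forall>t x \<omega>. W t x \<omega> = (\<Sum>V\<leftarrow>Ws. V t x \<omega>)))"

definition stochastic_convolution ::
    "'w measure \<Rightarrow> 'g::lca_group measure \<Rightarrow> ((real \<times> 'g) set \<Rightarrow> 'w \<Rightarrow> real) \<Rightarrow> real \<Rightarrow>
     (real \<Rightarrow> 'g \<Rightarrow> real) \<Rightarrow> ('g, 'w) field \<Rightarrow> ('g, 'w) field \<Rightarrow> bool" where
  "stochastic_convolution M m \<xi> \<beta> K Z W \<longleftrightarrow>
     K \<in> kernel_space m \<beta> \<and> Z \<in> P2 M m \<xi> \<beta> \<and> W \<in> P2 M m \<xi> \<beta> \<and>
     (\<exists>S V. (\<forall>n. list_all (elementary M m \<xi>) (S n) \<and> conv_simple M m \<xi> \<beta> K (S n) (V n)) \<and>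
        (\<lambda>n::nat. N_sq M m \<beta> (\<lambda>t x \<omega>. Z t x \<omega> - simple_field (S n) t x \<omega>)) \<longlonglongrightarrow> 0 \<and>
        (\<lambda>n::nat. N_sq M m \<beta> (\<lambda>t x \<omega>. W t x \<omega> - V n t x \<omega>)) \<longlonglongrightarrow> 0)"


section \<open>Mild solutions\<close>

text \<open>\<open>mild_solution M m md N X L \<sigma> lam \<xi> u0 u\<close>: the field \<open>u\<close> is a mild solution of
  \<open>\<partial>\<^sub>t u = L u + lam \<sigma>(u) \<xi>\<close> with initial value \<open>u0\<close>, where \<open>L\<close> is the \<open>L\<^sup>2\<close>-generator of the
  Levy process \<open>X\<close>. The noise lives on the probability space \<open>M\<close>. The process \<open>X\<close>, which enters
  only through its law, lives on a possibly different probability space \<open>N\<close>.\<close>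

definition mild_solution ::
    "'w measure \<Rightarrow> 'g::lca_group measure \<Rightarrow> ('g \<Rightarrow> complex) measure \<Rightarrow>
     'a measure \<Rightarrow> (real \<Rightarrow> 'a \<Rightarrow> 'g) \<Rightarrow> (('g \<Rightarrow> real) \<times> ('g \<Rightarrow> real)) set \<Rightarrow>
     (real \<Rightarrow> real) \<Rightarrow> real \<Rightarrow> ((real \<times> 'g) set \<Rightarrow> 'w \<Rightarrow> real) \<Rightarrow>
     ('g \<Rightarrow> real) \<Rightarrow> ('g, 'w) field \<Rightarrow> bool" where
  "mild_solution M m md N X L \<sigma> lam \<xi> u0 u \<longleftrightarrow>
     L = L2_generator m N X \<and>
     (\<forall>t\<ge>0. AE \<omega> in M. (\<lambda>x. u t x \<omega>) \<in> sq_integrable m) \<and>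
     (AE \<omega> in M. AE x in m. u 0 x \<omega> = u0 x) \<and>
     (\<exists>\<beta>>0. u \<in> P2 M m \<xi> \<beta> \<and>
        (\<exists>W. stochastic_convolution M m \<xi> \<beta> (trans_density md N X) (\<lambda>t x \<omega>. \<sigma> (u t x \<omega>)) W \<and>
           (\<forall>t>0. AE \<omega> in M. AE x in m.
              u t x \<omega> = semigroup_op N X t u0 x + lam * W t x \<omega>)))"

definition exp_moment_bound :: "'w measure \<Rightarrow> 'g measure \<Rightarrow> ('g, 'w) field \<Rightarrow> bool" where
  "exp_moment_bound M m u \<longleftrightarrow>
     (\<exists>c1>0. \<exists>c2>0. \<forall>t\<ge>0. second_moment M m u t \<le> ennreal (c1 * exp (c2 * t)))"

definition modification :: "'w measure \<Rightarrow> 'g measure \<Rightarrow> ('g, 'w) field \<Rightarrow> ('g, 'w) field \<Rightarrow> bool" where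
  "modification M m u u' \<longleftrightarrow> (\<forall>t\<ge>0. AE \<omega> in M. AE x in m. u t x \<omega> = u' t x \<omega>)"

text \<open>\<open>u\<close> is (a version of) \<^emph>\<open>the\<close> mild solution: the one, up to modification, that satisfies
  an exponential moment bound.\<close>

definition the_mild_solution ::
    "'w measure \<Rightarrow> 'g::lca_group measure \<Rightarrow> ('g \<Rightarrow> complex) measure \<Rightarrow>
     'a measure \<Rightarrow> (real \<Rightarrow> 'a \<Rightarrow> 'g) \<Rightarrow> (('g \<Rightarrow> real) \<times> ('g \<Rightarrow> real)) set \<Rightarrow>
     (real \<Rightarrow> real) \<Rightarrow> real \<Rightarrow> ((real \<times> 'g) set \<Rightarrow> 'w \<Rightarrow> real) \<Rightarrow>
     ('g \<Rightarrow> real) \<Rightarrow> ('g, 'w) field \<Rightarrow> bool" where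
  "the_mild_solution M m md N X L \<sigma> lam \<xi> u0 u \<longleftrightarrow>
     mild_solution M m md N X L \<sigma> lam \<xi> u0 u \<and> exp_moment_bound M m u \<and>
     (\<forall>u'. mild_solution M m md N X L \<sigma> lam \<xi> u0 u' \<and> exp_moment_bound M m u' \<longrightarrow>
        modification M m u u')"

end

theory Submission
  imports Defs
begin

text \<open>Everything in the statement is natural in the group, so the proof transports each ingredient
along \<open>h\<close> and keeps track of the powers of \<open>\<mu>\<close>. Squared \<open>L\<^sup>2\<close> norms on \<open>\<Gamma>\<close> are \<open>\<mu>\<close> times those on
\<open>G\<close>, both for functions on the groups and for functions on space-time. Since \<open>\<xi>\<^sub>h\<close> carries the
factor \<open>\<surd>\<mu>\<close>, the Wiener integral of \<open>\<phi>\<close> with respect to \<open>\<xi>\<close> is that of \<open>\<phi> \<circ> h\<^sup>-\<^sup>1 / \<surd>\<mu>\<close> with respect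
to \<open>\<xi>\<^sub>h\<close> (lemma \<open>wiener_integral_push\<close>). Consequently both noises generate the same filtration, and
simple fields, \<open>\<P>\<^sup>2\<^sub>\<beta>\<close> and the norms \<open>\<N>\<^sub>\<beta>\<close> on the two groups correspond to each other. The transition
density of \<open>h \<circ> X\<close> is \<open>p \<circ> h\<^sup>-\<^sup>1 / \<mu>\<close>; the convolution with this kernel against \<open>\<xi>\<^sub>h\<close> is the old
convolution divided by \<open>\<surd>\<mu>\<close> (lemma \<open>stochastic_convolution_push\<close>), and the noise level \<open>\<lambda> \<surd>\<mu>\<close>
restores the factor. Hence \<open>u \<circ> h\<^sup>-\<^sup>1\<close> is a mild solution on \<open>\<Gamma>\<close>. Uniqueness on \<open>\<Gamma>\<close> follows from
uniqueness on \<open>G\<close>, because the same transport applies to \<open>h\<^sup>-\<^sup>1\<close>, whose modulus is \<open>1 / \<mu>\<close>.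

The one ingredient that is not formal is the factor \<open>1 / \<mu>\<close> in the density and the transport of
Dalang's condition. Both are integrals over the dual groups, so one has to know that the given
Haar measure of \<open>\<Gamma>\<^sup>*\<close> is \<open>1 / \<mu>\<close> times the image of the Haar measure of \<open>G\<^sup>*\<close> under
\<open>\<gamma> \<mapsto> \<gamma> \<circ> h\<^sup>-\<^sup>1\<close>. A change of variables shows that this image is a Radon measure which satisfies the
Plancherel identity of \<open>\<Gamma>\<close>, and lemma \<open>plancherel_measure_unique\<close> says that the Plancherel identity
determines a Radon measure on the dual group. The reason is that real trigonometric polynomials
\<open>p\<close> are Fourier multipliers, which, with \<open>F\<close> for the Fourier transform, gives \<open>\<integral> p\<^sup>2 \<bar>F f\<bar>\<^sup>2\<close> the same value for both measures; by the
Stone-Weierstrass theorem \<open>p\<close> can be taken close to the indicator of a compact set, and \<open>f\<close> can be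
taken with \<open>F f\<close> close to 1 on that set.\<close>


section \<open>Isomorphisms of measure spaces up to a scalar\<close>

text \<open>The transport is always along a bijection that multiplies a measure by a constant: \<open>h\<close> itself,
its product with the identity of the time axis, and its adjoint between the dual groups. The
bijection is one of the whole types, also when the measures live on proper subsets such as a set of
characters; so functions can be moved back and forth by composition alone.\<close>

locale scaling_iso =
  fixes M :: "'a measure" and N :: "'b measure" and g :: "'a \<Rightarrow> 'b" and c :: real
  assumes bij_g: "bij g"
    and measurable_g: "g \<in> measurable M N"
    and measurable_inv_g: "inv g \<in> measurable N M"
    and scale_pos: "0 < c"
    and emeasure_image: "\<And>E. E \<in> sets N \<Longrightarrow> emeasure N E = ennreal c * emeasure M (g -` E \<inter> space M)"
begin

lemma inv_g [simp]: "inv g (g x) = x" "g (inv g y) = y"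
  using bij_g by (simp_all add: bij_is_inj bij_is_surj surj_f_inv_f)

lemma borel_measurable_comp_iff:
  "(\<lambda>x. f (g x)) \<in> borel_measurable M \<longleftrightarrow> f \<in> borel_measurable N"
proof
  assume "(\<lambda>x. f (g x)) \<in> borel_measurable M"
  from measurable_compose[OF measurable_inv_g this] show "f \<in> borel_measurable N" by simp
qed (rule measurable_compose[OF measurable_g])

lemma scaling_iso_inverse: "scaling_iso N M (inv g) (1 / c)"
proof
  show "bij (inv g)" using bij_g by (rule bij_imp_bij_inv)
  show "inv g \<in> measurable N M" by (rule measurable_inv_g)
  show "inv (inv g) \<in> measurable M N" using measurable_g bij_g by (simp add: inv_inv_eq)
  show "0 < 1 / c" using scale_pos by simp
  fix E assume E: "E \<in> sets M"
  have "g -` (inv g -` E \<inter> space N) \<inter> space M = E"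
    using sets.sets_into_space[OF E] measurable_space[OF measurable_g] by auto
  moreover have "inv g -` E \<inter> space N \<in> sets N"
    using measurable_inv_g E by measurable
  ultimately have *: "emeasure N (inv g -` E \<inter> space N) = ennreal c * emeasure M E"
    using emeasure_image by metis
  have "ennreal (1 / c) * ennreal c = 1"
    using scale_pos by (simp add: ennreal_mult[symmetric])
  then show "emeasure M E = ennreal (1 / c) * emeasure N (inv g -` E \<inter> space N)"
    unfolding * by (simp add: mult.assoc[symmetric])
qed

lemma eq_scaled_distr: "N = scale_measure (ennreal c) (distr M N g)"
  by (rule measure_eqI) (simp_all add: emeasure_image emeasure_distr[OF measurable_g])

text \<open>The integral of an arbitrary function is a supremum over simple functions below it, and simple
functions can be transported. The generality matters for the characteristic exponent, whose
measurability on the dual group is not at hand.\<close>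

lemma nn_integral_le: "(\<integral>\<^sup>+y. f y \<partial>N) \<le> ennreal c * (\<integral>\<^sup>+x. f (g x) \<partial>M)"
  unfolding nn_integral_def[of N f]
proof (rule SUP_least, safe)
  fix s assume s: "simple_function N s" "s \<le> f"
  have [measurable]: "s \<in> borel_measurable N"
    using s(1) by (rule borel_measurable_simple_function)
  have "integral\<^sup>S N s = (\<integral>\<^sup>+y. s y \<partial>N)"
    using s(1) by (simp add: nn_integral_eq_simple_integral)
  also have "\<dots> = (\<integral>\<^sup>+y. s y \<partial>scale_measure (ennreal c) (distr M N g))"
    using eq_scaled_distr by simp
  also have "\<dots> = ennreal c * (\<integral>\<^sup>+x. s (g x) \<partial>M)"
    using measurable_g by (subst nn_integral_scale_measure) (simp_all add: nn_integral_distr)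
  also have "\<dots> \<le> ennreal c * (\<integral>\<^sup>+x. f (g x) \<partial>M)"
    using s(2) by (intro mult_left_mono nn_integral_mono) (auto simp: le_fun_def)
  finally show "integral\<^sup>S N s \<le> ennreal c * (\<integral>\<^sup>+x. f (g x) \<partial>M)" .
qed

lemma nn_integral_image: "(\<integral>\<^sup>+y. f y \<partial>N) = ennreal c * (\<integral>\<^sup>+x. f (g x) \<partial>M)"
proof (rule antisym[OF nn_integral_le])
  interpret inv: scaling_iso N M "inv g" "1 / c" by (rule scaling_iso_inverse)
  have "ennreal c * (\<integral>\<^sup>+x. f (g x) \<partial>M) \<le> ennreal c * (ennreal (1 / c) * (\<integral>\<^sup>+y. f y \<partial>N))"
    using inv.nn_integral_le[of "\<lambda>x. f (g x)"] by (intro mult_left_mono) simp_all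
  also have "\<dots> = (\<integral>\<^sup>+y. f y \<partial>N)"
    using scale_pos by (simp add: mult.assoc[symmetric] ennreal_mult[symmetric])
  finally show "ennreal c * (\<integral>\<^sup>+x. f (g x) \<partial>M) \<le> (\<integral>\<^sup>+y. f y \<partial>N)" .
qed

lemma integrable_comp_iff:
  fixes f :: "'b \<Rightarrow> 'c::{banach, second_countable_topology}"
  shows "integrable M (\<lambda>x. f (g x)) \<longleftrightarrow> integrable N f"
  unfolding integrable_iff_bounded nn_integral_image[of "\<lambda>y. ennreal (norm (f y))"]
    borel_measurable_comp_iff
  using scale_pos by (auto simp: ennreal_mult_less_top)

lemma integral_image:
  fixes f :: "'b \<Rightarrow> 'c::{banach, second_countable_topology}"
  shows "(\<integral>y. f y \<partial>N) = c *\<^sub>R (\<integral>x. f (g x) \<partial>M)"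
proof (cases "f \<in> borel_measurable N")
  case True
  have "(\<integral>y. f y \<partial>N) = (\<integral>y. f y \<partial>scale_measure (ennreal c) (distr M N g))"
    using eq_scaled_distr by simp
  also have "scale_measure (ennreal c) (distr M N g) = density (distr M N g) (\<lambda>_. ennreal c)"
    by (rule measure_eqI) (simp_all add: emeasure_density nn_integral_cmult_indicator)
  also have "(\<integral>y. f y \<partial>density (distr M N g) (\<lambda>_. ennreal c)) = c *\<^sub>R (\<integral>x. f (g x) \<partial>M)"
    using True measurable_g scale_pos
    by (subst integral_density) (simp_all add: integral_distr)
  finally show ?thesis .
next
  case False
  then have "\<not> integrable N f"
    by (auto dest: borel_measurable_integrable)
  moreover from this have "\<not> integrable M (\<lambda>x. f (g x))"
    by (simp add: integrable_comp_iff)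
  ultimately show ?thesis
    by (simp add: not_integrable_integral_eq)
qed

lemma AE_image_iff: "(AE y in N. P y) \<longleftrightarrow> (AE x in M. P (g x))"
proof -
  have 1: "AE y in N. P y" if sc: "scaling_iso M N g c" and P: "AE x in M. P (g x)"
    for M :: "'x measure" and N :: "'y measure" and g c P
  proof -
    interpret s: scaling_iso M N g c by (rule sc)
    from P obtain A where A: "{x \<in> space M. \<not> P (g x)} \<subseteq> A" "A \<in> sets M" "emeasure M A = 0"
      by (auto elim!: AE_E)
    have [measurable]: "inv g -` A \<inter> space N \<in> sets N"
      using s.measurable_inv_g A(2) by measurable
    have "g -` (inv g -` A \<inter> space N) \<inter> space M = A"
      using sets.sets_into_space[OF A(2)] measurable_space[OF s.measurable_g] by auto
    then have "emeasure N (inv g -` A \<inter> space N) = 0"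
      using A(3) by (simp add: s.emeasure_image)
    moreover have "{y \<in> space N. \<not> P y} \<subseteq> inv g -` A \<inter> space N"
      using A(1) measurable_space[OF s.measurable_inv_g] by force
    ultimately show ?thesis
      by (intro AE_I'[of "inv g -` A \<inter> space N"]) (auto simp: null_sets_def)
  qed
  show ?thesis
    using 1[OF scaling_iso_axioms, of P] 1[OF scaling_iso_inverse, of "\<lambda>x. P (g x)"] by auto
qed

lemma sq_norm_image: "sq_norm N f = ennreal c * sq_norm M (\<lambda>x. f (g x))"
  unfolding sq_norm_def by (rule nn_integral_image)

lemma sq_integrable_comp_iff: "(\<lambda>x. f (g x)) \<in> sq_integrable M \<longleftrightarrow> f \<in> sq_integrable N"
  using scale_pos unfolding sq_integrable_def
  by (auto simp: sq_norm_image[of f] borel_measurable_comp_iff ennreal_mult_less_top)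

end

text \<open>Second moments of random fields integrate the function \<open>\<omega> \<mapsto> \<parallel>Z\<^sub>t(\<omega>)\<parallel>\<^sup>2\<close>, whose measurability is
not clear when the Haar measure is not \<open>\<sigma>\<close>-finite. So the constant is moved through the supremum over
simple functions, once for \<open>c\<close> and once for \<open>1 / c\<close>.\<close>

lemma nn_integral_cmult_pos:
  fixes f :: "'a \<Rightarrow> ennreal"
  assumes c: "0 < c"
  shows "(\<integral>\<^sup>+x. ennreal c * f x \<partial>M) = ennreal c * (\<integral>\<^sup>+x. f x \<partial>M)"
proof -
  have le: "ennreal c * (\<integral>\<^sup>+x. f x \<partial>M) \<le> (\<integral>\<^sup>+x. ennreal c * f x \<partial>M)" for c and f :: "'a \<Rightarrow> ennreal"
  proof -
    have "ennreal c * (\<integral>\<^sup>+x. f x \<partial>M) = (SUP s\<in>{s. simple_function M s \<and> s \<le> f}. ennreal c * integral\<^sup>S M s)"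
      unfolding nn_integral_def by (rule SUP_mult_left_ennreal)
    also have "\<dots> \<le> (\<integral>\<^sup>+x. ennreal c * f x \<partial>M)"
    proof (rule SUP_least, safe)
      fix s assume s: "simple_function M s" "s \<le> f"
      have "ennreal c * integral\<^sup>S M s = integral\<^sup>S M (\<lambda>x. ennreal c * s x)"
        using s(1) by simp
      also have "\<dots> \<le> (\<integral>\<^sup>+x. ennreal c * f x \<partial>M)"
        unfolding nn_integral_def
        using s by (intro SUP_upper) (auto simp: le_fun_def intro!: mult_left_mono)
      finally show "ennreal c * integral\<^sup>S M s \<le> (\<integral>\<^sup>+x. ennreal c * f x \<partial>M)" .
    qed
    finally show ?thesis .
  qed
  have inv: "ennreal (1 / c) * ennreal c = 1" "ennreal c * ennreal (1 / c) = 1"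
    using c by (simp_all add: ennreal_mult[symmetric])
  have "(\<integral>\<^sup>+x. ennreal c * f x \<partial>M) = ennreal c * (ennreal (1 / c) * (\<integral>\<^sup>+x. ennreal c * f x \<partial>M))"
    by (simp add: mult.assoc[symmetric] inv)
  also have "\<dots> \<le> ennreal c * (\<integral>\<^sup>+x. ennreal (1 / c) * (ennreal c * f x) \<partial>M)"
    by (intro mult_left_mono le) simp
  also have "\<dots> = ennreal c * (\<integral>\<^sup>+x. f x \<partial>M)"
    by (simp add: mult.assoc[symmetric] inv)
  finally show ?thesis
    using le[of c f] by (rule antisym)
qed

lemma sq_norm_scale: "c \<noteq> 0 \<Longrightarrow> sq_norm m (\<lambda>x. c * f x) = ennreal (c\<^sup>2) * sq_norm m f"
  unfolding sq_norm_def by (simp add: power_mult_distrib ennreal_mult nn_integral_cmult_pos)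

lemma sq_integrable_scale: "f \<in> sq_integrable m \<Longrightarrow> (\<lambda>x. c * f x) \<in> sq_integrable m"
  by (cases "c = 0") (auto simp: sq_integrable_def sq_norm_scale ennreal_mult_less_top, simp add: sq_norm_def)


section \<open>Levy processes under isomorphisms of groups\<close>

locale group_iso =
  fixes h :: "'g::lca_group \<Rightarrow> 'k::lca_group"
  assumes top_iso: "topological_isomorphism h"
begin

lemma homeo: "homeomorphism UNIV UNIV h (inv h)"
  and h_add: "h (x + y) = h x + h y"
  using top_iso by (auto simp: topological_isomorphism_def)

lemma inv_h [simp]: "inv h (h x) = x" "h (inv h y) = y"
  using homeo by (auto simp: homeomorphism_def)

lemma bij_h: "bij h"
  by (rule o_bij[of "inv h"]) (auto simp: fun_eq_iff)

lemma continuous_h: "continuous_on A h" "continuous_on B (inv h)"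
  using homeo by (auto simp: homeomorphism_def intro: continuous_on_subset)

lemma measurable_h [measurable]: "h \<in> borel_measurable borel" "inv h \<in> borel_measurable borel"
  using continuous_h by (auto intro: borel_measurable_continuous_onI)

lemma h_0: "h 0 = 0"
  using h_add[of 0 0] by simp

lemma h_minus: "h (- x) = - h x"
  using h_add[of x "- x"] by (simp add: h_0 eq_neg_iff_add_eq_0 add.commute)

lemma h_diff: "h (x - y) = h x - h y"
  using h_add[of x "- y"] by (simp add: h_minus)

lemma inverse: "group_iso (inv h)"
proof
  have "inv h (x + y) = inv h x + inv h y" for x y
    using h_add[of "inv h x" "inv h y"] inv_h(1)[of "inv h x + inv h y"] by simp
  then show "topological_isomorphism (inv h)"
    using homeo by (simp add: topological_isomorphism_def inv_inv_eq[OF bij_h] homeomorphism_symD)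
qed

lemma inv_h_add: "inv h (x + y) = inv h x + inv h y"
  by (rule group_iso.h_add[OF inverse])

lemma inv_h_diff: "inv h (x - y) = inv h x - inv h y"
  by (rule group_iso.h_diff[OF inverse])

lemma compact_image_h: "compact K \<Longrightarrow> compact (h ` K)"
  by (rule compact_continuous_image[OF continuous_h(1)])

lemma levy_process_image:
  assumes N: "prob_space N" and X: "levy_process N X"
  shows "levy_process N (\<lambda>t \<omega>. h (X t \<omega>))"
proof -
  interpret N: prob_space N by (rule N)
  have mX[measurable]: "X t \<in> borel_measurable N" if "t \<ge> 0" for t
    using X that by (simp add: levy_process_def)
  have mD[measurable]: "(\<lambda>\<omega>. X (t + s) \<omega> - X s \<omega>) \<in> borel_measurable N" if "s \<ge> 0" "t \<ge> 0" for s t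
    using X that by (simp add: levy_process_def)
  have "(\<lambda>\<omega>. h (X (t + s) \<omega>) - h (X s \<omega>)) \<in> borel_measurable N" if "s \<ge> 0" "t \<ge> 0" for s t
    unfolding h_diff[symmetric] using that by measurable
  moreover have "distr N borel (\<lambda>\<omega>. h (X (t + s) \<omega>) - h (X s \<omega>)) = distr N borel (\<lambda>\<omega>. h (X t \<omega>))"
    if st: "s \<ge> 0" "t \<ge> 0" for s t
  proof -
    have "distr (distr N borel (\<lambda>\<omega>. X (t + s) \<omega> - X s \<omega>)) borel h = distr (distr N borel (X t)) borel h"
      using X st by (simp add: levy_process_def)
    then show ?thesis
      using st by (simp add: distr_distr comp_def h_diff)
  qed
  moreover have "N.indep_set
      {(\<lambda>\<omega>. h (X (t + s) \<omega>) - h (X s \<omega>)) -` B \<inter> space N | B. B \<in> sets borel}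
      (sigma_sets (space N) {(\<lambda>\<omega>. h (X r \<omega>)) -` B \<inter> space N | r B. r \<in> {0..s} \<and> B \<in> sets borel})"
    (is "N.indep_set ?A ?B") if st: "s \<ge> 0" "t \<ge> 0" for s t
  proof -
    let ?A' = "{(\<lambda>\<omega>. X (t + s) \<omega> - X s \<omega>) -` B \<inter> space N | B. B \<in> sets borel}"
    let ?B' = "sigma_sets (space N) {X r -` B \<inter> space N | r B. r \<in> {0..s} \<and> B \<in> sets borel}"
    have ind: "N.indep_set ?A' ?B'"
      using X st by (simp add: levy_process_def)
    have pre: "h -` B \<in> sets borel" if "B \<in> sets borel" for B
      using measurable_sets[OF measurable_h(1) that] by simp
    have "?A \<subseteq> ?A'"
    proof safe
      fix B :: "'k set" assume "B \<in> sets borel"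
      then show "\<exists>Ba. (\<lambda>\<omega>. h (X (t + s) \<omega>) - h (X s \<omega>)) -` B \<inter> space N =
          (\<lambda>\<omega>. X (t + s) \<omega> - X s \<omega>) -` Ba \<inter> space N \<and> Ba \<in> sets borel"
        by (intro exI[of _ "h -` B"]) (auto simp: h_diff pre)
    qed
    moreover have "?B \<subseteq> ?B'"
    proof (rule sigma_sets_mono')
      show "{(\<lambda>\<omega>. h (X r \<omega>)) -` B \<inter> space N | r B. r \<in> {0..s} \<and> B \<in> sets borel}
        \<subseteq> {X r -` B \<inter> space N | r B. r \<in> {0..s} \<and> B \<in> sets borel}"
      proof safe
        fix r and B :: "'k set" assume "r \<in> {0..s}" "B \<in> sets borel"
        then show "\<exists>ra Ba. (\<lambda>\<omega>. h (X r \<omega>)) -` B \<inter> space N = X ra -` Ba \<inter> space N \<and>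
            ra \<in> {0..s} \<and> Ba \<in> sets borel"
          by (intro exI[of _ r] exI[of _ "h -` B"]) (auto simp: pre)
      qed
    qed
    ultimately show ?thesis
      using ind unfolding N.indep_set_def
      by (elim N.indep_sets_mono_sets) (auto split: bool.split)
  qed
  moreover have "AE \<omega> in N. \<forall>t\<ge>0. ((\<lambda>s. h (X s \<omega>)) \<longlongrightarrow> h (X t \<omega>)) (at_right t) \<and>
        (t > 0 \<longrightarrow> (\<exists>l. ((\<lambda>s. h (X s \<omega>)) \<longlongrightarrow> l) (at_left t)))"
  proof -
    have lim: "((\<lambda>s. h (f s)) \<longlongrightarrow> h l) F" if "(f \<longlongrightarrow> l) F" for f :: "real \<Rightarrow> 'g" and l F
      using continuous_on_tendsto_compose[OF continuous_h(1)[of UNIV] that] by simp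
    have "AE \<omega> in N. \<forall>t\<ge>0. ((\<lambda>s. X s \<omega>) \<longlongrightarrow> X t \<omega>) (at_right t) \<and>
        (t > 0 \<longrightarrow> (\<exists>l. ((\<lambda>s. X s \<omega>) \<longlongrightarrow> l) (at_left t)))"
      using X by (simp add: levy_process_def)
    then show ?thesis
      by eventually_elim (use lim in blast)
  qed
  moreover have "AE \<omega> in N. h (X 0 \<omega>) = 0"
  proof -
    have "AE \<omega> in N. X 0 \<omega> = 0"
      using X by (simp add: levy_process_def)
    then show ?thesis by eventually_elim (simp add: h_0)
  qed
  moreover have "\<forall>t\<ge>0. (\<lambda>\<omega>. h (X t \<omega>)) \<in> borel_measurable N"
    by (auto intro: measurable_compose[OF mX])
  ultimately show ?thesis
    unfolding levy_process_def by blast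
qed

end


section \<open>Space-time measures and white noise\<close>

text \<open>Only the time axis is known to be \<open>\<sigma>\<close>-finite, so the sections over points of the group are measured first.\<close>

lemma emeasure_spacetime:
  assumes m: "sets m = sets borel" and E: "E \<in> sets (time_borel \<Otimes>\<^sub>M borel)"
  shows "emeasure (spacetime m) E =
    (\<integral>\<^sup>+x. emeasure (restrict_space lborel {0..}) {t. (t, x) \<in> E} \<partial>m)"
proof -
  interpret L: sigma_finite_measure "restrict_space lborel {0::real..}"
    by (rule sigma_finite_measure_restrict_space) (auto intro: lborel.sigma_finite_measure_axioms)
  have sp: "space m = UNIV"
    using sets_eq_imp_space_eq[OF m] by simp
  have mL: "sets (m \<Otimes>\<^sub>M restrict_space lborel {0::real..}) = sets (borel \<Otimes>\<^sub>M time_borel)"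
    by (intro sets_pair_measure_cong m sets_restrict_space_cong) simp
  have swap: "(\<lambda>(x, t). (t, x)) \<in> m \<Otimes>\<^sub>M restrict_space lborel {0..} \<rightarrow>\<^sub>M time_borel \<Otimes>\<^sub>M borel"
    unfolding measurable_cong_sets[OF mL refl] by (rule measurable_pair_swap')
  let ?S = "(\<lambda>(x, t). (t, x)) -` E \<inter> space (m \<Otimes>\<^sub>M restrict_space lborel {0..})"
  have "emeasure (spacetime m) E = emeasure (m \<Otimes>\<^sub>M restrict_space lborel {0..}) ?S"
    unfolding spacetime_def using swap E by (rule emeasure_distr)
  also have "\<dots> = (\<integral>\<^sup>+x. emeasure (restrict_space lborel {0..}) (Pair x -` ?S) \<partial>m)"
    using measurable_sets[OF swap E] by (rule L.emeasure_pair_measure_alt)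
  also have "(\<lambda>x. Pair x -` ?S) = (\<lambda>x. {t. (t, x) \<in> E})"
    using sets.sets_into_space[OF E] by (auto simp: space_pair_measure sp space_restrict_space)
  finally show ?thesis .
qed

lemma sets_spacetime [simp]: "sets (spacetime m) = sets (time_borel \<Otimes>\<^sub>M borel)"
  by (simp add: spacetime_def)

lemma space_spacetime: "space (spacetime m) = {0..} \<times> UNIV"
  by (simp add: spacetime_def space_pair_measure space_restrict_space)

lemma measurable_map_prod_time:
  assumes "f \<in> borel_measurable borel"
  shows "map_prod id f \<in> measurable (spacetime m) (spacetime m')"
proof -
  have "(\<lambda>z. (fst z, f (snd z))) \<in> time_borel \<Otimes>\<^sub>M borel \<rightarrow>\<^sub>M time_borel \<Otimes>\<^sub>M borel"
    by (intro measurable_Pair measurable_fst measurable_compose[OF measurable_snd assms])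
  then show ?thesis
    unfolding measurable_cong_sets[OF sets_spacetime sets_spacetime]
    by (simp add: map_prod_def case_prod_beta)
qed

locale haar_iso = group_iso h for h :: "'g::lca_group \<Rightarrow> 'k::lca_group" +
  fixes mG :: "'g measure" and m\<Gamma> :: "'k measure" and \<mu> :: real
  assumes sets_mG: "sets mG = sets borel" and sets_m\<Gamma>: "sets m\<Gamma> = sets borel"
    and modulus: "is_modulus mG m\<Gamma> h \<mu>"
begin

lemma \<mu>_pos: "0 < \<mu>"
  using modulus by (simp add: is_modulus_def)

lemma space_mG [simp]: "space mG = UNIV" and space_m\<Gamma> [simp]: "space m\<Gamma> = UNIV"
  using sets_eq_imp_space_eq[OF sets_mG] sets_eq_imp_space_eq[OF sets_m\<Gamma>] by simp_all

sublocale haar: scaling_iso mG m\<Gamma> h \<mu>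
proof
  show "h \<in> measurable mG m\<Gamma>" "inv h \<in> measurable m\<Gamma> mG"
    using measurable_h by (simp_all add: measurable_cong_sets[OF sets_mG sets_m\<Gamma>] measurable_cong_sets[OF sets_m\<Gamma> sets_mG])
  fix E assume "E \<in> sets m\<Gamma>"
  then have "h -` E \<in> sets borel"
    using measurable_sets[OF measurable_h(1), of E] by (simp add: sets_m\<Gamma>)
  moreover have "h ` (h -` E) = E"
    using bij_h by (simp add: bij_is_surj surj_image_vimage_eq)
  ultimately show "emeasure m\<Gamma> E = ennreal \<mu> * emeasure mG (h -` E \<inter> space mG)"
    using modulus by (metis is_modulus_def Int_UNIV_right space_mG)
qed (rule bij_h \<mu>_pos)+

text \<open>By this symmetry each transport is proved in one direction only.\<close>

lemma haar_iso_inverse: "haar_iso (inv h) m\<Gamma> mG (1 / \<mu>)"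
proof -
  interpret inv: group_iso "inv h" by (rule inverse)
  interpret haar_inv: scaling_iso m\<Gamma> mG "inv h" "1 / \<mu>" by (rule haar.scaling_iso_inverse)
  have "is_modulus m\<Gamma> mG (inv h) (1 / \<mu>)"
    unfolding is_modulus_def
  proof safe
    show "0 < 1 / \<mu>" using \<mu>_pos by simp
    fix A :: "'k set" assume A: "A \<in> sets borel"
    have eq: "inv h ` A = h -` A"
      using bij_h by (simp add: bij_vimage_eq_inv_image)
    have "inv h -` (h -` A) = A" by auto
    moreover have "h -` A \<in> sets mG"
      using measurable_sets[OF measurable_h(1) A] by (simp add: sets_mG)
    ultimately show "emeasure mG (inv h ` A) = ennreal (1 / \<mu>) * emeasure m\<Gamma> A"
      unfolding eq by (simp add: haar_inv.emeasure_image)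
  qed
  then show ?thesis
    by unfold_locales (rule sets_m\<Gamma> sets_mG)+
qed

abbreviation "hh \<equiv> map_prod (id :: real \<Rightarrow> real) h"

lemma bij_hh: "bij hh" and inv_hh: "inv hh = map_prod id (inv h)"
proof -
  have "hh \<circ> map_prod id (inv h) = id" "map_prod id (inv h) \<circ> hh = id"
    by (auto simp: fun_eq_iff)
  then show "bij hh" "inv hh = map_prod id (inv h)"
    by (auto intro: o_bij inv_unique_comp)
qed

sublocale st: scaling_iso "spacetime mG" "spacetime m\<Gamma>" hh \<mu>
proof
  show m1: "hh \<in> measurable (spacetime mG) (spacetime m\<Gamma>)"
    by (rule measurable_map_prod_time) (rule measurable_h)
  show "inv hh \<in> measurable (spacetime m\<Gamma>) (spacetime mG)"
    unfolding inv_hh by (rule measurable_map_prod_time) (rule measurable_h)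
  fix E assume E: "E \<in> sets (spacetime m\<Gamma>)"
  let ?L = "restrict_space lborel {0::real..}"
  have "emeasure (spacetime m\<Gamma>) E = (\<integral>\<^sup>+y. emeasure ?L {t. (t, y) \<in> E} \<partial>m\<Gamma>)"
    using E by (intro emeasure_spacetime sets_m\<Gamma>) simp
  also have "\<dots> = ennreal \<mu> * (\<integral>\<^sup>+x. emeasure ?L {t. (t, h x) \<in> E} \<partial>mG)"
    by (rule haar.nn_integral_image)
  also have "(\<integral>\<^sup>+x. emeasure ?L {t. (t, h x) \<in> E} \<partial>mG) =
      (\<integral>\<^sup>+x. emeasure ?L {t. (t, x) \<in> hh -` E \<inter> space (spacetime mG)} \<partial>mG)"
  proof -
    have "{t. (t, h x) \<in> E} = {t. (t, x) \<in> hh -` E \<inter> space (spacetime mG)}" for x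
      using sets.sets_into_space[OF E] by (auto simp: space_spacetime)
    then show ?thesis by simp
  qed
  also have "\<dots> = emeasure (spacetime mG) (hh -` E \<inter> space (spacetime mG))"
    using measurable_sets[OF m1 E] by (intro emeasure_spacetime[symmetric] sets_mG) simp
  finally show "emeasure (spacetime m\<Gamma>) E = ennreal \<mu> * emeasure (spacetime mG) (hh -` E \<inter> space (spacetime mG))" .
qed (rule bij_hh \<mu>_pos)+

end

lemma wiener_integral_scale:
  assumes c: "c \<noteq> 0" and I: "wiener_integral M m \<xi> \<phi> I"
  shows "wiener_integral M m \<xi> (\<lambda>z. c * \<phi> z) (\<lambda>\<omega>. c * I \<omega>)"
proof -
  obtain S where S: "\<And>n c E. (c, E) \<in> set (S n) \<Longrightarrow> E \<in> finite_sets (spacetime m)"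
    and lim: "(\<lambda>n. sq_norm (spacetime m) (\<lambda>z. \<phi> z - (\<Sum>(c, E)\<leftarrow>S n. c * indicator E z))) \<longlonglongrightarrow> 0"
      "(\<lambda>n. sq_norm M (\<lambda>\<omega>. I \<omega> - (\<Sum>(c, E)\<leftarrow>S n. c * \<xi> E \<omega>))) \<longlonglongrightarrow> 0"
    and int: "\<phi> \<in> sq_integrable (spacetime m)" "I \<in> sq_integrable M"
    using I unfolding wiener_integral_def by (clarsimp, fast)
  let ?S = "\<lambda>n. map (\<lambda>(d, E). (c * d, E)) (S n)"
  have sum: "(\<Sum>(d, E)\<leftarrow>?S n. d * f E) = c * (\<Sum>(d, E)\<leftarrow>S n. d * f E)" for f :: "_ \<Rightarrow> real" and n
    unfolding map_map sum_list_const_mult[symmetric] by (simp add: comp_def case_prod_beta mult.assoc)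
  have "(\<lambda>n. ennreal (c\<^sup>2) * sq_norm (spacetime m) (\<lambda>z. \<phi> z - (\<Sum>(d, E)\<leftarrow>S n. d * indicator E z))) \<longlonglongrightarrow> ennreal (c\<^sup>2) * 0"
    "(\<lambda>n. ennreal (c\<^sup>2) * sq_norm M (\<lambda>\<omega>. I \<omega> - (\<Sum>(d, E)\<leftarrow>S n. d * \<xi> E \<omega>))) \<longlonglongrightarrow> ennreal (c\<^sup>2) * 0"
    using lim by (intro ennreal_tendsto_cmult; simp)+
  then have "(\<lambda>n. sq_norm (spacetime m) (\<lambda>z. c * \<phi> z - (\<Sum>(d, E)\<leftarrow>?S n. d * indicator E z))) \<longlonglongrightarrow> 0"
    "(\<lambda>n. sq_norm M (\<lambda>\<omega>. c * I \<omega> - (\<Sum>(d, E)\<leftarrow>?S n. d * \<xi> E \<omega>))) \<longlonglongrightarrow> 0"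
    unfolding sum right_diff_distrib[symmetric] sq_norm_scale[OF c] by simp_all
  moreover have "\<forall>n. \<forall>(d, E)\<in>set (?S n). E \<in> finite_sets (spacetime m)"
    using S by auto
  ultimately show ?thesis
    unfolding wiener_integral_def using int by (intro conjI sq_integrable_scale exI[of _ ?S])
qed

lemma N_sq_scale:
  assumes c: "c \<noteq> 0"
  shows "N_sq M m \<beta> (\<lambda>t x \<omega>. c * Z t x \<omega>) = ennreal (c\<^sup>2) * N_sq M m \<beta> Z"
  using c unfolding N_sq_def second_moment_def
  by (simp add: sq_norm_scale nn_integral_cmult_pos SUP_mult_left_ennreal mult.left_commute)

lemma simple_field_scale:
  "simple_field (map (\<lambda>(Y, a, b, \<psi>). (\<lambda>\<omega>. c * Y \<omega>, a, b, \<psi>)) es) t x \<omega> = c * simple_field es t x \<omega>"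
  by (induction es) (auto simp: simple_field_def algebra_simps)

lemma P2_scale:
  assumes c: "c \<noteq> 0" and Z: "Z \<in> P2 M m \<xi> \<beta>"
  shows "(\<lambda>t x \<omega>. c * Z t x \<omega>) \<in> P2 M m \<xi> \<beta>"
proof -
  obtain S where S: "\<And>n. list_all (elementary M m \<xi>) (S n)"
    and lim: "(\<lambda>n. N_sq M m \<beta> (\<lambda>t x \<omega>. Z t x \<omega> - simple_field (S n) t x \<omega>)) \<longlonglongrightarrow> 0"
    using Z unfolding P2_def by blast
  let ?S = "\<lambda>n. map (\<lambda>(Y, a, b, \<psi>). (\<lambda>\<omega>. c * Y \<omega>, a, b, \<psi>)) (S n)"
  have "random_field M (\<lambda>t x \<omega>. c * Z t x \<omega>)"
  proof -
    have [measurable]: "(\<lambda>(\<omega>, t, x). Z t x \<omega>) \<in> borel_measurable (M \<Otimes>\<^sub>M (time_borel \<Otimes>\<^sub>M borel))"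
      using Z by (simp add: P2_def random_field_def)
    have "(\<lambda>p. c * (\<lambda>(\<omega>, t, x). Z t x \<omega>) p) \<in> borel_measurable (M \<Otimes>\<^sub>M (time_borel \<Otimes>\<^sub>M borel))"
      by measurable
    then show ?thesis
      by (simp add: random_field_def case_prod_beta)
  qed
  moreover have "list_all (elementary M m \<xi>) (?S n)" for n
  proof -
    have "elementary M m \<xi> (Y, a, b, \<psi>) \<Longrightarrow> elementary M m \<xi> (\<lambda>\<omega>. c * Y \<omega>, a, b, \<psi>)" for Y a b \<psi>
      by (auto intro: sq_integrable_scale)
    then show ?thesis
      using S[of n] by (auto simp: list_all_iff simp del: elementary.simps)
  qed
  moreover have "(\<lambda>n. N_sq M m \<beta> (\<lambda>t x \<omega>. c * Z t x \<omega> - simple_field (?S n) t x \<omega>)) \<longlonglongrightarrow> 0"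
  proof -
    have "(\<lambda>n. ennreal (c\<^sup>2) * N_sq M m \<beta> (\<lambda>t x \<omega>. Z t x \<omega> - simple_field (S n) t x \<omega>)) \<longlonglongrightarrow> ennreal (c\<^sup>2) * 0"
      using lim by (intro ennreal_tendsto_cmult) simp_all
    then show ?thesis
      unfolding simple_field_scale right_diff_distrib[symmetric] N_sq_scale[OF c] by simp
  qed
  ultimately show ?thesis
    unfolding P2_def by (intro CollectI conjI exI[of _ ?S] allI)
qed

context haar_iso
begin

lemma vimage_hh_inv: "map_prod id h -` (map_prod id (inv h) -` E) = E"
  by auto

lemma finite_sets_image:
  assumes "E \<in> finite_sets (spacetime mG)"
  shows "map_prod id (inv h) -` E \<in> finite_sets (spacetime m\<Gamma>)"
proof -
  have E: "E \<in> sets (spacetime mG)" "emeasure (spacetime mG) E < \<infinity>"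
    using assms by (auto simp: finite_sets_def)
  have sub: "map_prod id (inv h) -` E \<subseteq> space (spacetime m\<Gamma>)"
    using sets.sets_into_space[OF E(1)] by (auto simp: space_spacetime)
  have s: "map_prod id (inv h) -` E \<in> sets (spacetime m\<Gamma>)"
    using measurable_sets[OF st.measurable_inv_g E(1)] sub unfolding inv_hh by (simp add: Int_absorb2)
  show ?thesis
    using s E unfolding finite_sets_def
    by (simp add: st.emeasure_image vimage_hh_inv Int_absorb2[OF sets.sets_into_space[OF E(1)]] ennreal_mult_less_top
        del: sets_spacetime)
qed

lemma finite_sets_vimage:
  assumes "E \<in> finite_sets (spacetime m\<Gamma>)"
  shows "hh -` E \<in> finite_sets (spacetime mG)"
  using haar_iso.finite_sets_image[OF haar_iso_inverse assms] by (simp add: inv_inv_eq[OF bij_h])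

lemma white_noise_push:
  assumes \<xi>: "white_noise M mG \<xi>"
  shows "white_noise M m\<Gamma> (push_noise h \<mu> \<xi>)"
  unfolding white_noise_def
proof (intro conjI allI impI ballI)
  fix I and c :: "_ \<Rightarrow> real" assume I: "finite I \<and> I \<subseteq> finite_sets (spacetime m\<Gamma>)"
  let ?J = "(\<lambda>E. hh -` E) ` I" and ?c = "\<lambda>E :: (real \<times> 'g) set. sqrt \<mu> * c (map_prod id (inv h) -` E)"
  have inj: "inj_on (\<lambda>E. hh -` E) I"
    by (rule inj_on_inverseI[of _ "\<lambda>E. map_prod id (inv h) -` E"]) auto
  have "finite ?J \<and> ?J \<subseteq> finite_sets (spacetime mG)"
    using I by (auto intro: finite_sets_vimage)
  then have "centered_gaussian M (\<lambda>\<omega>. \<Sum>E\<in>?J. ?c E * \<xi> E \<omega>)"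
    by (rule \<xi>[unfolded white_noise_def, THEN conjunct1, rule_format])
  moreover have "(\<Sum>E\<in>?J. ?c E * \<xi> E \<omega>) = (\<Sum>E\<in>I. c E * push_noise h \<mu> \<xi> E \<omega>)" for \<omega>
  proof -
    have eq: "map_prod id (inv h) -` (hh -` E) = E" for E :: "(real \<times> 'k) set"
      by auto
    show ?thesis
      unfolding sum.reindex[OF inj] comp_def eq push_noise_def by (simp add: mult_ac)
  qed
  ultimately show "centered_gaussian M (\<lambda>\<omega>. \<Sum>E\<in>I. c E * push_noise h \<mu> \<xi> E \<omega>)"
    by simp
next
  fix E F assume EF: "E \<in> finite_sets (spacetime m\<Gamma>)" "F \<in> finite_sets (spacetime m\<Gamma>)"
  have "(\<integral>\<omega>. push_noise h \<mu> \<xi> E \<omega> * push_noise h \<mu> \<xi> F \<omega> \<partial>M) =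
      (\<integral>\<omega>. \<mu> * (\<xi> (hh -` E) \<omega> * \<xi> (hh -` F) \<omega>) \<partial>M)"
    using \<mu>_pos by (intro Bochner_Integration.integral_cong) (auto simp: push_noise_def)
  also have "\<dots> = \<mu> * (\<integral>\<omega>. \<xi> (hh -` E) \<omega> * \<xi> (hh -` F) \<omega> \<partial>M)"
    by simp
  also have "(\<integral>\<omega>. \<xi> (hh -` E) \<omega> * \<xi> (hh -` F) \<omega> \<partial>M) = measure (spacetime mG) (hh -` E \<inter> hh -` F)"
    using EF by (intro \<xi>[unfolded white_noise_def, THEN conjunct2, rule_format] finite_sets_vimage)
  also have "\<mu> * \<dots> = measure (spacetime m\<Gamma>) (E \<inter> F)"
  proof -
    have "E \<inter> F \<in> sets (spacetime m\<Gamma>)"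
      using EF unfolding finite_sets_def by blast
    moreover have "hh -` (E \<inter> F) \<subseteq> space (spacetime mG)"
      using sets.sets_into_space[OF calculation] by (auto simp: space_spacetime)
    ultimately have "emeasure (spacetime m\<Gamma>) (E \<inter> F) = ennreal \<mu> * emeasure (spacetime mG) (hh -` E \<inter> hh -` F)"
      by (simp add: st.emeasure_image Int_absorb2 del: sets_spacetime)
    then show ?thesis
      using \<mu>_pos by (simp add: measure_def enn2real_mult)
  qed
  finally show "(\<integral>\<omega>. push_noise h \<mu> \<xi> E \<omega> * push_noise h \<mu> \<xi> F \<omega> \<partial>M) = measure (spacetime m\<Gamma>) (E \<inter> F)" .
qed

lemma push_noise_inverse: "push_noise (inv h) (1 / \<mu>) (push_noise h \<mu> \<xi>) = \<xi>"
proof -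
  have "hh -` (map_prod id (inv h) -` E) = E" for E :: "(real \<times> 'g) set"
    by auto
  then show ?thesis
    using \<mu>_pos by (auto simp: fun_eq_iff push_noise_def real_sqrt_divide)
qed

text \<open>The integral itself is unchanged, so the same approximating sums serve on both sides: a term
\<open>c \<xi>(E)\<close> equals \<open>(c / \<surd>\<mu>) \<xi>\<^sub>h(h(E))\<close>, and the factor \<open>1 / \<surd>\<mu>\<close> in front of the integrand compensates
for the modulus in the space-time \<open>L\<^sup>2\<close> norm.\<close>

lemma wiener_integral_push:
  assumes I: "wiener_integral M mG \<xi> \<phi> I"
  shows "wiener_integral M m\<Gamma> (push_noise h \<mu> \<xi>) (\<lambda>z. \<phi> (map_prod id (inv h) z) / sqrt \<mu>) I"
proof -
  obtain S where S: "\<And>n c E. (c, E) \<in> set (S n) \<Longrightarrow> E \<in> finite_sets (spacetime mG)"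
    and lim: "(\<lambda>n. sq_norm (spacetime mG) (\<lambda>z. \<phi> z - (\<Sum>(c, E)\<leftarrow>S n. c * indicator E z))) \<longlonglongrightarrow> 0"
      "(\<lambda>n. sq_norm M (\<lambda>\<omega>. I \<omega> - (\<Sum>(c, E)\<leftarrow>S n. c * \<xi> E \<omega>))) \<longlonglongrightarrow> 0"
    and int: "\<phi> \<in> sq_integrable (spacetime mG)" "I \<in> sq_integrable M"
    using I unfolding wiener_integral_def by (clarsimp, fast)
  let ?S = "\<lambda>n. map (\<lambda>(c, E). (c / sqrt \<mu>, map_prod id (inv h) -` E)) (S n)"
  let ?\<phi> = "\<lambda>z. \<phi> (map_prod id (inv h) z) / sqrt \<mu>"
  have sqrt: "sqrt \<mu> \<noteq> 0" using \<mu>_pos by simp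
  have noise: "(\<Sum>(c, E)\<leftarrow>?S n. c * push_noise h \<mu> \<xi> E \<omega>) = (\<Sum>(c, E)\<leftarrow>S n. c * \<xi> E \<omega>)" for n \<omega>
    using sqrt by (simp add: comp_def case_prod_unfold push_noise_def vimage_hh_inv)
  have step: "sq_norm (spacetime m\<Gamma>) (\<lambda>z. ?\<phi> z - (\<Sum>(c, E)\<leftarrow>?S n. c * indicator E z)) =
      sq_norm (spacetime mG) (\<lambda>z. \<phi> z - (\<Sum>(c, E)\<leftarrow>S n. c * indicator E z))" for n
  proof -
    have [simp]: "map_prod id (inv h) (hh z) = z" for z
      by (cases z) simp
    have sum: "(\<Sum>(c, E)\<leftarrow>?S n. c * indicator E (hh z)) = (1 / sqrt \<mu>) * (\<Sum>(c, E)\<leftarrow>S n. c * indicator E z)" for z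
      unfolding sum_list_const_mult[symmetric]
      by (simp add: comp_def case_prod_unfold indicator_def of_bool_def)
    have "(\<lambda>z. ?\<phi> (hh z) - (\<Sum>(c, E)\<leftarrow>?S n. c * indicator E (hh z))) =
        (\<lambda>z. (1 / sqrt \<mu>) * (\<phi> z - (\<Sum>(c, E)\<leftarrow>S n. c * indicator E z)))"
      unfolding sum by (simp add: right_diff_distrib)
    then have "sq_norm (spacetime m\<Gamma>) (\<lambda>z. ?\<phi> z - (\<Sum>(c, E)\<leftarrow>?S n. c * indicator E z)) =
        ennreal \<mu> * (ennreal ((1 / sqrt \<mu>)\<^sup>2) *
          sq_norm (spacetime mG) (\<lambda>z. \<phi> z - (\<Sum>(c, E)\<leftarrow>S n. c * indicator E z)))"
      unfolding st.sq_norm_image[of "\<lambda>z. ?\<phi> z - (\<Sum>(c, E)\<leftarrow>?S n. c * indicator E z)"]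
      using sqrt by (simp only: sq_norm_scale divide_eq_0_iff not_False_eq_True one_neq_zero simp_thms)
    moreover have "ennreal \<mu> * ennreal ((1 / sqrt \<mu>)\<^sup>2) = 1"
      using \<mu>_pos by (simp add: ennreal_mult[symmetric] power_divide)
    ultimately show ?thesis
      by (simp add: mult.assoc[symmetric])
  qed
  have "(\<lambda>z. \<phi> (map_prod id (inv h) z)) \<in> sq_integrable (spacetime m\<Gamma>)"
    using int(1) st.sq_integrable_comp_iff[of "\<lambda>z. \<phi> (map_prod id (inv h) z)"]
    by (simp add: map_prod_def case_prod_beta)
  then have "?\<phi> \<in> sq_integrable (spacetime m\<Gamma>)"
    using sq_integrable_scale[of "\<lambda>z. \<phi> (map_prod id (inv h) z)" _ "1 / sqrt \<mu>"] by simp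
  moreover have "\<forall>n. \<forall>(d, E)\<in>set (?S n). E \<in> finite_sets (spacetime m\<Gamma>)"
    using S by (auto intro: finite_sets_image)
  ultimately show ?thesis
    unfolding wiener_integral_def using int(2) lim[folded step] lim(2)
    by (intro conjI exI[of _ ?S]) (simp_all only: noise)
qed

end


section \<open>Random fields and stochastic convolutions\<close>

context haar_iso
begin

text \<open>Applied to \<open>h\<close> and to its inverse, this inclusion shows that the two noises generate the same
filtration.\<close>

lemma raw_filtration_generators:
  "{I -` B \<inter> space M | I B s \<phi>. B \<in> sets borel \<and> s \<in> {0..t} \<and> \<phi> \<in> sq_integrable mG \<and>
      wiener_integral M mG \<xi> (\<lambda>(r, y). indicator {0<..<s} r * \<phi> y) I} \<subseteq>
   {I -` B \<inter> space M | I B s \<phi>. B \<in> sets borel \<and> s \<in> {0..t} \<and> \<phi> \<in> sq_integrable m\<Gamma> \<and>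
      wiener_integral M m\<Gamma> (push_noise h \<mu> \<xi>) (\<lambda>(r, y). indicator {0<..<s} r * \<phi> y) I}"
proof safe
  fix I and B :: "real set" and s \<phi>
  assume B: "B \<in> sets borel" and s: "s \<in> {0..t}" and \<phi>: "\<phi> \<in> sq_integrable mG"
    and I: "wiener_integral M mG \<xi> (\<lambda>(r, y). indicator {0<..<s} r * \<phi> y) I"
  have "(\<lambda>y. \<phi> (inv h y)) \<in> sq_integrable m\<Gamma>"
    using \<phi> haar.sq_integrable_comp_iff[of "\<lambda>y. \<phi> (inv h y)"] by simp
  then have \<phi>': "(\<lambda>y. \<phi> (inv h y) / sqrt \<mu>) \<in> sq_integrable m\<Gamma>"
    using sq_integrable_scale[of "\<lambda>y. \<phi> (inv h y)" _ "1 / sqrt \<mu>"] by simp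
  have "wiener_integral M m\<Gamma> (push_noise h \<mu> \<xi>) (\<lambda>(r, y). indicator {0<..<s} r * (\<phi> (inv h y) / sqrt \<mu>)) I"
    using wiener_integral_push[OF I] by (simp add: case_prod_unfold)
  with B s \<phi>' show "\<exists>I' B' s \<phi>. I -` B \<inter> space M = I' -` B' \<inter> space M \<and> B' \<in> sets borel \<and>
      s \<in> {0..t} \<and> \<phi> \<in> sq_integrable m\<Gamma> \<and>
      wiener_integral M m\<Gamma> (push_noise h \<mu> \<xi>) (\<lambda>(r, y). indicator {0<..<s} r * \<phi> y) I'"
    by (intro exI[of _ I] exI[of _ B] exI[of _ s] exI[of _ "\<lambda>y. \<phi> (inv h y) / sqrt \<mu>"]) simp
qed

lemma raw_filtration_push: "raw_filtration M m\<Gamma> (push_noise h \<mu> \<xi>) t = raw_filtration M mG \<xi> t"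
proof -
  interpret inv: haar_iso "inv h" m\<Gamma> mG "1 / \<mu>" by (rule haar_iso_inverse)
  have "{I -` B \<inter> space M | I B s \<phi>. B \<in> sets borel \<and> s \<in> {0..t} \<and> \<phi> \<in> sq_integrable mG \<and>
      wiener_integral M mG \<xi> (\<lambda>(r, y). indicator {0<..<s} r * \<phi> y) I} =
   {I -` B \<inter> space M | I B s \<phi>. B \<in> sets borel \<and> s \<in> {0..t} \<and> \<phi> \<in> sq_integrable m\<Gamma> \<and>
      wiener_integral M m\<Gamma> (push_noise h \<mu> \<xi>) (\<lambda>(r, y). indicator {0<..<s} r * \<phi> y) I}"
    by (rule antisym[OF raw_filtration_generators
        inv.raw_filtration_generators[of M t "push_noise h \<mu> \<xi>", unfolded push_noise_inverse]])
  then show ?thesis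
    by (simp add: raw_filtration_def)
qed

lemma noise_filtration_push: "noise_filtration M m\<Gamma> (push_noise h \<mu> \<xi>) = noise_filtration M mG \<xi>"
  unfolding noise_filtration_def raw_filtration_push ..

definition push_elem :: "('g, 'w) elem \<Rightarrow> ('k, 'w) elem" where
  "push_elem = (\<lambda>(Y, a, b, \<psi>). (Y, a, b, \<lambda>y. \<psi> (inv h y)))"

lemma elementary_push:
  assumes "elementary M mG \<xi> e"
  shows "elementary M m\<Gamma> (push_noise h \<mu> \<xi>) (push_elem e)"
proof -
  obtain Y a b \<psi> where e: "e = (Y, a, b, \<psi>)" by (cases e)
  have cont: "continuous_on UNIV \<psi>" and comp: "compact (closure {x. \<psi> x \<noteq> 0})"
    using assms by (simp_all add: e)
  have "continuous_on UNIV (\<lambda>y. \<psi> (inv h y))"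
    by (rule continuous_on_compose2[OF cont continuous_h(2)]) simp
  moreover have "compact (closure {y. \<psi> (inv h y) \<noteq> 0})"
  proof -
    have C: "compact (h ` closure {x. \<psi> x \<noteq> 0})"
      by (rule compact_image_h[OF comp])
    have "{y. \<psi> (inv h y) \<noteq> 0} \<subseteq> h ` closure {x. \<psi> x \<noteq> 0}"
      using closure_subset[of "{x. \<psi> x \<noteq> 0}"] by (force intro: image_eqI[of _ _ "inv h _"])
    then have "closure {y. \<psi> (inv h y) \<noteq> 0} \<subseteq> h ` closure {x. \<psi> x \<noteq> 0}"
      by (rule closure_minimal[OF _ compact_imp_closed[OF C]])
    then show ?thesis
      using compact_Int_closed[OF C closed_closure, of "{y. \<psi> (inv h y) \<noteq> 0}"] by (simp add: Int_absorb1)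
  qed
  ultimately show ?thesis
    using assms by (simp add: e push_elem_def noise_filtration_push)
qed

lemma simple_field_push: "simple_field (map push_elem es) t y \<omega> = simple_field es t (inv h y) \<omega>"
  by (simp add: simple_field_def push_elem_def comp_def case_prod_unfold)

lemma second_moment_push: "second_moment M m\<Gamma> (\<lambda>t y. Z t (inv h y)) t = ennreal \<mu> * second_moment M mG Z t"
  unfolding second_moment_def
  by (simp add: haar.sq_norm_image[of "\<lambda>y. Z t (inv h y) _"] nn_integral_cmult_pos[OF \<mu>_pos])

lemma N_sq_push: "N_sq M m\<Gamma> \<beta> (\<lambda>t y. Z t (inv h y)) = ennreal \<mu> * N_sq M mG \<beta> Z"
  unfolding N_sq_def second_moment_push
  by (simp add: SUP_mult_left_ennreal mult.left_commute)

lemma N_sq_push_limit: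
  assumes "(\<lambda>n::nat. N_sq M mG \<beta> (Z n)) \<longlonglongrightarrow> 0"
  shows "(\<lambda>n. N_sq M m\<Gamma> \<beta> (\<lambda>t y. Z n t (inv h y))) \<longlonglongrightarrow> 0"
proof -
  have "(\<lambda>n. ennreal \<mu> * N_sq M mG \<beta> (Z n)) \<longlonglongrightarrow> ennreal \<mu> * 0"
    using assms by (intro ennreal_tendsto_cmult) simp_all
  then show ?thesis
    by (simp add: N_sq_push)
qed

lemma random_field_push:
  assumes "random_field M Z"
  shows "random_field M (\<lambda>t y. Z t (inv h y))"
proof -
  have "(\<lambda>p. (fst p, fst (snd p), inv h (snd (snd p)))) \<in>
      M \<Otimes>\<^sub>M (time_borel \<Otimes>\<^sub>M borel) \<rightarrow>\<^sub>M M \<Otimes>\<^sub>M (time_borel \<Otimes>\<^sub>M borel)"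
    by (intro measurable_Pair measurable_fst measurable_compose[OF measurable_snd]
        measurable_compose[OF measurable_snd measurable_fst] 
        measurable_compose[OF measurable_snd measurable_compose[OF measurable_snd measurable_h(2)]])
  from measurable_compose[OF this assms[unfolded random_field_def]]
  show ?thesis
    by (simp add: random_field_def case_prod_unfold)
qed

lemma P2_push:
  assumes Z: "Z \<in> P2 M mG \<xi> \<beta>"
  shows "(\<lambda>t y. Z t (inv h y)) \<in> P2 M m\<Gamma> (push_noise h \<mu> \<xi>) \<beta>"
proof -
  obtain S where S: "\<And>n. list_all (elementary M mG \<xi>) (S n)"
    and lim: "(\<lambda>n. N_sq M mG \<beta> (\<lambda>t x \<omega>. Z t x \<omega> - simple_field (S n) t x \<omega>)) \<longlonglongrightarrow> 0"
    using Z unfolding P2_def by blast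
  have "random_field M (\<lambda>t y. Z t (inv h y))"
    using Z by (intro random_field_push) (simp add: P2_def)
  moreover have "list_all (elementary M m\<Gamma> (push_noise h \<mu> \<xi>)) (map push_elem (S n))" for n
    using S[of n] by (auto simp: list_all_iff intro: elementary_push)
  moreover have "(\<lambda>n. N_sq M m\<Gamma> \<beta> (\<lambda>t y \<omega>. Z t (inv h y) \<omega> - simple_field (map push_elem (S n)) t y \<omega>)) \<longlonglongrightarrow> 0"
    unfolding simple_field_push using N_sq_push_limit[OF lim] .
  ultimately show ?thesis
    unfolding P2_def by (intro CollectI conjI exI[of _ "\<lambda>n. map push_elem (S n)"] allI)
qed

lemma kernel_space_push:
  assumes K: "K \<in> kernel_space mG \<beta>"
  shows "(\<lambda>t y. K t (inv h y) / \<mu>) \<in> kernel_space m\<Gamma> \<beta>"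
proof -
  have "(\<lambda>p. (fst p, inv h (snd p))) \<in>
      restrict_space borel {0::real<..} \<Otimes>\<^sub>M borel \<rightarrow>\<^sub>M restrict_space borel {0<..} \<Otimes>\<^sub>M borel"
    by (intro measurable_Pair measurable_fst measurable_compose[OF measurable_snd measurable_h(2)])
  moreover have "(\<lambda>(s, x). K s x) \<in> borel_measurable (restrict_space borel {0<..} \<Otimes>\<^sub>M borel)"
    using K by (simp add: kernel_space_def)
  ultimately have "(\<lambda>p. (\<lambda>(s, x). K s x) (fst p, inv h (snd p))) \<in>
      borel_measurable (restrict_space borel {0<..} \<Otimes>\<^sub>M borel)"
    by (rule measurable_compose)
  then have "(\<lambda>p. (\<lambda>(s, x). K s x) (fst p, inv h (snd p)) / \<mu>) \<in>
      borel_measurable (restrict_space borel {0<..} \<Otimes>\<^sub>M borel)"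
    by (rule borel_measurable_divide) simp
  then have meas: "(\<lambda>(s, y). K s (inv h y) / \<mu>) \<in> borel_measurable (restrict_space borel {0<..} \<Otimes>\<^sub>M borel)"
    by (simp add: case_prod_unfold)
  have eq: "sq_norm m\<Gamma> (\<lambda>y. K s (inv h y) / \<mu>) = ennreal (1 / \<mu>) * sq_norm mG (K s)" for s
  proof -
    have "sq_norm m\<Gamma> (\<lambda>y. K s (inv h y) / \<mu>) = ennreal \<mu> * sq_norm mG (\<lambda>x. (1 / \<mu>) * K s x)"
      by (subst haar.sq_norm_image) simp
    also have "\<dots> = ennreal \<mu> * (ennreal ((1 / \<mu>)\<^sup>2) * sq_norm mG (K s))"
      using \<mu>_pos by (subst sq_norm_scale) simp_all
    also have "\<dots> = ennreal (1 / \<mu>) * sq_norm mG (K s)"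
      using \<mu>_pos by (simp add: mult.assoc[symmetric] ennreal_mult[symmetric] power2_eq_square)
    finally show ?thesis .
  qed
  have "(\<integral>\<^sup>+s. ennreal (exp (- 2 * \<beta> * s)) * sq_norm m\<Gamma> (\<lambda>y. K s (inv h y) / \<mu>) * indicator {0<..} s \<partial>lborel)
     = (\<integral>\<^sup>+s. ennreal (1 / \<mu>) * (ennreal (exp (- 2 * \<beta> * s)) * sq_norm mG (K s) * indicator {0<..} s) \<partial>lborel)"
    unfolding eq by (simp add: mult_ac)
  also have "\<dots> = ennreal (1 / \<mu>) * (\<integral>\<^sup>+s. ennreal (exp (- 2 * \<beta> * s)) * sq_norm mG (K s) * indicator {0<..} s \<partial>lborel)"
    using \<mu>_pos by (intro nn_integral_cmult_pos) simp
  also have "\<dots> < \<infinity>"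
    using K by (simp add: kernel_space_def ennreal_mult_less_top)
  finally show ?thesis
    using meas by (simp add: kernel_space_def)
qed

text \<open>The kernel and the convolution scale differently. The integrand on \<open>\<Gamma>\<close> is \<open>1 / \<mu>\<close> times the
transported one; of this, one factor \<open>1 / \<surd>\<mu>\<close> is absorbed by the normalization of \<open>\<xi>\<^sub>h\<close> and the
other one remains in front of the convolution.\<close>

lemma conv_elementary_push:
  assumes "conv_elementary M mG \<xi> \<beta> K e W"
  shows "conv_elementary M m\<Gamma> (push_noise h \<mu> \<xi>) \<beta> (\<lambda>t y. K t (inv h y) / \<mu>) (push_elem e)
    (\<lambda>t y \<omega>. W t (inv h y) \<omega> / sqrt \<mu>)"
proof -
  obtain Y a b \<psi> where e: "e = (Y, a, b, \<psi>)" by (cases e)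
  have W: "W \<in> P2 M mG \<xi> \<beta>"
    and I: "\<And>t x. t \<ge> 0 \<Longrightarrow> \<exists>I. wiener_integral M mG \<xi>
          (\<lambda>(s, y). indicator {0<..<t} s * indicator {a..<b} s * K (t - s) (y - x) * \<psi> y) I \<and>
        (AE \<omega> in M. W t x \<omega> = Y \<omega> * I \<omega>)"
    using assms unfolding e conv_elementary.simps by blast+
  have sqrt: "1 / sqrt \<mu> \<noteq> 0" using \<mu>_pos by simp
  have "(\<lambda>t y \<omega>. (1 / sqrt \<mu>) * W t (inv h y) \<omega>) \<in> P2 M m\<Gamma> (push_noise h \<mu> \<xi>) \<beta>"
    by (rule P2_scale[OF sqrt P2_push[OF W]])
  moreover have "\<exists>I. wiener_integral M m\<Gamma> (push_noise h \<mu> \<xi>)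
        (\<lambda>(s, y). indicator {0<..<t} s * indicator {a..<b} s * (K (t - s) (inv h (y - x)) / \<mu>) * \<psi> (inv h y)) I \<and>
        (AE \<omega> in M. W t (inv h x) \<omega> / sqrt \<mu> = Y \<omega> * I \<omega>)" if t: "t \<ge> 0" for t x
  proof -
    obtain I where I: "wiener_integral M mG \<xi>
          (\<lambda>(s, y). indicator {0<..<t} s * indicator {a..<b} s * K (t - s) (y - inv h x) * \<psi> y) I"
      and ae: "AE \<omega> in M. W t (inv h x) \<omega> = Y \<omega> * I \<omega>"
      using I[OF t] by blast
    from wiener_integral_scale[OF sqrt wiener_integral_push[OF I]]
    have "wiener_integral M m\<Gamma> (push_noise h \<mu> \<xi>)
        (\<lambda>(s, y). indicator {0<..<t} s * indicator {a..<b} s * (K (t - s) (inv h (y - x)) / \<mu>) * \<psi> (inv h y))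
        (\<lambda>\<omega>. (1 / sqrt \<mu>) * I \<omega>)"
      by (simp add: case_prod_unfold inv_h_diff abs_of_pos[OF \<mu>_pos])
    moreover have "AE \<omega> in M. W t (inv h x) \<omega> / sqrt \<mu> = Y \<omega> * ((1 / sqrt \<mu>) * I \<omega>)"
      using ae by eventually_elim simp
    ultimately show ?thesis by blast
  qed
  ultimately show ?thesis
    unfolding e push_elem_def by simp
qed

lemma conv_simple_push:
  assumes "conv_simple M mG \<xi> \<beta> K es W"
  shows "conv_simple M m\<Gamma> (push_noise h \<mu> \<xi>) \<beta> (\<lambda>t y. K t (inv h y) / \<mu>) (map push_elem es)
    (\<lambda>t y \<omega>. W t (inv h y) \<omega> / sqrt \<mu>)"
proof -
  obtain Ws where Ws: "list_all2 (conv_elementary M mG \<xi> \<beta> K) es Ws"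
    and W: "\<And>t x \<omega>. W t x \<omega> = (\<Sum>V\<leftarrow>Ws. V t x \<omega>)"
    using assms unfolding conv_simple_def by blast
  let ?p = "\<lambda>V t y \<omega>. V t (inv h y) \<omega> / sqrt \<mu>"
  have "list_all2 (conv_elementary M m\<Gamma> (push_noise h \<mu> \<xi>) \<beta> (\<lambda>t y. K t (inv h y) / \<mu>))
      (map push_elem es) (map ?p Ws)"
    unfolding list_all2_map1 list_all2_map2 using Ws by (rule list_all2_mono) (rule conv_elementary_push)
  moreover have "W t (inv h y) \<omega> / sqrt \<mu> = (\<Sum>V\<leftarrow>map ?p Ws. V t y \<omega>)" for t y \<omega>
  proof -
    have "(\<Sum>V\<leftarrow>Ws. V t (inv h y) \<omega>) / sqrt \<mu> = (\<Sum>V\<leftarrow>map ?p Ws. V t y \<omega>)"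
      by (induction Ws) (simp_all add: add_divide_distrib)
    then show ?thesis by (simp add: W)
  qed
  ultimately show ?thesis
    unfolding conv_simple_def by blast
qed

lemma stochastic_convolution_push:
  assumes "stochastic_convolution M mG \<xi> \<beta> K Z W"
  shows "stochastic_convolution M m\<Gamma> (push_noise h \<mu> \<xi>) \<beta> (\<lambda>t y. K t (inv h y) / \<mu>)
    (\<lambda>t y. Z t (inv h y)) (\<lambda>t y \<omega>. W t (inv h y) \<omega> / sqrt \<mu>)"
proof -
  obtain S V where SV: "\<And>n. list_all (elementary M mG \<xi>) (S n)" "\<And>n. conv_simple M mG \<xi> \<beta> K (S n) (V n)"
    and limZ: "(\<lambda>n. N_sq M mG \<beta> (\<lambda>t x \<omega>. Z t x \<omega> - simple_field (S n) t x \<omega>)) \<longlonglongrightarrow> 0"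
    and limW: "(\<lambda>n. N_sq M mG \<beta> (\<lambda>t x \<omega>. W t x \<omega> - V n t x \<omega>)) \<longlonglongrightarrow> 0"
    and KZW: "K \<in> kernel_space mG \<beta>" "Z \<in> P2 M mG \<xi> \<beta>" "W \<in> P2 M mG \<xi> \<beta>"
    using assms unfolding stochastic_convolution_def by blast
  let ?V = "\<lambda>n t y \<omega>. V n t (inv h y) \<omega> / sqrt \<mu>" and ?S = "\<lambda>n. map push_elem (S n)"
  have sqrt: "1 / sqrt \<mu> \<noteq> 0" using \<mu>_pos by simp
  have W: "(\<lambda>t y \<omega>. W t (inv h y) \<omega> / sqrt \<mu>) \<in> P2 M m\<Gamma> (push_noise h \<mu> \<xi>) \<beta>"
    using P2_scale[OF sqrt P2_push[OF KZW(3)]] by simp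
  have "\<forall>n. list_all (elementary M m\<Gamma> (push_noise h \<mu> \<xi>)) (?S n) \<and>
      conv_simple M m\<Gamma> (push_noise h \<mu> \<xi>) \<beta> (\<lambda>t y. K t (inv h y) / \<mu>) (?S n) (?V n)"
    using SV(1) conv_simple_push[OF SV(2)] by (auto simp: list_all_iff intro: elementary_push)
  moreover have "(\<lambda>n. N_sq M m\<Gamma> \<beta> (\<lambda>t y \<omega>. Z t (inv h y) \<omega> - simple_field (?S n) t y \<omega>)) \<longlonglongrightarrow> 0"
    unfolding simple_field_push using N_sq_push_limit[OF limZ] .
  moreover have "(\<lambda>n. N_sq M m\<Gamma> \<beta> (\<lambda>t y \<omega>. W t (inv h y) \<omega> / sqrt \<mu> - ?V n t y \<omega>)) \<longlonglongrightarrow> 0"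
  proof -
    have "(\<lambda>n. ennreal ((1 / sqrt \<mu>)\<^sup>2) * N_sq M m\<Gamma> \<beta> (\<lambda>t y \<omega>. W t (inv h y) \<omega> - V n t (inv h y) \<omega>))
        \<longlonglongrightarrow> ennreal ((1 / sqrt \<mu>)\<^sup>2) * 0"
      using N_sq_push_limit[OF limW] by (intro ennreal_tendsto_cmult) simp_all
    then show ?thesis
      unfolding N_sq_scale[OF sqrt, symmetric] by (simp add: diff_divide_distrib)
  qed
  ultimately show ?thesis
    unfolding stochastic_convolution_def using kernel_space_push[OF KZW(1)] P2_push[OF KZW(2)] W
    by (intro conjI exI[of _ ?S] exI[of _ ?V])
qed

lemma semigroup_op_push:
  "semigroup_op N (\<lambda>t \<omega>. h (X t \<omega>)) t (f \<circ> inv h) y = semigroup_op N X t f (inv h y)"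
  by (simp add: semigroup_op_def inv_h_add)

lemma exp_moment_bound_push:
  assumes "exp_moment_bound M mG u"
  shows "exp_moment_bound M m\<Gamma> (\<lambda>t y. u t (inv h y))"
proof -
  obtain c1 c2 where c: "c1 > 0" "c2 > 0" "\<And>t. t \<ge> 0 \<Longrightarrow> second_moment M mG u t \<le> ennreal (c1 * exp (c2 * t))"
    using assms unfolding exp_moment_bound_def by blast
  have "second_moment M m\<Gamma> (\<lambda>t y. u t (inv h y)) t \<le> ennreal ((\<mu> * c1) * exp (c2 * t))" if "t \<ge> 0" for t
  proof -
    have "ennreal \<mu> * second_moment M mG u t \<le> ennreal \<mu> * ennreal (c1 * exp (c2 * t))"
      using c(3)[OF that] by (rule mult_left_mono) simp
    then show ?thesis
      using \<mu>_pos c by (simp add: second_moment_push ennreal_mult[symmetric] mult_ac)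
  qed
  then show ?thesis
    unfolding exp_moment_bound_def using c \<mu>_pos by (intro exI[of _ "\<mu> * c1"] conjI exI[of _ c2]) auto
qed

lemma modification_pull:
  assumes "modification M mG u (\<lambda>t x. v t (h x))"
  shows "modification M m\<Gamma> (\<lambda>t y. u t (inv h y)) v"
  using assms unfolding modification_def by (simp add: haar.AE_image_iff)

text \<open>The noise level \<open>lam * sqrt \<mu>\<close> cancels the factor \<open>1 / sqrt \<mu>\<close> that the stochastic convolution
acquires. The hypothesis on the densities is where the relation between the two dual Haar measures
comes in.\<close>

lemma mild_solution_push:
  assumes density: "\<And>t x. trans_density md N X t x = \<mu> * trans_density md' N (\<lambda>t \<omega>. h (X t \<omega>)) t (h x)"
    and u: "mild_solution M mG md N X L \<sigma> lam \<xi> u0 u"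
  shows "mild_solution M m\<Gamma> md' N (\<lambda>t \<omega>. h (X t \<omega>)) (L2_generator m\<Gamma> N (\<lambda>t \<omega>. h (X t \<omega>)))
    \<sigma> (lam * sqrt \<mu>) (push_noise h \<mu> \<xi>) (u0 \<circ> inv h) (\<lambda>t y. u t (inv h y))"
proof -
  let ?hX = "\<lambda>t \<omega>. h (X t \<omega>)" and ?v = "\<lambda>t y. u t (inv h y)"
  have sq: "\<And>t. t \<ge> 0 \<Longrightarrow> AE \<omega> in M. (\<lambda>x. u t x \<omega>) \<in> sq_integrable mG"
    and init: "AE \<omega> in M. AE x in mG. u 0 x \<omega> = u0 x"
    using u unfolding mild_solution_def by blast+
  obtain \<beta> W where \<beta>: "\<beta> > 0" and P: "u \<in> P2 M mG \<xi> \<beta>"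
    and W: "stochastic_convolution M mG \<xi> \<beta> (trans_density md N X) (\<lambda>t x \<omega>. \<sigma> (u t x \<omega>)) W"
    and mild: "\<And>t. t > 0 \<Longrightarrow> AE \<omega> in M. AE x in mG. u t x \<omega> = semigroup_op N X t u0 x + lam * W t x \<omega>"
    using u unfolding mild_solution_def by blast
  let ?W = "\<lambda>t y \<omega>. W t (inv h y) \<omega> / sqrt \<mu>"
  have dens: "(\<lambda>t y. trans_density md N X t (inv h y) / \<mu>) = trans_density md' N ?hX"
    using \<mu>_pos by (simp add: density)
  have "\<forall>t\<ge>0. AE \<omega> in M. (\<lambda>y. ?v t y \<omega>) \<in> sq_integrable m\<Gamma>"
    using sq by (simp add: haar.sq_integrable_comp_iff[of "\<lambda>y. u _ (inv h y) _", symmetric])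
  moreover have "AE \<omega> in M. AE y in m\<Gamma>. ?v 0 y \<omega> = (u0 \<circ> inv h) y"
    using init by (simp add: haar.AE_image_iff)
  moreover have "stochastic_convolution M m\<Gamma> (push_noise h \<mu> \<xi>) \<beta> (trans_density md' N ?hX)
      (\<lambda>t y \<omega>. \<sigma> (?v t y \<omega>)) ?W"
    using stochastic_convolution_push[OF W] unfolding dens .
  moreover have "\<forall>t>0. AE \<omega> in M. AE y in m\<Gamma>.
      ?v t y \<omega> = semigroup_op N ?hX t (u0 \<circ> inv h) y + lam * sqrt \<mu> * ?W t y \<omega>"
    using mild \<mu>_pos by (simp add: haar.AE_image_iff semigroup_op_push)
  ultimately show ?thesis
    unfolding mild_solution_def using \<beta> P2_push[OF P] by blast
qed

end


section \<open>The topology of the dual group\<close>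

lemma openin_dual_subbase:
  "compact K \<Longrightarrow> open U \<Longrightarrow> openin dual_topology {\<eta> \<in> characters. \<eta> ` K \<subseteq> U}"
  unfolding dual_topology_def by (rule topology_generated_by_Basis) blast

lemma topspace_dual [simp]: "topspace dual_topology = characters"
proof -
  have "{\<eta> \<in> characters. \<eta> ` {} \<subseteq> UNIV} \<in> {{\<eta> \<in> characters. \<eta> ` K \<subseteq> U} |K U. compact K \<and> open U}"
    using compact_empty open_UNIV by blast
  then show ?thesis
    unfolding dual_topology_def topology_generated_by_topspace by auto
qed

lemma sets_borel_of: "sets (borel_of T) = sigma_sets (topspace T) {U. openin T U}"
  unfolding borel_of_def by (rule sets_measure_of) (auto dest: openin_subset)

lemma space_borel_of [simp]: "space (borel_of T) = topspace T"
  unfolding borel_of_def by (rule space_measure_of) (auto dest: openin_subset)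

lemma openin_sets_borel_of: "openin T U \<Longrightarrow> U \<in> sets (borel_of T)"
  unfolding sets_borel_of by (rule sigma_sets.Basic) simp

lemma sets_borel_of_euclidean: "sets (borel_of euclidean) = sets borel"
  by (simp add: borel_of_def borel_def)

lemma measurable_borel_of_continuous_map:
  assumes "continuous_map S T f"
  shows "f \<in> measurable (borel_of S) (borel_of T)"
proof (rule measurable_sigma_sets[OF sets_borel_of])
  show "{U. openin T U} \<subseteq> Pow (topspace T)" by (auto dest: openin_subset)
  show "f \<in> space (borel_of S) \<rightarrow> topspace T"
    using continuous_map_image_subset_topspace[OF assms] by auto
  fix U assume "U \<in> {U. openin T U}"
  then have "openin S {x \<in> topspace S. f x \<in> U}"
    using openin_continuous_map_preimage[OF assms] by simp
  moreover have "f -` U \<inter> space (borel_of S) = {x \<in> topspace S. f x \<in> U}" by auto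
  ultimately show "f -` U \<inter> space (borel_of S) \<in> sets (borel_of S)"
    by (simp add: openin_sets_borel_of)
qed

lemma continuous_map_dual_eval: "continuous_map dual_topology euclidean (\<lambda>\<eta>. \<eta> x)"
proof -
  have "openin dual_topology {\<eta> \<in> characters. \<eta> x \<in> U}" if "open U" for U
    using openin_dual_subbase[of "{x}" U] that by simp
  then show ?thesis by (simp add: continuous_map_def)
qed

lemma Hausdorff_space_dual: "Hausdorff_space dual_topology"
  unfolding Hausdorff_space_def
proof (intro allI impI, elim conjE)
  fix \<gamma> \<eta> :: "'a \<Rightarrow> complex"
  assume *: "\<gamma> \<in> topspace dual_topology" "\<eta> \<in> topspace dual_topology" "\<gamma> \<noteq> \<eta>"
  then obtain x where "\<gamma> x \<noteq> \<eta> x" by auto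
  from hausdorff[OF this] obtain U V where "open U" "open V" "\<gamma> x \<in> U" "\<eta> x \<in> V" "U \<inter> V = {}"
    by blast
  then show "\<exists>U V. openin dual_topology U \<and> openin dual_topology V \<and> \<gamma> \<in> U \<and> \<eta> \<in> V \<and> disjnt U V"
    using * openin_dual_subbase[of "{x}" U] openin_dual_subbase[of "{x}" V]
    by (intro exI[of _ "{\<eta> \<in> characters. \<eta> ` {x} \<subseteq> U}"] exI[of _ "{\<eta> \<in> characters. \<eta> ` {x} \<subseteq> V}"])
      (auto simp: disjnt_def)
qed

lemma closedin_sets_borel_of:
  assumes "closedin T A" shows "A \<in> sets (borel_of T)"
proof -
  have "topspace T - A \<in> sets (borel_of T)" "A \<subseteq> topspace T"
    using assms by (auto simp: closedin_def openin_sets_borel_of)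
  then show ?thesis
    using sets.compl_sets[of "topspace T - A" "borel_of T"] by (simp add: double_diff)
qed

lemma character_0: "\<gamma> \<in> characters \<Longrightarrow> \<gamma> 0 = 1"
proof -
  assume *: "\<gamma> \<in> characters"
  then have "\<gamma> (0 + 0) = \<gamma> 0 * \<gamma> 0" "norm (\<gamma> 0) = 1" unfolding characters_def by blast+
  then show "\<gamma> 0 = 1" by auto
qed

lemma character_continuous: "\<gamma> \<in> characters \<Longrightarrow> continuous_on UNIV \<gamma>"
  and character_norm: "\<gamma> \<in> characters \<Longrightarrow> norm (\<gamma> x) = 1"
  and character_add: "\<gamma> \<in> characters \<Longrightarrow> \<gamma> (x + y) = \<gamma> x * \<gamma> y"
  by (auto simp: characters_def)

lemma character_minus: "\<gamma> \<in> characters \<Longrightarrow> \<gamma> (- x) = cnj (\<gamma> x)"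
proof -
  assume \<gamma>: "\<gamma> \<in> characters"
  have "\<gamma> x * \<gamma> (- x) = 1"
    using character_add[OF \<gamma>, of x "- x"] character_0[OF \<gamma>] by simp
  moreover have "\<gamma> x * cnj (\<gamma> x) = 1"
    using character_norm[OF \<gamma>, of x] by (simp add: complex_norm_square[symmetric] del: of_real_power)
  moreover have "\<gamma> x \<noteq> 0"
    using character_norm[OF \<gamma>, of x] by auto
  ultimately show ?thesis by (metis mult_left_cancel)
qed

text \<open>The compact-open topology is that of uniform convergence on compact sets. The compact set is covered by finitely many pieces on which the character is nearly constant, and each
piece contributes one subbasic condition.\<close>

lemma uniform_dual_neighbourhood:
  assumes \<gamma>: "\<gamma> \<in> characters" and W: "compact W" and e: "0 < e"
  obtains V where "openin dual_topology V" "\<gamma> \<in> V" "\<And>\<eta> x. \<eta> \<in> V \<Longrightarrow> x \<in> W \<Longrightarrow> norm (\<eta> x - \<gamma> x) < e"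
proof -
  let ?O = "\<lambda>x. {y. dist (\<gamma> y) (\<gamma> x) < e / 3}" and ?A = "\<lambda>x. W \<inter> {y. dist (\<gamma> y) (\<gamma> x) \<le> e / 3}"
  have cont: "continuous_on UNIV (\<lambda>y. dist (\<gamma> y) (\<gamma> x))" for x
    by (intro continuous_intros character_continuous[OF \<gamma>])
  have "open (?O x)" for x
    by (intro open_Collect_less cont continuous_intros)
  moreover have "W \<subseteq> (\<Union>x\<in>W. ?O x)" using e by auto
  ultimately obtain D where D: "D \<subseteq> W" "finite D" "W \<subseteq> (\<Union>x\<in>D. ?O x)"
    by (rule compactE_image[OF W, of W ?O])
  have A: "compact (?A x)" for x
    by (intro compact_Int_closed[OF W] closed_Collect_le cont continuous_intros)
  define V where "V = characters \<inter> (\<Inter>x\<in>D. {\<eta> \<in> characters. \<eta> ` ?A x \<subseteq> ball (\<gamma> x) (e / 2)})"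
  show thesis
  proof (rule that[of V])
    show "openin dual_topology V"
    proof (cases "D = {}")
      case True
      then show ?thesis unfolding V_def using openin_topspace[of dual_topology] by simp
    next
      case False
      have "openin dual_topology {\<eta> \<in> characters. \<eta> ` ?A x \<subseteq> ball (\<gamma> x) (e / 2)}" for x
        by (rule openin_dual_subbase[OF A open_ball])
      then have "openin dual_topology (\<Inter>x\<in>D. {\<eta> \<in> characters. \<eta> ` ?A x \<subseteq> ball (\<gamma> x) (e / 2)})"
        using False by (intro openin_Inter finite_imageI D(2)) blast+
      then show ?thesis
        unfolding V_def using openin_topspace[of dual_topology] by (intro openin_Int) simp_all
    qed
    show "\<gamma> \<in> V"
      using \<gamma> e by (auto simp: V_def dist_commute)
    fix \<eta> y assume \<eta>: "\<eta> \<in> V" and y: "y \<in> W"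
    from y D(3) obtain x where x: "x \<in> D" "dist (\<gamma> y) (\<gamma> x) < e / 3" by blast
    then have "\<eta> y \<in> ball (\<gamma> x) (e / 2)"
      using \<eta> y by (force simp: V_def)
    then have "dist (\<eta> y) (\<gamma> y) < e / 2 + e / 3"
      using x(2) dist_triangle2[of "\<eta> y" "\<gamma> y" "\<gamma> x"] by (simp add: dist_commute)
    then show "norm (\<eta> y - \<gamma> y) < e"
      using e by (simp add: dist_norm)
  qed
qed

text \<open>Each character is close to 1 on some compact neighbourhood of 0, and so are all characters
in a compact-open neighbourhood of it; finitely many such neighbourhoods cover \<open>K\<close>.\<close>

lemma compact_characters_equicontinuous:
  fixes K :: "('g::lca_group \<Rightarrow> complex) set"
  assumes K: "compactin dual_topology K" and e: "0 < e"
  obtains W O' where "compact W" "open O'" "0 \<in> O'" "O' \<subseteq> W"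
    "\<And>\<gamma> x. \<gamma> \<in> K \<Longrightarrow> x \<in> W \<Longrightarrow> norm (\<gamma> x - 1) < e"
proof -
  obtain U0 K0 where U0: "open U0" "(0 :: 'g) \<in> U0" "U0 \<subseteq> K0" and K0: "compact K0"
    using locally_compact by blast
  let ?A = "\<lambda>\<gamma>. {x. dist (\<gamma> x) (1::complex) \<le> e / 2}" and ?O = "\<lambda>\<gamma>. {x. dist (\<gamma> x) (1::complex) < e / 2}"
  let ?N = "\<lambda>\<gamma>. {\<eta> \<in> characters. \<eta> ` (K0 \<inter> ?A \<gamma>) \<subseteq> ball 1 e}"
  have Kc: "K \<subseteq> characters"
    using compactin_subset_topspace[OF K] by simp
  have cont: "continuous_on UNIV (\<lambda>y. dist (\<gamma> y) 1)" if "\<gamma> \<in> K" for \<gamma> :: "'g \<Rightarrow> complex"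
    using that Kc by (intro continuous_intros character_continuous) auto
  have clA: "closed (?A \<gamma>)" and opO: "open (?O \<gamma>)" if "\<gamma> \<in> K" for \<gamma>
    using cont[OF that] by (auto intro!: closed_Collect_le open_Collect_less continuous_intros)
  have "openin dual_topology (?N \<gamma>)" if "\<gamma> \<in> K" for \<gamma>
    using clA[OF that] K0 by (intro openin_dual_subbase compact_Int_closed) auto
  moreover have "K \<subseteq> \<Union>(?N ` K)"
  proof
    fix \<gamma> assume "\<gamma> \<in> K"
    moreover from this have "\<gamma> \<in> ?N \<gamma>"
      using Kc e by (auto simp: dist_commute)
    ultimately show "\<gamma> \<in> \<Union>(?N ` K)" by blast
  qed
  ultimately obtain F where F: "finite F" "F \<subseteq> ?N ` K" "K \<subseteq> \<Union>F"
    using compactinD[OF K, of "?N ` K"] by auto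
  obtain D where D: "finite D" "D \<subseteq> K" "K \<subseteq> \<Union>(?N ` D)"
    using finite_subset_image[OF F(1,2)] F(3) by auto
  show thesis
  proof (rule that[of "K0 \<inter> (\<Inter>\<gamma>\<in>D. ?A \<gamma>)" "U0 \<inter> (\<Inter>\<gamma>\<in>D. ?O \<gamma>)"])
    show "compact (K0 \<inter> (\<Inter>\<gamma>\<in>D. ?A \<gamma>))"
      using D clA by (intro compact_Int_closed[OF K0] closed_INT) auto
    show "open (U0 \<inter> (\<Inter>\<gamma>\<in>D. ?O \<gamma>))"
      using D opO by (intro open_Int U0 open_INT) auto
    have "0 \<in> ?O \<gamma>" if "\<gamma> \<in> D" for \<gamma>
    proof -
      have "\<gamma> 0 = 1" using that D(2) Kc character_0 by blast
      then show ?thesis using e by simp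
    qed
    then show "0 \<in> U0 \<inter> (\<Inter>\<gamma>\<in>D. ?O \<gamma>)"
      using U0(2) by blast
    show "U0 \<inter> (\<Inter>\<gamma>\<in>D. ?O \<gamma>) \<subseteq> K0 \<inter> (\<Inter>\<gamma>\<in>D. ?A \<gamma>)"
      using U0(3) by (auto simp: less_imp_le)
    fix \<gamma> x assume \<gamma>: "\<gamma> \<in> K" and x: "x \<in> K0 \<inter> (\<Inter>\<gamma>\<in>D. ?A \<gamma>)"
    from \<gamma> D(3) obtain \<gamma>' where "\<gamma>' \<in> D" "\<gamma> \<in> ?N \<gamma>'" by blast
    then have "\<gamma> x \<in> ball 1 e" using x by blast
    then show "norm (\<gamma> x - 1) < e" by (simp add: dist_norm norm_minus_commute)
  qed
qed

text \<open>The Stone-Weierstrass locale \<open>function_ring_on\<close> works on types of class \<open>t2_space\<close>; this type turns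
the dual group into one.\<close>

typedef (overloaded) 'g char_group = "characters :: ('g::lca_group \<Rightarrow> complex) set"
  by (rule exI[of _ "\<lambda>_. 1"]) (simp add: characters_def)

instantiation char_group :: (lca_group) t2_space
begin

definition open_char_group :: "'a char_group set \<Rightarrow> bool" where
  "open_char_group U \<longleftrightarrow> openin dual_topology (Rep_char_group ` U)"

instance
proof
  show "open (UNIV :: 'a char_group set)"
    using openin_topspace[of "dual_topology :: ('a \<Rightarrow> complex) topology"]
    by (simp add: open_char_group_def type_definition.Rep_range[OF type_definition_char_group])
next
  fix S T :: "'a char_group set" assume "open S" "open T"
  then show "open (S \<inter> T)"
    by (simp add: open_char_group_def image_Int inj_def Rep_char_group_inject openin_Int)
next
  fix F :: "'a char_group set set" assume "\<forall>S\<in>F. open S"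
  then show "open (\<Union>F)"
    by (auto simp: open_char_group_def image_Union)
next
  fix x y :: "'a char_group" assume "x \<noteq> y"
  then have "Rep_char_group x \<noteq> Rep_char_group y"
    by (simp add: Rep_char_group_inject)
  then obtain U V where UV: "openin dual_topology U" "openin dual_topology V"
    "Rep_char_group x \<in> U" "Rep_char_group y \<in> V" "disjnt U V"
    using Hausdorff_space_dual[unfolded Hausdorff_space_def topspace_dual, rule_format,
        of "Rep_char_group x" "Rep_char_group y"] Rep_char_group by blast
  have "Rep_char_group ` (Rep_char_group -` A) = A" if "openin dual_topology A" for A
    using openin_subset[OF that] type_definition.Rep_range[OF type_definition_char_group]
    by (auto simp: image_vimage_eq)
  then show "\<exists>U V. open U \<and> open V \<and> x \<in> U \<and> y \<in> V \<and> U \<inter> V = {}"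
    using UV by (intro exI[of _ "Rep_char_group -` U"] exI[of _ "Rep_char_group -` V"])
      (auto simp: open_char_group_def disjnt_def)
qed

end

lemma continuous_map_Rep_char_group: "continuous_map euclidean dual_topology Rep_char_group"
proof -
  have "Rep_char_group ` (Rep_char_group -` A) = A" if "openin dual_topology A" for A :: "('a \<Rightarrow> complex) set"
    using openin_subset[OF that] type_definition.Rep_range[OF type_definition_char_group]
    by (auto simp: image_vimage_eq)
  then show ?thesis
    by (auto simp: continuous_map_def Rep_char_group open_char_group_def vimage_def)
qed

lemma continuous_map_Abs_char_group: "continuous_map dual_topology euclidean Abs_char_group"
proof -
  have "{\<eta> \<in> characters. Abs_char_group \<eta> \<in> U} = Rep_char_group ` U" for U :: "'a char_group set"
    by (force simp: Abs_char_group_inverse Rep_char_group_inverse Rep_char_group)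
  then show ?thesis
    by (simp add: continuous_map_def open_char_group_def)
qed


section \<open>Fourier multipliers\<close>

text \<open>On the support of \<open>f\<close>, characters that are close in the compact-open topology are uniformly
close, so their integrals against \<open>f\<close> are close.\<close>

lemma continuous_map_fourier:
  fixes f :: "'g::lca_group \<Rightarrow> complex"
  assumes m: "sets m = sets borel" and f: "integrable m f" and W: "compact W"
    and supp: "\<And>x. x \<notin> W \<Longrightarrow> f x = 0"
  shows "continuous_map dual_topology euclidean (fourier m f)"
proof -
  have meas: "\<eta> \<in> borel_measurable m" if "\<eta> \<in> characters" for \<eta>
    unfolding measurable_cong_sets[OF m refl]
    using character_continuous[OF that] by (rule borel_measurable_continuous_onI)
  have int: "integrable m (\<lambda>x. \<eta> x * f x)" if "\<eta> \<in> characters" for \<eta>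
  proof (rule Bochner_Integration.integrable_bound[OF f])
    show "(\<lambda>x. \<eta> x * f x) \<in> borel_measurable m"
      using meas[OF that] borel_measurable_integrable[OF f] by measurable
  qed (simp add: norm_mult character_norm[OF that])
  have "\<exists>V. openin dual_topology V \<and> \<gamma> \<in> V \<and> V \<subseteq> {\<eta> \<in> characters. fourier m f \<eta> \<in> U}"
    if U: "open U" and \<gamma>: "\<gamma> \<in> characters" "fourier m f \<gamma> \<in> U" for U \<gamma>
  proof -
    obtain e where e: "e > 0" "ball (fourier m f \<gamma>) e \<subseteq> U"
      using U \<gamma>(2) by (auto simp: open_contains_ball)
    define B where "B = (\<integral>x. norm (f x) \<partial>m)"
    have B: "B \<ge> 0" by (simp add: B_def)
    \<comment> \<open>The summand 1 keeps the denominator positive when \<open>f\<close> vanishes almost everywhere.\<close>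
  define d where "d = e / (B + 1)"
    have d: "d > 0" "d * B < e" using e B by (auto simp: d_def field_simps)
    obtain V where V: "openin dual_topology V" "\<gamma> \<in> V"
      "\<And>\<eta> x. \<eta> \<in> V \<Longrightarrow> x \<in> W \<Longrightarrow> norm (\<eta> x - \<gamma> x) < d"
      using uniform_dual_neighbourhood[OF \<gamma>(1) W d(1)] by blast
    have "fourier m f \<eta> \<in> ball (fourier m f \<gamma>) e" if \<eta>: "\<eta> \<in> V" for \<eta>
    proof -
      have \<eta>c: "\<eta> \<in> characters" using \<eta> openin_subset[OF V(1)] by auto
      have "fourier m f \<eta> - fourier m f \<gamma> = (\<integral>x. (\<eta> x - \<gamma> x) * f x \<partial>m)"
        unfolding fourier_def using int[OF \<eta>c] int[OF \<gamma>(1)]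
        by (simp add: left_diff_distrib)
      also have "norm \<dots> \<le> (\<integral>x. norm ((\<eta> x - \<gamma> x) * f x) \<partial>m)"
        by (rule integral_norm_bound)
      also have "\<dots> \<le> (\<integral>x. d * norm (f x) \<partial>m)"
      proof (rule integral_mono)
        show "integrable m (\<lambda>x. norm ((\<eta> x - \<gamma> x) * f x))"
          using int[OF \<eta>c] int[OF \<gamma>(1)] by (intro integrable_norm) (simp add: left_diff_distrib)
        show "integrable m (\<lambda>x. d * norm (f x))" using f by simp
        show "norm ((\<eta> x - \<gamma> x) * f x) \<le> d * norm (f x)" for x
          using V(3)[OF \<eta>, of x] supp[of x] by (cases "x \<in> W") (auto simp: norm_mult intro: mult_right_mono)
      qed
      also have "\<dots> = d * B" by (simp add: B_def)
      also have "\<dots> < e" by (rule d)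
      finally show ?thesis by (simp add: dist_norm norm_minus_commute)
    qed
    then show ?thesis
      using V e(2) openin_subset[OF V(1)] by (intro exI[of _ V]) auto
  qed
  then have "openin dual_topology {\<eta> \<in> characters. fourier m f \<eta> \<in> U}" if "open U" for U
    using that by (subst openin_subopen) blast
  then show ?thesis
    by (simp add: continuous_map_def)
qed

locale haar_group =
  fixes m :: "'g::lca_group measure"
  assumes haar: "haar_measure euclidean (+) m"
begin

lemma sets_m: "sets m = sets borel"
  using haar by (simp add: haar_measure_def sets_borel_of_euclidean)

lemma space_m [simp]: "space m = UNIV"
  using sets_eq_imp_space_eq[OF sets_m] by simp

lemma emeasure_translate: "A \<in> sets m \<Longrightarrow> emeasure m ((+) a ` A) = emeasure m A"
  using haar by (simp add: haar_measure_def)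

lemma translation: "scaling_iso m m (\<lambda>x. x + a) 1"
proof
  have inv: "inv (\<lambda>x. x + a) = (\<lambda>x. x - a)"
    by (rule inv_unique_comp) (auto simp: fun_eq_iff)
  show "bij (\<lambda>x. x + a)"
    by (rule o_bij[of "\<lambda>x. x - a"]) (auto simp: fun_eq_iff)
  show "(\<lambda>x. x + a) \<in> measurable m m" "inv (\<lambda>x. x + a) \<in> measurable m m"
    unfolding inv measurable_cong_sets[OF sets_m sets_m]
    by (intro borel_measurable_continuous_onI continuous_intros)+
  fix E assume E: "E \<in> sets m"
  have "(\<lambda>x. x + a) -` E \<inter> space m = (+) (- a) ` E"
    by (force intro: image_eqI[of _ _ "_ + a"])
  then show "emeasure m E = ennreal 1 * emeasure m ((\<lambda>x. x + a) -` E \<inter> space m)"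
    using emeasure_translate[OF E, of "- a"] by simp
qed simp

lemma emeasure_compact_finite: "compact K \<Longrightarrow> emeasure m K < \<infinity>"
  using haar by (simp add: haar_measure_def)

text \<open>If \<open>O'\<close> were null, then all compact sets, being covered by finitely many translates of it, would be null,
and by inner regularity so would be the whole group.\<close>

lemma emeasure_open_pos:
  assumes O: "open O'" "0 \<in> O'"
  shows "emeasure m O' > 0"
proof (rule ccontr)
  assume "\<not> emeasure m O' > 0"
  then have z: "emeasure m O' = 0" by simp
  have op: "open ((+) a ` O')" for a
  proof -
    have "(+) a ` O' = (\<lambda>x. x - a) -` O'"
      by (force intro: image_eqI[of _ _ "_ - a"])
    then show ?thesis
      using open_vimage[OF O(1), of "\<lambda>x. x - a"] by (simp add: continuous_intros)
  qed
  have "emeasure m ((+) a ` O') = 0" for a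
    using emeasure_translate[of O' a] z O(1) sets_m by simp
  then have null: "(+) a ` O' \<in> null_sets m" for a
    using op[of a] sets_m by (simp add: null_sets_def)
  have "emeasure m K = 0" if K: "compact K" for K
  proof -
    have "K \<subseteq> (\<Union>a\<in>K. (+) a ` O')"
      using O(2) by force
    then obtain D where D: "D \<subseteq> K" "finite D" "K \<subseteq> (\<Union>a\<in>D. (+) a ` O')"
      by (rule compactE_image[OF K op])
    have "(\<Union>a\<in>D. (+) a ` O') \<in> null_sets m"
      using D(2) null by (intro null_sets.finite_UN) auto
    moreover have "K \<in> sets m" using K sets_m by (simp add: compact_imp_closed)
    ultimately show ?thesis
      using null_sets_subset[OF _ _ D(3)] by (auto simp: null_sets_def)
  qed
  then have "(SUP K\<in>{K. compactin euclidean K \<and> K \<subseteq> UNIV}. emeasure m K) \<le> 0"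
    by (intro SUP_least) simp
  moreover have "emeasure m UNIV = (SUP K\<in>{K. compactin euclidean K \<and> K \<subseteq> UNIV}. emeasure m K)"
    using haar by (simp add: haar_measure_def)
  ultimately show False
    using haar by (simp add: haar_measure_def)
qed

text \<open>The intersection of \<open>L\<^sup>1\<close> and \<open>L\<^sup>2\<close>, on which the Plancherel identity is imposed.\<close>

definition L12 :: "('g \<Rightarrow> complex) set" where
  "L12 = {f. integrable m f \<and> integrable m (\<lambda>x. (norm (f x))\<^sup>2)}"

lemma L12_add:
  assumes f: "f \<in> L12" and g: "g \<in> L12"
  shows "(\<lambda>x. f x + g x) \<in> L12"
proof -
  have [measurable]: "f \<in> borel_measurable m" "g \<in> borel_measurable m"
    using f g by (auto simp: L12_def)
  have "integrable m (\<lambda>x. (norm (f x + g x))\<^sup>2)"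
  proof (rule Bochner_Integration.integrable_bound)
    show "integrable m (\<lambda>x. 2 * (norm (f x))\<^sup>2 + 2 * (norm (g x))\<^sup>2)"
      using f g by (auto simp: L12_def)
    have "(norm (f x + g x))\<^sup>2 \<le> 2 * (norm (f x))\<^sup>2 + 2 * (norm (g x))\<^sup>2" for x
    proof -
      have "(norm (f x + g x))\<^sup>2 \<le> (norm (f x) + norm (g x))\<^sup>2"
        by (intro power_mono norm_triangle_ineq) simp
      also have "\<dots> \<le> 2 * (norm (f x))\<^sup>2 + 2 * (norm (g x))\<^sup>2"
        using sum_squares_bound[of "norm (f x)" "norm (g x)"] by (simp add: power2_sum)
      finally show ?thesis .
    qed
    then show "AE x in m. norm ((norm (f x + g x))\<^sup>2) \<le> norm (2 * (norm (f x))\<^sup>2 + 2 * (norm (g x))\<^sup>2)"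
      by simp
  qed measurable
  then show ?thesis
    using f g by (simp add: L12_def)
qed

lemma L12_cmult: "f \<in> L12 \<Longrightarrow> (\<lambda>x. c * f x) \<in> L12"
  by (simp add: L12_def norm_mult power_mult_distrib)

lemma L12_translate: "f \<in> L12 \<Longrightarrow> (\<lambda>x. f (x + a)) \<in> L12"
  using scaling_iso.integrable_comp_iff[OF translation, of f a]
    scaling_iso.integrable_comp_iff[OF translation, of "\<lambda>x. (norm (f x))\<^sup>2" a]
  by (simp add: L12_def)

lemma integrable_character_mult:
  assumes "f \<in> L12" "\<gamma> \<in> characters"
  shows "integrable m (\<lambda>x. \<gamma> x * f x)"
proof (rule Bochner_Integration.integrable_bound)
  show "integrable m f" using assms by (simp add: L12_def)
  have "\<gamma> \<in> borel_measurable m"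
    unfolding measurable_cong_sets[OF sets_m refl]
    using character_continuous[OF assms(2)] by (rule borel_measurable_continuous_onI)
  then show "(\<lambda>x. \<gamma> x * f x) \<in> borel_measurable m"
    using assms(1) by (auto simp: L12_def)
qed (simp add: norm_mult character_norm[OF assms(2)])

lemma fourier_add:
  assumes "f \<in> L12" "g \<in> L12" "\<gamma> \<in> characters"
  shows "fourier m (\<lambda>x. f x + g x) \<gamma> = fourier m f \<gamma> + fourier m g \<gamma>"
  using integrable_character_mult[OF assms(1,3)] integrable_character_mult[OF assms(2,3)]
  by (simp add: fourier_def distrib_left)

lemma fourier_cmult: "fourier m (\<lambda>x. c * f x) \<gamma> = c * fourier m f \<gamma>"
  by (simp add: fourier_def mult.left_commute[of _ c])

lemma fourier_translate:
  assumes "\<gamma> \<in> characters"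
  shows "fourier m (\<lambda>x. f (x + a)) \<gamma> = \<gamma> (- a) * fourier m f \<gamma>"
proof -
  have "fourier m f \<gamma> = (\<integral>x. \<gamma> (x + a) * f (x + a) \<partial>m)"
    unfolding fourier_def using scaling_iso.integral_image[OF translation, of "\<lambda>x. \<gamma> x * f x" a] by simp
  also have "\<dots> = \<gamma> a * fourier m (\<lambda>x. f (x + a)) \<gamma>"
    unfolding fourier_def integral_mult_right_zero[symmetric] character_add[OF assms] by (simp add: mult_ac)
  finally have "\<gamma> (- a) * fourier m f \<gamma> = (\<gamma> (- a) * \<gamma> a) * fourier m (\<lambda>x. f (x + a)) \<gamma>"
    by simp
  also have "\<gamma> (- a) * \<gamma> a = 1"
    using character_add[OF assms, of "- a" a] character_0[OF assms] by simp
  finally show ?thesis by simp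
qed

definition multiplier :: "(('g \<Rightarrow> complex) \<Rightarrow> real) \<Rightarrow> bool" where
  "multiplier p \<longleftrightarrow> (\<forall>f\<in>L12. \<exists>g\<in>L12. \<forall>\<gamma>\<in>characters. fourier m g \<gamma> = of_real (p \<gamma>) * fourier m f \<gamma>)"

text \<open>This ring contains the real trigonometric polynomials. Membership is defined by the properties
that are used, so that closure under sums and products is immediate: multipliers compose.\<close>

definition multiplier_ring :: "(('g \<Rightarrow> complex) \<Rightarrow> real) set" where
  "multiplier_ring = {p. multiplier p \<and> continuous_map dual_topology euclidean p \<and>
     (\<exists>B. \<forall>\<gamma>\<in>characters. \<bar>p \<gamma>\<bar> \<le> B)}"

lemma multiplier_ring_const: "(\<lambda>_. c) \<in> multiplier_ring"
proof -
  have "multiplier (\<lambda>_. c)"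
    unfolding multiplier_def
    by (intro ballI) (auto intro!: bexI[OF _ L12_cmult[of _ "of_real c"]] simp: fourier_cmult)
  then show ?thesis by (auto simp: multiplier_ring_def)
qed

lemma multiplier_ring_add:
  assumes p: "p \<in> multiplier_ring" and q: "q \<in> multiplier_ring"
  shows "(\<lambda>\<gamma>. p \<gamma> + q \<gamma>) \<in> multiplier_ring"
proof -
  have "multiplier (\<lambda>\<gamma>. p \<gamma> + q \<gamma>)"
    unfolding multiplier_def
  proof
    fix f assume f: "f \<in> L12"
    obtain g where g: "g \<in> L12" "\<forall>\<gamma>\<in>characters. fourier m g \<gamma> = of_real (p \<gamma>) * fourier m f \<gamma>"
      using p f by (auto simp: multiplier_ring_def multiplier_def)
    obtain g' where g': "g' \<in> L12" "\<forall>\<gamma>\<in>characters. fourier m g' \<gamma> = of_real (q \<gamma>) * fourier m f \<gamma>"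
      using q f by (auto simp: multiplier_ring_def multiplier_def)
    show "\<exists>g\<in>L12. \<forall>\<gamma>\<in>characters. fourier m g \<gamma> = of_real (p \<gamma> + q \<gamma>) * fourier m f \<gamma>"
      using g g' by (intro bexI[OF _ L12_add[OF g(1) g'(1)]]) (simp add: fourier_add distrib_right)
  qed
  moreover obtain B B' where "\<forall>\<gamma>\<in>characters. \<bar>p \<gamma>\<bar> \<le> B" "\<forall>\<gamma>\<in>characters. \<bar>q \<gamma>\<bar> \<le> B'"
    using p q by (auto simp: multiplier_ring_def)
  then have "\<forall>\<gamma>\<in>characters. \<bar>p \<gamma> + q \<gamma>\<bar> \<le> B + B'"
    by (auto intro: order_trans[OF abs_triangle_ineq] add_mono)
  ultimately show ?thesis
    using p q unfolding multiplier_ring_def by (auto intro: continuous_map_add)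
qed

lemma multiplier_ring_mult:
  assumes p: "p \<in> multiplier_ring" and q: "q \<in> multiplier_ring"
  shows "(\<lambda>\<gamma>. p \<gamma> * q \<gamma>) \<in> multiplier_ring"
proof -
  have "multiplier (\<lambda>\<gamma>. p \<gamma> * q \<gamma>)"
    unfolding multiplier_def
  proof
    fix f assume f: "f \<in> L12"
    obtain g where g: "g \<in> L12" "\<forall>\<gamma>\<in>characters. fourier m g \<gamma> = of_real (q \<gamma>) * fourier m f \<gamma>"
      using q f by (auto simp: multiplier_ring_def multiplier_def)
    obtain g' where g': "g' \<in> L12" "\<forall>\<gamma>\<in>characters. fourier m g' \<gamma> = of_real (p \<gamma>) * fourier m g \<gamma>"
      using p g(1) by (auto simp: multiplier_ring_def multiplier_def)
    show "\<exists>g\<in>L12. \<forall>\<gamma>\<in>characters. fourier m g \<gamma> = of_real (p \<gamma> * q \<gamma>) * fourier m f \<gamma>"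
      using g g' by (intro bexI[OF _ g'(1)]) simp
  qed
  moreover obtain B B' where "\<forall>\<gamma>\<in>characters. \<bar>p \<gamma>\<bar> \<le> B" "\<forall>\<gamma>\<in>characters. \<bar>q \<gamma>\<bar> \<le> B'"
    using p q by (auto simp: multiplier_ring_def)
  then have "\<forall>\<gamma>\<in>characters. \<bar>p \<gamma> * q \<gamma>\<bar> \<le> B * B'"
    by (auto simp: abs_mult intro!: mult_mono intro: order_trans[OF abs_ge_zero])
  ultimately show ?thesis
    using p q unfolding multiplier_ring_def by (auto intro: continuous_map_real_mult)
qed

lemma multiplier_ring_Re: "(\<lambda>\<gamma>. Re (\<gamma> a)) \<in> multiplier_ring"
  and multiplier_ring_Im: "(\<lambda>\<gamma>. Im (\<gamma> a)) \<in> multiplier_ring"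
proof -
  have "multiplier (\<lambda>\<gamma>. Re (\<gamma> a))"
    unfolding multiplier_def
  proof
    fix f assume f: "f \<in> L12"
    let ?g = "\<lambda>x. (1 / 2) * (f (x + - a) + f (x + a))"
    have "fourier m ?g \<gamma> = of_real (Re (\<gamma> a)) * fourier m f \<gamma>" if \<gamma>: "\<gamma> \<in> characters" for \<gamma>
    proof -
      have "fourier m ?g \<gamma> = (1 / 2) * (\<gamma> (- (- a)) * fourier m f \<gamma> + \<gamma> (- a) * fourier m f \<gamma>)"
        unfolding fourier_cmult
        by (subst fourier_add[OF L12_translate[OF f] L12_translate[OF f] \<gamma>]) (simp only: fourier_translate[OF \<gamma>])
      also have "\<dots> = ((\<gamma> a + cnj (\<gamma> a)) / 2) * fourier m f \<gamma>"
        by (simp add: character_minus[OF \<gamma>] algebra_simps)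
      also have "(\<gamma> a + cnj (\<gamma> a)) / 2 = of_real (Re (\<gamma> a))"
        by (simp add: complex_add_cnj)
      finally show ?thesis .
    qed
    then show "\<exists>g\<in>L12. \<forall>\<gamma>\<in>characters. fourier m g \<gamma> = of_real (Re (\<gamma> a)) * fourier m f \<gamma>"
      by (intro bexI[of _ ?g] L12_cmult L12_add L12_translate f) simp
  qed
  moreover have "multiplier (\<lambda>\<gamma>. Im (\<gamma> a))"
    unfolding multiplier_def
  proof
    fix f assume f: "f \<in> L12"
    let ?g = "\<lambda>x. (- \<i> / 2) * (f (x + - a) + (- 1) * f (x + a))"
    have "fourier m ?g \<gamma> = of_real (Im (\<gamma> a)) * fourier m f \<gamma>" if \<gamma>: "\<gamma> \<in> characters" for \<gamma>
    proof -
      have "fourier m ?g \<gamma> = (- \<i> / 2) * (\<gamma> (- (- a)) * fourier m f \<gamma> + (- 1) * (\<gamma> (- a) * fourier m f \<gamma>))"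
        unfolding fourier_cmult
        by (subst fourier_add[OF L12_translate[OF f] L12_cmult[OF L12_translate[OF f]] \<gamma>])
          (simp only: fourier_translate[OF \<gamma>] fourier_cmult)
      also have "\<dots> = (- \<i> / 2) * (\<gamma> a - cnj (\<gamma> a)) * fourier m f \<gamma>"
        by (simp add: character_minus[OF \<gamma>] algebra_simps)
      also have "(- \<i> / 2) * (\<gamma> a - cnj (\<gamma> a)) = of_real (Im (\<gamma> a))"
        by (simp add: complex_eq_iff)
      finally show ?thesis .
    qed
    then show "\<exists>g\<in>L12. \<forall>\<gamma>\<in>characters. fourier m g \<gamma> = of_real (Im (\<gamma> a)) * fourier m f \<gamma>"
      by (intro bexI[of _ ?g] L12_cmult L12_add L12_translate f) simp
  qed
  moreover have "continuous_map dual_topology euclidean (\<lambda>\<gamma> :: 'g \<Rightarrow> complex. Re (\<gamma> a))"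
    "continuous_map dual_topology euclidean (\<lambda>\<gamma> :: 'g \<Rightarrow> complex. Im (\<gamma> a))"
    using continuous_map_compose[OF continuous_map_dual_eval[of a], of euclidean Re]
      continuous_map_compose[OF continuous_map_dual_eval[of a], of euclidean Im]
    by (simp_all add: comp_def continuous_intros)
  moreover have "\<bar>Re (\<gamma> a)\<bar> \<le> 1" "\<bar>Im (\<gamma> a)\<bar> \<le> 1" if "\<gamma> \<in> characters" for \<gamma>
    using abs_Re_le_cmod[of "\<gamma> a"] abs_Im_le_cmod[of "\<gamma> a"] character_norm[OF that, of a] by simp_all
  ultimately show "(\<lambda>\<gamma>. Re (\<gamma> a)) \<in> multiplier_ring" "(\<lambda>\<gamma>. Im (\<gamma> a)) \<in> multiplier_ring"
    unfolding multiplier_ring_def by blast+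
qed

lemma multiplier_ring_polynomial:
  assumes p: "p \<in> multiplier_ring"
  shows "real_polynomial_function q \<Longrightarrow> (\<lambda>\<gamma>. q (p \<gamma>)) \<in> multiplier_ring"
proof (induction q rule: real_polynomial_function.induct)
  case (linear f)
  have "f x = f 1 * x" for x :: real
    using linear_scale_real[OF bounded_linear.linear[OF linear], of x 1] by (simp add: mult.commute)
  then have "(\<lambda>\<gamma>. f (p \<gamma>)) = (\<lambda>\<gamma>. f 1 * p \<gamma>)"
    by blast
  then show ?case
    using multiplier_ring_mult[OF multiplier_ring_const[of "f 1"] p] by (simp only:)
qed (auto intro: multiplier_ring_const multiplier_ring_add multiplier_ring_mult)

end


section \<open>Radon measures and uniqueness of the Plancherel measure\<close>

text \<open>The regularity of Haar measures, stated with strict inequalities instead of suprema and infima,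
which makes it easy to transport along homeomorphisms.\<close>

definition radon_on :: "'a topology \<Rightarrow> 'a measure \<Rightarrow> bool" where
  "radon_on T m \<longleftrightarrow> sets m = sets (borel_of T) \<and>
     (\<forall>K. compactin T K \<longrightarrow> emeasure m K < \<infinity>) \<and>
     (\<forall>A r. A \<in> sets m \<longrightarrow> emeasure m A < r \<longrightarrow> (\<exists>U. openin T U \<and> A \<subseteq> U \<and> emeasure m U < r)) \<and>
     (\<forall>U r. openin T U \<longrightarrow> r < emeasure m U \<longrightarrow> (\<exists>K. compactin T K \<and> K \<subseteq> U \<and> r < emeasure m K))"

lemma haar_measure_imp_radon_on:
  assumes "haar_measure T mul m"
  shows "radon_on T m"
  unfolding radon_on_def
proof (intro conjI allI impI)
  show "sets m = sets (borel_of T)" "\<And>K. compactin T K \<Longrightarrow> emeasure m K < \<infinity>"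
    using assms by (simp_all add: haar_measure_def)
next
  fix A r assume "A \<in> sets m" "emeasure m A < r"
  then have "(INF U\<in>{U. openin T U \<and> A \<subseteq> U}. emeasure m U) < r"
    using assms unfolding haar_measure_def by metis
  then show "\<exists>U. openin T U \<and> A \<subseteq> U \<and> emeasure m U < r"
    unfolding INF_less_iff by blast
next
  fix U r assume "openin T U" "r < emeasure m U"
  then have "r < (SUP K\<in>{K. compactin T K \<and> K \<subseteq> U}. emeasure m K)"
    using assms unfolding haar_measure_def by metis
  then show "\<exists>K. compactin T K \<and> K \<subseteq> U \<and> r < emeasure m K"
    unfolding less_SUP_iff by blast
qed

lemma radon_on_sets: "radon_on T m \<Longrightarrow> sets m = sets (borel_of T)"
  and radon_on_compact: "radon_on T m \<Longrightarrow> compactin T K \<Longrightarrow> emeasure m K < \<infinity>"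
  and radon_on_outer: "radon_on T m \<Longrightarrow> A \<in> sets m \<Longrightarrow> emeasure m A < r \<Longrightarrow>
    \<exists>U. openin T U \<and> A \<subseteq> U \<and> emeasure m U < r"
  and radon_on_inner: "radon_on T m \<Longrightarrow> openin T U \<Longrightarrow> r < emeasure m U \<Longrightarrow>
    \<exists>K. compactin T K \<and> K \<subseteq> U \<and> r < emeasure m K"
  by (simp_all add: radon_on_def)

lemma radon_on_le:
  assumes m1: "radon_on T m1" and m2: "radon_on T m2" and T: "Hausdorff_space T"
    and le: "\<And>K. compactin T K \<Longrightarrow> emeasure m1 K \<le> emeasure m2 K"
    and A: "A \<in> sets m1"
  shows "emeasure m1 A \<le> emeasure m2 A"
proof (rule ccontr)
  assume "\<not> ?thesis"
  then have "emeasure m2 A < emeasure m1 A" by simp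
  moreover have "A \<in> sets m2" using A radon_on_sets[OF m1] radon_on_sets[OF m2] by simp
  ultimately obtain U where U: "openin T U" "A \<subseteq> U" "emeasure m2 U < emeasure m1 A"
    using radon_on_outer[OF m2] by blast
  have Us: "U \<in> sets m1" "U \<in> sets m2"
    using openin_sets_borel_of[OF U(1)] radon_on_sets[OF m1] radon_on_sets[OF m2] by simp_all
  have "emeasure m2 U < emeasure m1 U"
    using U(3) emeasure_mono[OF U(2) Us(1)] by (rule less_le_trans)
  then obtain K where K: "compactin T K" "K \<subseteq> U" "emeasure m2 U < emeasure m1 K"
    using radon_on_inner[OF m1 U(1)] by blast
  have "emeasure m2 K \<le> emeasure m2 U"
    using K(2) Us(2) by (rule emeasure_mono)
  with le[OF K(1)] K(3) show False by simp
qed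

lemma continuous_map_borel_measurable:
  fixes f :: "'a \<Rightarrow> 'b::topological_space"
  assumes "continuous_map T euclidean f" "sets m = sets (borel_of T)"
  shows "f \<in> borel_measurable m"
  using measurable_borel_of_continuous_map[OF assms(1)]
  unfolding measurable_cong_sets[OF assms(2) refl] measurable_cong_sets[OF refl sets_borel_of_euclidean] .

context haar_group
begin

text \<open>Stone-Weierstrass separates \<open>K\<close> from \<open>C - U\<close> by an element of the ring, but controls it only on
\<open>C \<union> K\<close>. Composing it with a polynomial that approximates the truncation \<open>t \<mapsto> max 0 (min 1 t)\<close> on
the range of this element gives a bound on the whole dual group.\<close>

lemma multiplier_ring_bump:
  assumes C: "compactin dual_topology C" and K: "compactin dual_topology K"
    and U: "openin dual_topology U" and KU: "K \<subseteq> U" and e: "0 < e" "e < 1"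
  obtains p where "p \<in> multiplier_ring" "\<And>\<gamma>. \<gamma> \<in> characters \<Longrightarrow> \<bar>p \<gamma>\<bar> \<le> 1 + e"
    "\<And>\<gamma>. \<gamma> \<in> K \<Longrightarrow> 1 - e \<le> p \<gamma>" "\<And>\<gamma>. \<gamma> \<in> C - U \<Longrightarrow> \<bar>p \<gamma>\<bar> \<le> e"
proof -
  let ?R = "(\<lambda>p \<gamma>. p (Rep_char_group \<gamma>)) ` multiplier_ring"
  let ?S = "Abs_char_group ` (C \<union> K)"
  have comp: "compact (Abs_char_group ` L)" if "compactin dual_topology L" for L :: "('g \<Rightarrow> complex) set"
    using image_compactin[OF that continuous_map_Abs_char_group] by simp
  have chars: "C \<subseteq> characters" "K \<subseteq> characters"
    using compactin_subset_topspace[OF C] compactin_subset_topspace[OF K] by simp_all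
  interpret R: function_ring_on ?R ?S
  proof
    show "compact ?S"
      by (intro comp compactin_Un C K)
  next
    fix f assume "f \<in> ?R"
    then obtain p where f: "f = (\<lambda>\<gamma>. p (Rep_char_group \<gamma>))" and p: "p \<in> multiplier_ring" by blast
    have "continuous_map euclidean euclidean (p \<circ> Rep_char_group)"
      using p by (intro continuous_map_compose[OF continuous_map_Rep_char_group]) (simp add: multiplier_ring_def)
    then show "continuous_on ?S f"
      by (auto simp: f comp_def intro: continuous_on_subset)
  next
    fix f g assume "f \<in> ?R" "g \<in> ?R"
    then obtain p q where f: "f = (\<lambda>\<gamma>. p (Rep_char_group \<gamma>))" and p: "p \<in> multiplier_ring"
      and g: "g = (\<lambda>\<gamma>. q (Rep_char_group \<gamma>))" and q: "q \<in> multiplier_ring" by blast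
    show "(\<lambda>\<gamma>. f \<gamma> + g \<gamma>) \<in> ?R" "(\<lambda>\<gamma>. f \<gamma> * g \<gamma>) \<in> ?R"
      using imageI[OF multiplier_ring_add[OF p q], of "\<lambda>p \<gamma>. p (Rep_char_group \<gamma>)"]
        imageI[OF multiplier_ring_mult[OF p q], of "\<lambda>p \<gamma>. p (Rep_char_group \<gamma>)"]
      unfolding f g by simp_all
  next
    fix c :: real show "(\<lambda>_. c) \<in> ?R"
      using imageI[OF multiplier_ring_const[of c], of "\<lambda>p \<gamma>. p (Rep_char_group \<gamma>)"] by simp
  next
    fix x y :: "'g char_group" assume "x \<noteq> y"
    then have "Rep_char_group x \<noteq> Rep_char_group y"
      by (simp add: Rep_char_group_inject)
    then obtain a where "Rep_char_group x a \<noteq> Rep_char_group y a" by auto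
    then consider "Re (Rep_char_group x a) \<noteq> Re (Rep_char_group y a)"
      | "Im (Rep_char_group x a) \<noteq> Im (Rep_char_group y a)"
      by (auto simp: complex_eq_iff)
    then show "\<exists>f\<in>?R. f x \<noteq> f y"
    proof cases
      case 1
      then show ?thesis
        by (intro bexI[OF _ imageI[OF multiplier_ring_Re[of a]]])
    next
      case 2
      then show ?thesis
        by (intro bexI[OF _ imageI[OF multiplier_ring_Im[of a]]])
    qed
  qed
  have CU: "compactin dual_topology (C - U)"
  proof -
    have "closedin dual_topology (topspace dual_topology - U)"
      using U by (rule openin_closedin_eq[THEN iffD1, THEN conjunct2])
    then have "compactin dual_topology (C \<inter> (topspace dual_topology - U))"
      by (rule compact_Int_closedin[OF C])
    moreover have "C \<inter> (topspace dual_topology - U) = C - U" using chars by auto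
    ultimately show ?thesis by simp
  qed
  have "closed (Abs_char_group ` (C - U))" "closed (Abs_char_group ` K)"
    using comp[OF CU] comp[OF K] by (auto intro: compact_imp_closed)
  moreover have "Abs_char_group ` (C - U) \<inter> Abs_char_group ` K = {}"
    using chars KU by (auto simp: Abs_char_group_inject subset_eq)
  ultimately have "\<exists>f\<in>?R. f ` ?S \<subseteq> {0..1} \<and> (\<forall>x\<in>Abs_char_group ` (C - U). f x < e / 2) \<and>
      (\<forall>x\<in>Abs_char_group ` K. f x > 1 - e / 2)"
    using e by (intro R.two) auto
  then obtain p0 where p0: "p0 \<in> multiplier_ring"
    and p0C: "\<And>\<gamma>. \<gamma> \<in> C - U \<Longrightarrow> p0 \<gamma> < e / 2" and p0K: "\<And>\<gamma>. \<gamma> \<in> K \<Longrightarrow> p0 \<gamma> > 1 - e / 2"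
    using chars by (auto simp: Abs_char_group_inverse subset_eq)
  obtain B where B: "\<And>\<gamma>. \<gamma> \<in> characters \<Longrightarrow> \<bar>p0 \<gamma>\<bar> \<le> B"
    using p0 by (auto simp: multiplier_ring_def)
  have "continuous_on {- B..B} (\<lambda>t :: real. max 0 (min 1 t))"
    by (intro continuous_intros)
  then obtain q where q: "real_polynomial_function q"
    and q_close: "\<And>t. t \<in> {- B..B} \<Longrightarrow> \<bar>max 0 (min 1 t) - q t\<bar> < e / 2"
    using Stone_Weierstrass_real_polynomial_function[OF compact_Icc _ half_gt_zero[OF e(1)]] by blast
  have close: "\<bar>max 0 (min 1 (p0 \<gamma>)) - q (p0 \<gamma>)\<bar> < e / 2" if "\<gamma> \<in> characters" for \<gamma>
    using B[OF that] by (intro q_close) auto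
  show thesis
  proof (rule that)
    show "(\<lambda>\<gamma>. q (p0 \<gamma>)) \<in> multiplier_ring"
      by (rule multiplier_ring_polynomial[OF p0 q])
    show "\<bar>q (p0 \<gamma>)\<bar> \<le> 1 + e" if "\<gamma> \<in> characters" for \<gamma>
      using close[OF that] e by (auto simp: max_def min_def abs_if split: if_splits)
    show "1 - e \<le> q (p0 \<gamma>)" if "\<gamma> \<in> K" for \<gamma>
      using close[of \<gamma>] p0K[OF that] that chars e by (auto simp: max_def min_def abs_if split: if_splits)
    show "\<bar>q (p0 \<gamma>)\<bar> \<le> e" if "\<gamma> \<in> C - U" for \<gamma>
      using close[of \<gamma>] p0C[OF that] that chars e by (auto simp: max_def min_def abs_if split: if_splits)
  qed
qed

definition plancherel :: "('g \<Rightarrow> complex) measure \<Rightarrow> bool" where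
  "plancherel md \<longleftrightarrow> (\<forall>f\<in>L12.
     (\<integral>\<^sup>+\<eta>. ennreal ((norm (fourier m f \<eta>))\<^sup>2) \<partial>md) = (\<integral>\<^sup>+x. ennreal ((norm (f x))\<^sup>2) \<partial>m))"

lemma plancherel_finite:
  assumes "plancherel md" "f \<in> L12"
  shows "(\<integral>\<^sup>+\<eta>. ennreal ((norm (fourier m f \<eta>))\<^sup>2) \<partial>md) < \<infinity>"
proof -
  have "integrable m (\<lambda>x. (norm (f x))\<^sup>2)" using assms(2) by (simp add: L12_def)
  then have "(\<integral>\<^sup>+x. ennreal ((norm (f x))\<^sup>2) \<partial>m) < \<infinity>"
    by (simp add: integrable_iff_bounded)
  then show ?thesis
    using assms by (simp add: plancherel_def)
qed

text \<open>A multiplier \<open>p\<close> turns the transform of \<open>f\<close> into that of another \<open>g\<close>, and both sides are the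
squared norm of \<open>g\<close>.\<close>

lemma plancherel_multiplier:
  assumes md: "plancherel md1" "plancherel md2" and sp: "space md1 = characters" "space md2 = characters"
    and p: "p \<in> multiplier_ring" and f: "f \<in> L12"
  shows "(\<integral>\<^sup>+\<eta>. ennreal ((p \<eta>)\<^sup>2 * (norm (fourier m f \<eta>))\<^sup>2) \<partial>md1) =
    (\<integral>\<^sup>+\<eta>. ennreal ((p \<eta>)\<^sup>2 * (norm (fourier m f \<eta>))\<^sup>2) \<partial>md2)"
proof -
  obtain g where g: "g \<in> L12" "\<And>\<gamma>. \<gamma> \<in> characters \<Longrightarrow> fourier m g \<gamma> = of_real (p \<gamma>) * fourier m f \<gamma>"
    using p f unfolding multiplier_ring_def multiplier_def by blast
  have "(\<integral>\<^sup>+\<eta>. ennreal ((p \<eta>)\<^sup>2 * (norm (fourier m f \<eta>))\<^sup>2) \<partial>md) =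
      (\<integral>\<^sup>+\<eta>. ennreal ((norm (fourier m g \<eta>))\<^sup>2) \<partial>md)" if "space md = characters" for md
    using that by (intro nn_integral_cong) (simp add: g(2) norm_mult power_mult_distrib)
  then show ?thesis
    using sp md g(1) by (simp add: plancherel_def)
qed

end

context haar_group
begin

text \<open>Off the zeros of the transform \<open>F\<close> of \<open>f\<close>, the dual group is exhausted by the open sets
\<open>{\<bar>F\<bar> > 1 / (n + 1)}\<close>. These have finite measure because \<open>\<bar>F\<bar>\<^sup>2\<close> is integrable, so inner regularity
fills them with compact sets up to a small error.\<close>

lemma fourier_density_tight:
  assumes md: "radon_on dual_topology md" and f: "f \<in> L12"
    and fin: "(\<integral>\<^sup>+\<eta>. ennreal ((norm (fourier m f \<eta>))\<^sup>2) \<partial>md) < \<infinity>"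
    and cont: "continuous_map dual_topology euclidean (fourier m f)"
    and bound: "\<And>\<eta>. \<eta> \<in> characters \<Longrightarrow> norm (fourier m f \<eta>) \<le> 1" and e: "0 < e"
  obtains C where "compactin dual_topology C"
    "emeasure (density md (\<lambda>\<eta>. ennreal ((norm (fourier m f \<eta>))\<^sup>2))) (characters - C) \<le> ennreal e"
proof -
  let ?w = "\<lambda>\<eta>. ennreal ((norm (fourier m f \<eta>))\<^sup>2)"
  let ?D = "density md ?w"
  have sets: "sets md = sets (borel_of dual_topology)" by (rule radon_on_sets[OF md])
  have sp: "space md = characters" using sets_eq_imp_space_eq[OF sets] by simp
  have fm[measurable]: "fourier m f \<in> borel_measurable md"
    by (rule continuous_map_borel_measurable[OF cont sets])
  let ?O = "\<lambda>n::nat. {\<eta> \<in> characters. norm (fourier m f \<eta>) > 1 / (n + 1)}"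
  have cn: "continuous_map dual_topology euclidean (\<lambda>\<eta>. norm (fourier m f \<eta>))"
    using continuous_map_compose[OF cont, of euclidean norm] by (simp add: comp_def continuous_intros)
  have openO: "openin dual_topology (?O n)" for n
    using openin_continuous_map_preimage[OF cn, of "{1 / (real n + 1) <..}"] by simp
  have Os[measurable]: "?O n \<in> sets md" for n
    using openin_sets_borel_of[OF openO] sets by simp
  have D: "emeasure ?D A = (\<integral>\<^sup>+\<eta>. ?w \<eta> * indicator A \<eta> \<partial>md)" if "A \<in> sets md" for A
    using that by (intro emeasure_density) measurable
  have Dle: "emeasure ?D A \<le> emeasure md A" if A: "A \<in> sets md" for A
  proof -
    have "emeasure ?D A \<le> (\<integral>\<^sup>+\<eta>. indicator A \<eta> \<partial>md)"
      unfolding D[OF A] using bound sp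
      by (intro nn_integral_mono) (auto simp: indicator_def power_le_one ennreal_le_1)
    then show ?thesis using A by simp
  qed
  have Dfin: "emeasure ?D A < \<infinity>" if A: "A \<in> sets md" for A
  proof -
    have "emeasure ?D A \<le> (\<integral>\<^sup>+\<eta>. ?w \<eta> \<partial>md)"
      unfolding D[OF A] by (intro nn_integral_mono) (auto simp: indicator_def)
    then show ?thesis using fin by (rule le_less_trans)
  qed
  have "(\<lambda>n. emeasure ?D (characters - ?O n)) \<longlonglongrightarrow> emeasure ?D (\<Inter>n. characters - ?O n)"
  proof (rule Lim_emeasure_decseq)
    show "range (\<lambda>n. characters - ?O n) \<subseteq> sets ?D"
      using sets.compl_sets[OF Os] sp by auto
    show "decseq (\<lambda>n. characters - ?O n)"
    proof (rule decseq_SucI)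
      fix n
      have "1 / (real (Suc n) + 1) \<le> 1 / (real n + 1)" by (simp add: field_simps)
      then show "characters - ?O (Suc n) \<subseteq> characters - ?O n" by auto
    qed
    show "emeasure ?D (characters - ?O n) \<noteq> \<infinity>" for n
      using Dfin[of "characters - ?O n"] sets.compl_sets[OF Os[of n]] sp by simp
  qed
  moreover have "emeasure ?D (\<Inter>n. characters - ?O n) = 0"
  proof -
    have z: "?w \<eta> = 0" if "\<eta> \<in> (\<Inter>n. characters - ?O n)" for \<eta>
    proof (rule ccontr)
      assume "?w \<eta> \<noteq> 0"
      then have "norm (fourier m f \<eta>) > 0" by auto
      then obtain n where "1 / (real n + 1) < norm (fourier m f \<eta>)"
        using nat_approx_posE[of "norm (fourier m f \<eta>)"] by (auto simp: add.commute)
      with that show False by auto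
    qed
    have "characters - ?O n \<in> sets md" for n
      using sets.compl_sets[OF Os] sp by auto
    then have "(\<Inter>n. characters - ?O n) \<in> sets md"
      by (intro sets.countable_INT) blast+
    then have "emeasure ?D (\<Inter>n. characters - ?O n) = (\<integral>\<^sup>+\<eta>. ?w \<eta> * indicator (\<Inter>n. characters - ?O n) \<eta> \<partial>md)"
      by (rule D)
    also have "\<dots> = (\<integral>\<^sup>+\<eta>. 0 \<partial>md)"
      by (intro nn_integral_cong) (use z in \<open>auto simp: indicator_def\<close>)
    finally show ?thesis by simp
  qed
  ultimately have "(\<lambda>n. emeasure ?D (characters - ?O n)) \<longlonglongrightarrow> 0" by simp
  then have "eventually (\<lambda>n. emeasure ?D (characters - ?O n) < ennreal (e / 2)) sequentially"
    using e by (intro order_tendstoD) auto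
  then obtain n where n: "emeasure ?D (characters - ?O n) < ennreal (e / 2)"
    by (auto simp: eventually_sequentially)
  have "emeasure md (?O n) < \<infinity>"
  proof -
    let ?c = "ennreal ((1 / (real n + 1))\<^sup>2)"
    have "?c * emeasure md (?O n) = (\<integral>\<^sup>+\<eta>. ?c * indicator (?O n) \<eta> \<partial>md)"
      by (rule nn_integral_cmult_indicator[symmetric]) measurable
    also have "\<dots> \<le> (\<integral>\<^sup>+\<eta>. ?w \<eta> \<partial>md)"
    proof (rule nn_integral_mono)
      fix \<eta>
      show "?c * indicator (?O n) \<eta> \<le> ?w \<eta>"
        by (cases "\<eta> \<in> ?O n") (auto intro!: ennreal_leI power_mono simp: indicator_def less_imp_le simp del: power_divide)
    qed
    finally have "?c * emeasure md (?O n) < \<infinity>" using fin by (rule le_less_trans)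
    then show ?thesis by (auto simp: ennreal_mult_less_top)
  qed
  then have fO: "emeasure md (?O n) \<noteq> \<infinity>" by simp
  obtain C where C: "compactin dual_topology C" "C \<subseteq> ?O n" "emeasure md (?O n) \<le> emeasure md C + ennreal (e / 2)"
  proof (cases "emeasure md (?O n) = 0")
    case True
    then show ?thesis by (intro that[of "{}"]) auto
  next
    case False
    then have "emeasure md (?O n) - ennreal (e / 2) < emeasure md (?O n)"
      using fO e by (intro ennreal_between) (auto simp: less_top zero_less_iff_neq_zero)
    then obtain C where C: "compactin dual_topology C" "C \<subseteq> ?O n" "emeasure md (?O n) - ennreal (e / 2) < emeasure md C"
      using radon_on_inner[OF md openO] by blast
    then have "emeasure md (?O n) \<le> emeasure md C + ennreal (e / 2)"
      using less_imp_le[OF C(3)] fO unfolding ennreal_minus_le_iff by (simp add: add.commute)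
    with C show ?thesis by (intro that)
  qed
  have Cs: "C \<in> sets md"
    using closedin_sets_borel_of[OF compactin_imp_closedin[OF Hausdorff_space_dual C(1)]] sets by simp
  have "emeasure md (?O n - C) \<le> ennreal (e / 2)"
  proof -
    have "emeasure md (?O n - C) = emeasure md (?O n) - emeasure md C"
      using C(2) Cs radon_on_compact[OF md C(1)] by (intro emeasure_Diff) auto
    also have "\<dots> \<le> ennreal (e / 2)"
      using C(3) fO by (simp add: ennreal_minus_le_iff add.commute)
    finally show ?thesis .
  qed
  then have DOC: "emeasure ?D (?O n - C) \<le> ennreal (e / 2)"
    using Dle[of "?O n - C"] Cs Os by (meson order_trans sets.Diff)
  have "emeasure ?D (characters - C) \<le> emeasure ?D ((characters - ?O n) \<union> (?O n - C))"
    using C(2) Cs sets.compl_sets[OF Os[of n]] sp by (intro emeasure_mono) auto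
  also have "\<dots> \<le> emeasure ?D (characters - ?O n) + emeasure ?D (?O n - C)"
    using Cs sets.compl_sets[OF Os[of n]] sp by (intro emeasure_subadditive) auto
  also have "\<dots> \<le> ennreal (e / 2) + ennreal (e / 2)"
    using n DOC by (intro add_mono) auto
  also have "\<dots> = ennreal e"
    using e by (simp add: ennreal_plus[symmetric] del: ennreal_plus)
  finally show thesis
    using C(1) that by blast
qed

text \<open>The squared multipliers \<open>p\<^sup>2\<close> from \<open>multiplier_ring_bump\<close> approximate the indicator of \<open>K\<close>. Under
the second measure, the error comes from the part of \<open>U\<close> outside \<open>K\<close>, from \<open>C - U\<close> where \<open>p\<close> is
small, and from the complement of \<open>C\<close> where the weight has little mass; all three vanish with \<open>e\<close>.\<close>

lemma fourier_weighted_compact_le: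
  assumes md: "radon_on dual_topology md1" "radon_on dual_topology md2" "plancherel md1" "plancherel md2"
    and f: "f \<in> L12" and cont: "continuous_map dual_topology euclidean (fourier m f)"
    and bound: "\<And>\<eta>. \<eta> \<in> characters \<Longrightarrow> norm (fourier m f \<eta>) \<le> 1"
    and K: "compactin dual_topology K"
  shows "(\<integral>\<^sup>+\<eta>. ennreal ((norm (fourier m f \<eta>))\<^sup>2) * indicator K \<eta> \<partial>md1) \<le>
    (\<integral>\<^sup>+\<eta>. ennreal ((norm (fourier m f \<eta>))\<^sup>2) * indicator K \<eta> \<partial>md2)"
proof -
  let ?w = "\<lambda>\<eta>. ennreal ((norm (fourier m f \<eta>))\<^sup>2)"
  let ?D = "density md2 ?w"
  have sets: "sets md1 = sets (borel_of dual_topology)" "sets md2 = sets (borel_of dual_topology)"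
    using md(1,2) by (auto dest: radon_on_sets)
  have sp: "space md1 = characters" "space md2 = characters"
    using sets_eq_imp_space_eq[OF sets(1)] sets_eq_imp_space_eq[OF sets(2)] by simp_all
  have fm[measurable]: "fourier m f \<in> borel_measurable md1" "fourier m f \<in> borel_measurable md2"
    using sets by (auto intro: continuous_map_borel_measurable[OF cont])
  have Ks[measurable]: "K \<in> sets md1" "K \<in> sets md2"
    using closedin_sets_borel_of[OF compactin_imp_closedin[OF Hausdorff_space_dual K]] sets by simp_all
  have D: "emeasure ?D A = (\<integral>\<^sup>+\<eta>. ?w \<eta> * indicator A \<eta> \<partial>md2)" if "A \<in> sets md2" for A
    using that by (intro emeasure_density) measurable
  define S where "S = (\<integral>\<^sup>+\<eta>. ?w \<eta> \<partial>md2)"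
  define I1 where "I1 = (\<integral>\<^sup>+\<eta>. ?w \<eta> * indicator K \<eta> \<partial>md1)"
  define I2 where "I2 = (\<integral>\<^sup>+\<eta>. ?w \<eta> * indicator K \<eta> \<partial>md2)"
  have S: "S < \<infinity>" unfolding S_def by (rule plancherel_finite[OF md(4) f])
  have "I1 \<le> (\<integral>\<^sup>+\<eta>. ?w \<eta> \<partial>md1)"
    unfolding I1_def by (intro nn_integral_mono) (auto simp: indicator_def)
  then have I1: "I1 < \<infinity>" using plancherel_finite[OF md(3) f] by (rule le_less_trans)
  have "I2 \<le> S"
    unfolding I2_def S_def by (intro nn_integral_mono) (auto simp: indicator_def)
  then have I2: "I2 < \<infinity>" using S by (rule le_less_trans)
  have main: "ennreal ((1 - e)\<^sup>2) * I1 \<le> ennreal ((1 + e)\<^sup>2) * (I2 + ennreal e) + ennreal (e\<^sup>2) * S + ennreal ((1 + e)\<^sup>2) * ennreal e"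
    if e: "0 < e" "e < 1" for e
  proof -
    obtain C where C: "compactin dual_topology C" "emeasure ?D (characters - C) \<le> ennreal e"
      using fourier_density_tight[OF md(2) f plancherel_finite[OF md(4) f] cont bound e(1)] by blast
    have "emeasure md2 K < emeasure md2 K + ennreal e"
      using radon_on_compact[OF md(2) K] e by (simp add: ennreal_add_left_cancel_less[of _ 0, simplified] ennreal_less_top)
    then obtain U where U: "openin dual_topology U" "K \<subseteq> U" "emeasure md2 U < emeasure md2 K + ennreal e"
      using radon_on_outer[OF md(2) Ks(2)] by blast
    have Us: "U \<in> sets md2" using openin_sets_borel_of[OF U(1)] sets by simp
    have Cs: "C \<in> sets md2"
      using closedin_sets_borel_of[OF compactin_imp_closedin[OF Hausdorff_space_dual C(1)]] sets by simp
    have CC: "characters - C \<in> sets md2" using sets.compl_sets[OF Cs] sp by simp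
    have DU: "emeasure ?D U \<le> I2 + ennreal e"
    proof -
      have "emeasure ?D U = emeasure ?D (K \<union> (U - K))" using U(2) by (simp add: Un_absorb1)
      also have "\<dots> \<le> emeasure ?D K + emeasure ?D (U - K)"
        using Ks Us by (intro emeasure_subadditive) auto
      also have "emeasure ?D K = I2" unfolding I2_def by (rule D[OF Ks(2)])
      also have "emeasure ?D (U - K) \<le> emeasure md2 (U - K)"
      proof -
        have "emeasure ?D (U - K) \<le> (\<integral>\<^sup>+\<eta>. indicator (U - K) \<eta> \<partial>md2)"
          unfolding D[OF sets.Diff[OF Us Ks(2)]] using bound sp
          by (intro nn_integral_mono) (auto simp: indicator_def power_le_one ennreal_le_1)
        then show ?thesis using Us Ks by simp
      qed
      also have "emeasure md2 (U - K) = emeasure md2 U - emeasure md2 K"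
        using U(2) Us Ks radon_on_compact[OF md(2) K] by (intro emeasure_Diff) auto
      also have "\<dots> \<le> ennreal e"
        using U(3) radon_on_compact[OF md(2) K] by (intro ennreal_minus_le_iff[THEN iffD2]) (auto simp: less_imp_le)
      finally show ?thesis by (simp add: add_left_mono)
    qed
    obtain p where p: "p \<in> multiplier_ring" "\<And>\<gamma>. \<gamma> \<in> characters \<Longrightarrow> \<bar>p \<gamma>\<bar> \<le> 1 + e"
      "\<And>\<gamma>. \<gamma> \<in> K \<Longrightarrow> 1 - e \<le> p \<gamma>" "\<And>\<gamma>. \<gamma> \<in> C - U \<Longrightarrow> \<bar>p \<gamma>\<bar> \<le> e"
      using multiplier_ring_bump[OF C(1) K U(1,2) e] by blast
    have "ennreal ((1 - e)\<^sup>2) * I1 = (\<integral>\<^sup>+\<eta>. ennreal ((1 - e)\<^sup>2) * (?w \<eta> * indicator K \<eta>) \<partial>md1)"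
      unfolding I1_def using Ks by (intro nn_integral_cmult[symmetric]) measurable
    also have "\<dots> \<le> (\<integral>\<^sup>+\<eta>. ennreal ((p \<eta>)\<^sup>2 * (norm (fourier m f \<eta>))\<^sup>2) \<partial>md1)"
    proof (rule nn_integral_mono)
      fix \<eta>
      show "ennreal ((1 - e)\<^sup>2) * (?w \<eta> * indicator K \<eta>) \<le> ennreal ((p \<eta>)\<^sup>2 * (norm (fourier m f \<eta>))\<^sup>2)"
      proof (cases "\<eta> \<in> K")
        case True
        then have "(1 - e)\<^sup>2 \<le> (p \<eta>)\<^sup>2" using p(3) e by (intro power_mono) auto
        then show ?thesis
          using True by (simp add: ennreal_mult[symmetric] mult_right_mono)
      qed simp
    qed
    also have "\<dots> = (\<integral>\<^sup>+\<eta>. ennreal ((p \<eta>)\<^sup>2 * (norm (fourier m f \<eta>))\<^sup>2) \<partial>md2)"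
      by (rule plancherel_multiplier[OF md(3,4) sp p(1) f])
    also have "\<dots> \<le> (\<integral>\<^sup>+\<eta>. ennreal ((1 + e)\<^sup>2) * (?w \<eta> * indicator U \<eta>) + ennreal (e\<^sup>2) * ?w \<eta> +
        ennreal ((1 + e)\<^sup>2) * (?w \<eta> * indicator (characters - C) \<eta>) \<partial>md2)"
    proof (rule nn_integral_mono)
      fix \<eta> assume "\<eta> \<in> space md2"
      then have \<eta>: "\<eta> \<in> characters" using sp by simp
      have big: "(p \<eta>)\<^sup>2 \<le> (1 + e)\<^sup>2"
        using power_mono[OF p(2)[OF \<eta>], of 2] by simp
      have small: "(p \<eta>)\<^sup>2 \<le> e\<^sup>2" if "\<eta> \<in> C - U"
        using power_mono[OF p(4)[OF that], of 2] by simp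
      have *: "ennreal ((p \<eta>)\<^sup>2 * (norm (fourier m f \<eta>))\<^sup>2) \<le> ennreal c * ?w \<eta>" if "(p \<eta>)\<^sup>2 \<le> c" for c
        using that order_trans[OF zero_le_power2 that] by (simp add: ennreal_mult[symmetric] mult_right_mono)
      consider "\<eta> \<in> U" | "\<eta> \<in> C - U" | "\<eta> \<notin> C" by blast
      then show "ennreal ((p \<eta>)\<^sup>2 * (norm (fourier m f \<eta>))\<^sup>2) \<le> ennreal ((1 + e)\<^sup>2) * (?w \<eta> * indicator U \<eta>) +
          ennreal (e\<^sup>2) * ?w \<eta> + ennreal ((1 + e)\<^sup>2) * (?w \<eta> * indicator (characters - C) \<eta>)"
      proof cases
        case 1
        then show ?thesis
          using *[OF big] by (simp add: add_increasing2 add.assoc)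
      next
        case 2
        then show ?thesis
          using *[OF small] by (simp add: add_increasing add_increasing2)
      next
        case 3
        then show ?thesis
          using *[OF big] \<eta> by (simp add: add_increasing)
      qed
    qed
    also have "\<dots> = ennreal ((1 + e)\<^sup>2) * emeasure ?D U + ennreal (e\<^sup>2) * S + ennreal ((1 + e)\<^sup>2) * emeasure ?D (characters - C)"
      unfolding D[OF Us] D[OF CC] S_def using Us CC
      by (simp add: nn_integral_add nn_integral_cmult)
    also have "\<dots> \<le> ennreal ((1 + e)\<^sup>2) * (I2 + ennreal e) + ennreal (e\<^sup>2) * S + ennreal ((1 + e)\<^sup>2) * ennreal e"
      using DU C(2) by (intro add_mono mult_left_mono) auto
    finally show ?thesis .
  qed
  define a where "a = enn2real I1"
  define b where "b = enn2real I2"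
  define s where "s = enn2real S"
  have conv: "I1 = ennreal a" "I2 = ennreal b" "S = ennreal s" "0 \<le> a" "0 \<le> b" "0 \<le> s"
    using I1 I2 S by (simp_all add: a_def b_def s_def)
  have real: "(1 - e)\<^sup>2 * a \<le> (1 + e)\<^sup>2 * (b + e) + e\<^sup>2 * s + (1 + e)\<^sup>2 * e" if e: "0 < e" "e < 1" for e
  proof -
    have "ennreal ((1 - e)\<^sup>2 * a) \<le> ennreal ((1 + e)\<^sup>2 * (b + e) + e\<^sup>2 * s + (1 + e)\<^sup>2 * e)"
      using main[OF e] e conv(4-6) unfolding conv(1-3)
      by (simp add: ennreal_mult[symmetric] ennreal_plus[symmetric] del: ennreal_plus)
    then show ?thesis
      using e conv(4-6) by (subst (asm) ennreal_le_iff) simp_all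
  qed
  have "a \<le> b"
  proof (rule tendsto_le[OF trivial_limit_at_right_real])
    show "((\<lambda>e. (1 + e)\<^sup>2 * (b + e) + e\<^sup>2 * s + (1 + e)\<^sup>2 * e) \<longlongrightarrow> b) (at_right 0)"
      by (auto intro!: tendsto_eq_intros)
    show "((\<lambda>e. (1 - e)\<^sup>2 * a) \<longlongrightarrow> a) (at_right 0)"
      by (auto intro!: tendsto_eq_intros)
    show "eventually (\<lambda>e. (1 - e)\<^sup>2 * a \<le> (1 + e)\<^sup>2 * (b + e) + e\<^sup>2 * s + (1 + e)\<^sup>2 * e) (at_right 0)"
      using real eventually_at_right_real[of 0 1] by (auto elim!: eventually_mono)
  qed
  then show ?thesis
    using conv unfolding I1_def[symmetric] I2_def[symmetric] by (simp add: ennreal_leI)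
qed

text \<open>It remains to remove the weight, which is done with normalized indicators of small neighbourhoods
of 0: their transforms are bounded by 1 everywhere and close to 1 on \<open>K\<close>.\<close>

lemma plancherel_compact_le:
  assumes md: "radon_on dual_topology md1" "radon_on dual_topology md2" "plancherel md1" "plancherel md2"
    and K: "compactin dual_topology K"
  shows "emeasure md1 K \<le> emeasure md2 K"
proof -
  have sets: "sets md1 = sets (borel_of dual_topology)" "sets md2 = sets (borel_of dual_topology)"
    using md(1,2) by (auto dest: radon_on_sets)
  have Ks[measurable]: "K \<in> sets md1" "K \<in> sets md2"
    using closedin_sets_borel_of[OF compactin_imp_closedin[OF Hausdorff_space_dual K]] sets by simp_all
  have Kc: "K \<subseteq> characters" using compactin_subset_topspace[OF K] by simp
  have main: "ennreal ((1 - e)\<^sup>2) * emeasure md1 K \<le> emeasure md2 K" if e: "0 < e" "e < 1" for e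
  proof -
    obtain W O' where W: "compact W" and O': "open O'" "0 \<in> O'" "O' \<subseteq> W"
      and close: "\<And>\<gamma> x. \<gamma> \<in> K \<Longrightarrow> x \<in> W \<Longrightarrow> norm (\<gamma> x - 1) < e"
      using compact_characters_equicontinuous[OF K e(1)] by blast
    have Ws: "W \<in> sets m" using W sets_m by (simp add: compact_imp_closed)
    have fin: "emeasure m W < \<infinity>" by (rule emeasure_compact_finite[OF W])
    have "0 < emeasure m W"
      using emeasure_open_pos[OF O'(1,2)] emeasure_mono[OF O'(3) Ws] by (rule less_le_trans)
    then have mW: "measure m W > 0"
      using fin by (simp add: emeasure_eq_ennreal_measure)
    define f where "f x = complex_of_real (indicator W x / measure m W)" for x
    have intW: "integrable m (indicator W :: 'g \<Rightarrow> real)"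
      using Ws fin by (simp add: integrable_indicator_iff)
    have nf: "norm (f x) = indicator W x / measure m W" for x
      using mW by (simp add: f_def indicator_def norm_divide)
    have "integrable m f"
      unfolding f_def using intW by (intro integrable_of_real integrable_divide) simp
    moreover have "(\<lambda>x. (norm (f x))\<^sup>2) = (\<lambda>x. indicator W x / (measure m W)\<^sup>2)"
      unfolding nf by (auto simp: fun_eq_iff indicator_def power_divide)
    ultimately have f: "f \<in> L12"
      using intW by (simp add: L12_def)
    have f1: "(\<integral>x. norm (f x) \<partial>m) = 1"
      unfolding nf using Ws mW fin by simp
    have cont: "continuous_map dual_topology euclidean (fourier m f)"
      using continuous_map_fourier[OF sets_m \<open>integrable m f\<close> W] by (simp add: f_def)
    have bound: "norm (fourier m f \<eta>) \<le> 1" if "\<eta> \<in> characters" for \<eta>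
    proof -
      have "norm (fourier m f \<eta>) \<le> (\<integral>x. norm (\<eta> x * f x) \<partial>m)"
        unfolding fourier_def by (rule integral_norm_bound)
      also have "\<dots> = 1"
        using f1 by (simp add: norm_mult character_norm[OF that])
      finally show ?thesis .
    qed
    have low: "(1 - e)\<^sup>2 \<le> (norm (fourier m f \<eta>))\<^sup>2" if \<eta>: "\<eta> \<in> K" for \<eta>
    proof -
      have \<eta>c: "\<eta> \<in> characters" using \<eta> Kc by auto
      have fi: "(\<integral>x. f x \<partial>m) = 1"
        unfolding f_def using Ws mW fin by (simp del: of_real_divide)
      have "fourier m f \<eta> - 1 = (\<integral>x. (\<eta> x - 1) * f x \<partial>m)"
        using integrable_character_mult[OF f \<eta>c] \<open>integrable m f\<close> fi
        by (simp add: fourier_def left_diff_distrib)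
      also have "norm \<dots> \<le> (\<integral>x. norm ((\<eta> x - 1) * f x) \<partial>m)"
        by (rule integral_norm_bound)
      also have "\<dots> \<le> (\<integral>x. e * norm (f x) \<partial>m)"
      proof (rule integral_mono)
        show "integrable m (\<lambda>x. norm ((\<eta> x - 1) * f x))"
          using integrable_character_mult[OF f \<eta>c] \<open>integrable m f\<close>
          by (intro integrable_norm) (simp add: left_diff_distrib)
        show "integrable m (\<lambda>x. e * norm (f x))" using \<open>integrable m f\<close> by simp
        show "norm ((\<eta> x - 1) * f x) \<le> e * norm (f x)" for x
          using close[OF \<eta>, of x] by (cases "x \<in> W") (auto simp: f_def norm_mult norm_divide intro!: less_imp_le divide_strict_right_mono mW)
      qed
      also have "\<dots> = e" using f1 by simp
      finally have "1 - e \<le> norm (fourier m f \<eta>)"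
        using norm_triangle_ineq2[of 1 "1 - fourier m f \<eta>"] by (simp add: norm_minus_commute)
      then show ?thesis using e by (intro power_mono) auto
    qed
    have "ennreal ((1 - e)\<^sup>2) * emeasure md1 K = (\<integral>\<^sup>+\<eta>. ennreal ((1 - e)\<^sup>2) * indicator K \<eta> \<partial>md1)"
      using Ks by (simp add: nn_integral_cmult_indicator)
    also have "\<dots> \<le> (\<integral>\<^sup>+\<eta>. ennreal ((norm (fourier m f \<eta>))\<^sup>2) * indicator K \<eta> \<partial>md1)"
      using low by (intro nn_integral_mono) (auto simp: indicator_def intro: ennreal_leI)
    also have "\<dots> \<le> (\<integral>\<^sup>+\<eta>. ennreal ((norm (fourier m f \<eta>))\<^sup>2) * indicator K \<eta> \<partial>md2)"
      by (rule fourier_weighted_compact_le[OF md f cont bound K])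
    also have "\<dots> \<le> (\<integral>\<^sup>+\<eta>. indicator K \<eta> \<partial>md2)"
      using bound Kc by (intro nn_integral_mono) (auto simp: indicator_def power_le_one ennreal_le_1)
    also have "\<dots> = emeasure md2 K" using Ks by simp
    finally show ?thesis .
  qed
  have fin: "emeasure md1 K < \<infinity>" "emeasure md2 K < \<infinity>"
    using radon_on_compact[OF md(1) K] radon_on_compact[OF md(2) K] .
  have "measure md1 K \<le> measure md2 K"
  proof (rule tendsto_le[OF trivial_limit_at_right_real tendsto_const])
    show "((\<lambda>e. (1 - e)\<^sup>2 * measure md1 K) \<longlongrightarrow> measure md1 K) (at_right 0)"
      by (auto intro!: tendsto_eq_intros)
    have "(1 - e)\<^sup>2 * measure md1 K \<le> measure md2 K" if "0 < e" "e < 1" for e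
      using main[OF that] fin by (simp add: emeasure_eq_ennreal_measure ennreal_mult[symmetric])
    then show "eventually (\<lambda>e. (1 - e)\<^sup>2 * measure md1 K \<le> measure md2 K) (at_right 0)"
      using eventually_at_right_real[of 0 1] by (auto elim!: eventually_mono)
  qed
  then show ?thesis
    using fin by (simp add: emeasure_eq_ennreal_measure)
qed

text \<open>Both measures agree on compact sets by symmetry, and regularity extends this to Borel sets.\<close>

lemma plancherel_measure_unique:
  assumes md: "radon_on dual_topology md1" "radon_on dual_topology md2" "plancherel md1" "plancherel md2"
  shows "md1 = md2"
proof (rule measure_eqI)
  show sets: "sets md1 = sets md2"
    using md(1,2) by (simp add: radon_on_sets)
  fix A assume A: "A \<in> sets md1"
  show "emeasure md1 A = emeasure md2 A"
  proof (rule antisym)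
    show "emeasure md1 A \<le> emeasure md2 A"
      by (rule radon_on_le[OF md(1,2) Hausdorff_space_dual plancherel_compact_le[OF md] A])
    show "emeasure md2 A \<le> emeasure md1 A"
      by (rule radon_on_le[OF md(2,1) Hausdorff_space_dual plancherel_compact_le[OF md(2,1,4,3)] A[unfolded sets]])
  qed
qed

end


section \<open>The dual Haar measure of an isomorphic group\<close>

lemma radon_on_image:
  fixes g :: "'a \<Rightarrow> 'b"
  assumes m: "radon_on S m" and g: "bij g" "continuous_map S T g" "continuous_map T S (inv g)"
    and T: "Hausdorff_space T" and c: "0 < c"
  defines "m' \<equiv> scale_measure (ennreal c) (distr m (borel_of T) g)"
  shows "scaling_iso m m' g c" "radon_on T m'"
proof -
  have sets: "sets m = sets (borel_of S)" "sets m' = sets (borel_of T)"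
    using radon_on_sets[OF m] by (simp_all add: m'_def)
  have sp: "space m = topspace S" "space m' = topspace T"
    using sets_eq_imp_space_eq[OF sets(1)] sets_eq_imp_space_eq[OF sets(2)] by simp_all
  have g_meas: "g \<in> measurable m (borel_of T)"
    using measurable_borel_of_continuous_map[OF g(2)] by (simp add: measurable_cong_sets[OF sets(1) refl])
  show iso: "scaling_iso m m' g c"
  proof
    show "g \<in> measurable m m'" "inv g \<in> measurable m' m"
      using measurable_borel_of_continuous_map[OF g(2)] measurable_borel_of_continuous_map[OF g(3)]
      by (simp_all add: measurable_cong_sets[OF sets] measurable_cong_sets[OF sets(2,1)])
    show "emeasure m' E = ennreal c * emeasure m (g -` E \<inter> space m)" if "E \<in> sets m'" for E
      using that sets by (simp add: m'_def emeasure_distr[OF g_meas])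
  qed (rule g(1) c)+
  interpret scaling_iso m m' g c by (rule iso)
  have cc: "ennreal (1 / c) * (ennreal c * x) = x" "ennreal c * (ennreal (1 / c) * x) = x" for x
    using c by (simp_all add: mult.assoc[symmetric] ennreal_mult[symmetric])
  have strict: "ennreal d * x < ennreal d * y" if "x < y" "0 < d" for d :: real and x y
    using that by (intro ennreal_mult_strict_left_mono) auto
  have gS: "g x \<in> topspace T" if "x \<in> topspace S" for x
    using continuous_map_image_subset_topspace[OF g(2)] that by blast
  have gT: "inv g y \<in> topspace S" if "y \<in> topspace T" for y
    using continuous_map_image_subset_topspace[OF g(3)] that by blast
  have compact_image: "emeasure m' K = ennreal c * emeasure m (inv g ` K)" if K: "compactin T K" for K
  proof -
    have "K \<in> sets m'"
      using closedin_sets_borel_of[OF compactin_imp_closedin[OF T K]] sets by simp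
    moreover have "g -` K \<inter> space m = inv g ` K"
      using compactin_subset_topspace[OF K] gT unfolding sp by (force intro: image_eqI[of _ _ "g _"])
    ultimately show ?thesis by (simp add: emeasure_image)
  qed
  show "radon_on T m'"
    unfolding radon_on_def
  proof (intro conjI allI impI)
    show "sets m' = sets (borel_of T)" by (rule sets)
  next
    fix K assume K: "compactin T K"
    then show "emeasure m' K < \<infinity>"
      using radon_on_compact[OF m image_compactin[OF K g(3)]] by (simp add: compact_image ennreal_mult_less_top)
  next
    fix A r assume A: "A \<in> sets m'" and r: "emeasure m' A < r"
    let ?A = "g -` A \<inter> space m"
    have "emeasure m ?A < ennreal (1 / c) * r"
      using strict[OF r, of "1 / c"] c by (simp add: emeasure_image[OF A] cc)
    moreover have "?A \<in> sets m"
      using measurable_g A by (rule measurable_sets)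
    ultimately obtain U where U: "openin S U" "?A \<subseteq> U" "emeasure m U < ennreal (1 / c) * r"
      using radon_on_outer[OF m] by blast
    let ?V = "{y \<in> topspace T. inv g y \<in> U}"
    have V: "openin T ?V"
      by (rule openin_continuous_map_preimage[OF g(3) U(1)])
    have "g -` ?V \<inter> space m = U"
      using openin_subset[OF U(1)] gS by (auto simp: sp)
    then have "emeasure m' ?V = ennreal c * emeasure m U"
      using openin_sets_borel_of[OF V] sets by (simp add: emeasure_image)
    also have "\<dots> < r"
      using strict[OF U(3) c] by (simp add: cc)
    finally have "emeasure m' ?V < r" .
    moreover have "A \<subseteq> ?V"
      using sets.sets_into_space[OF A] gT U(2) by (force simp: sp)
    ultimately show "\<exists>U. openin T U \<and> A \<subseteq> U \<and> emeasure m' U < r"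
      using V by blast
  next
    fix U r assume U: "openin T U" and r: "r < emeasure m' U"
    let ?U = "{x \<in> topspace S. g x \<in> U}"
    have "g -` U \<inter> space m = ?U" by (auto simp: sp)
    then have "emeasure m' U = ennreal c * emeasure m ?U"
      using openin_sets_borel_of[OF U] sets by (simp add: emeasure_image)
    then have "ennreal (1 / c) * r < emeasure m ?U"
      using strict[OF r, of "1 / c"] c by (simp add: cc)
    then obtain K where K: "compactin S K" "K \<subseteq> ?U" "ennreal (1 / c) * r < emeasure m K"
      using radon_on_inner[OF m openin_continuous_map_preimage[OF g(2) U]] by blast
    have gK: "compactin T (g ` K)"
      by (rule image_compactin[OF K(1) g(2)])
    have "r < ennreal c * emeasure m K"
      using strict[OF K(3) c] by (simp add: cc)
    also have "\<dots> = emeasure m' (g ` K)"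
      unfolding compact_image[OF gK] by (simp add: image_image)
    finally show "\<exists>K. compactin T K \<and> K \<subseteq> U \<and> r < emeasure m' K"
      using gK K(2) by blast
  qed
qed

context group_iso
begin

lemma character_comp_inv: "\<gamma> \<in> characters \<Longrightarrow> \<gamma> \<circ> inv h \<in> characters"
  unfolding characters_def
  by (auto simp: inv_h_add intro: continuous_on_compose2[OF _ continuous_h(2)] simp flip: o_def)

lemma continuous_map_comp_inv: "continuous_map dual_topology dual_topology (\<lambda>\<gamma>. \<gamma> \<circ> inv h)"
  unfolding dual_topology_def[where 'g = 'k]
proof (rule continuous_on_generated_topo)
  fix U assume "U \<in> {{\<eta> \<in> characters :: ('k \<Rightarrow> complex) set. \<eta> ` K \<subseteq> U} |K U. compact K \<and> open U}"
  then obtain K V where U: "U = {\<eta> \<in> characters. \<eta> ` K \<subseteq> V}" and KV: "compact K" "open V"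
    by blast
  have "compact (inv h ` K)"
    by (rule compact_continuous_image[OF continuous_h(2) KV(1)])
  then have "openin dual_topology {\<gamma> \<in> characters. \<gamma> ` (inv h ` K) \<subseteq> V}"
    using KV(2) by (rule openin_dual_subbase)
  moreover have "(\<lambda>\<gamma>. \<gamma> \<circ> inv h) -` U \<inter> topspace dual_topology = {\<gamma> \<in> characters. \<gamma> ` (inv h ` K) \<subseteq> V}"
    by (auto simp: U character_comp_inv)
  ultimately show "openin dual_topology ((\<lambda>\<gamma>. \<gamma> \<circ> inv h) -` U \<inter> topspace dual_topology)"
    by simp
next
  show "(\<lambda>\<gamma>. \<gamma> \<circ> inv h) ` topspace dual_topology \<subseteq> \<Union>{{\<eta> \<in> characters. \<eta> ` K \<subseteq> U} |K U. compact K \<and> open U}"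
    unfolding topology_generated_by_topspace[symmetric] dual_topology_def[symmetric] topspace_dual
    by (auto intro: character_comp_inv)
qed

lemma bij_comp_inv: "bij (\<lambda>\<gamma> :: 'g \<Rightarrow> complex. \<gamma> \<circ> inv h)"
  and inv_comp_inv: "inv (\<lambda>\<gamma> :: 'g \<Rightarrow> complex. \<gamma> \<circ> inv h) = (\<lambda>\<eta>. \<eta> \<circ> h)"
proof -
  have "(\<lambda>\<gamma> :: 'g \<Rightarrow> complex. \<gamma> \<circ> inv h) \<circ> (\<lambda>\<eta>. \<eta> \<circ> h) = id" "(\<lambda>\<eta>. \<eta> \<circ> h) \<circ> (\<lambda>\<gamma> :: 'g \<Rightarrow> complex. \<gamma> \<circ> inv h) = id"
    by (auto simp: fun_eq_iff)
  then show "bij (\<lambda>\<gamma> :: 'g \<Rightarrow> complex. \<gamma> \<circ> inv h)"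
    "inv (\<lambda>\<gamma> :: 'g \<Rightarrow> complex. \<gamma> \<circ> inv h) = (\<lambda>\<eta>. \<eta> \<circ> h)"
    by (auto intro: o_bij inv_unique_comp)
qed

lemma char_exponent_push: "char_exponent N (\<lambda>t \<omega>. h (X t \<omega>)) (\<gamma> \<circ> inv h) = char_exponent N X \<gamma>"
  by (simp add: char_exponent_def)

end

text \<open>The Plancherel identity carries the normalization of the pair: by uniqueness it fixes the scale
of the dual measure.\<close>

lemma normalized_haar_pair_plancherel:
  assumes "normalized_haar_pair m md"
  shows "haar_group m" "radon_on dual_topology md" "haar_group.plancherel m md"
proof -
  show "haar_group m"
    using assms by unfold_locales (simp add: normalized_haar_pair_def)
  then show "haar_group.plancherel m md"
    using assms by (simp add: haar_group.plancherel_def haar_group.L12_def normalized_haar_pair_def)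
  show "radon_on dual_topology md"
    using assms by (intro haar_measure_imp_radon_on[where mul = "\<lambda>\<eta> \<eta>' x. \<eta> x * \<eta>' x"]) (simp add: normalized_haar_pair_def)
qed

locale normalized_haar_iso = haar_iso h mG m\<Gamma> \<mu>
  for h :: "'g::lca_group \<Rightarrow> 'k::lca_group" and mG m\<Gamma> \<mu> +
  fixes mG' :: "('g \<Rightarrow> complex) measure" and m\<Gamma>' :: "('k \<Rightarrow> complex) measure"
  assumes pair_G: "normalized_haar_pair mG mG'" and pair_\<Gamma>: "normalized_haar_pair m\<Gamma> m\<Gamma>'"
begin

sublocale G: haar_group mG
  by (rule normalized_haar_pair_plancherel(1)[OF pair_G])

sublocale \<Gamma>: haar_group m\<Gamma>
  by (rule normalized_haar_pair_plancherel(1)[OF pair_\<Gamma>])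

text \<open>The image of \<open>mG'\<close> under the adjoint map, scaled by \<open>1 / \<mu>\<close>, satisfies the Plancherel identity
of \<open>\<Gamma>\<close>: the transform on \<open>\<Gamma>\<close> is \<open>\<mu>\<close> times the one on \<open>G\<close>, so its square contributes \<open>\<mu>\<^sup>2\<close>, and the
squared norms on \<open>\<Gamma>\<close> need a factor \<open>\<mu>\<close>.\<close>

sublocale dual: scaling_iso mG' m\<Gamma>' "\<lambda>\<gamma>. \<gamma> \<circ> inv h" "1 / \<mu>"
proof -
  interpret inv: group_iso "inv h" by (rule inverse)
  let ?g = "\<lambda>\<gamma> :: 'g \<Rightarrow> complex. \<gamma> \<circ> inv h"
  let ?\<nu> = "scale_measure (ennreal (1 / \<mu>)) (distr mG' (borel_of dual_topology) ?g)"
  have cont: "continuous_map dual_topology dual_topology (inv ?g)"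
    using inv.continuous_map_comp_inv unfolding inv_comp_inv by (simp add: inv_inv_eq[OF bij_h])
  have c: "0 < 1 / \<mu>" using \<mu>_pos by simp
  note image = radon_on_image[OF normalized_haar_pair_plancherel(2)[OF pair_G]
      bij_comp_inv continuous_map_comp_inv cont Hausdorff_space_dual c]
  interpret \<nu>: scaling_iso mG' ?\<nu> ?g "1 / \<mu>" by (rule image(1))
  have "\<Gamma>.plancherel ?\<nu>"
    unfolding \<Gamma>.plancherel_def
  proof
    fix f assume f: "f \<in> \<Gamma>.L12"
    let ?f = "\<lambda>x. f (h x)"
    have fh: "?f \<in> G.L12"
      using f haar.integrable_comp_iff[of f] haar.integrable_comp_iff[of "\<lambda>y. (norm (f y))\<^sup>2"]
      by (simp add: G.L12_def \<Gamma>.L12_def)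
    have four: "fourier m\<Gamma> f (\<gamma> \<circ> inv h) = of_real \<mu> * fourier mG ?f \<gamma>" for \<gamma>
      unfolding fourier_def by (subst haar.integral_image) (simp add: scaleR_conv_of_real)
    have "(\<integral>\<^sup>+\<eta>. ennreal ((norm (fourier m\<Gamma> f \<eta>))\<^sup>2) \<partial>?\<nu>) =
        ennreal (1 / \<mu>) * (\<integral>\<^sup>+\<gamma>. ennreal ((norm (fourier m\<Gamma> f (\<gamma> \<circ> inv h)))\<^sup>2) \<partial>mG')"
      by (rule \<nu>.nn_integral_image)
    also have "(\<integral>\<^sup>+\<gamma>. ennreal ((norm (fourier m\<Gamma> f (\<gamma> \<circ> inv h)))\<^sup>2) \<partial>mG') =
        (\<integral>\<^sup>+\<gamma>. ennreal (\<mu>\<^sup>2) * ennreal ((norm (fourier mG ?f \<gamma>))\<^sup>2) \<partial>mG')"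
      unfolding four by (simp add: norm_mult power_mult_distrib ennreal_mult)
    also have "\<dots> = ennreal (\<mu>\<^sup>2) * (\<integral>\<^sup>+\<gamma>. ennreal ((norm (fourier mG ?f \<gamma>))\<^sup>2) \<partial>mG')"
      using \<mu>_pos by (intro nn_integral_cmult_pos) simp
    also have "(\<integral>\<^sup>+\<gamma>. ennreal ((norm (fourier mG ?f \<gamma>))\<^sup>2) \<partial>mG') = (\<integral>\<^sup>+x. ennreal ((norm (f (h x)))\<^sup>2) \<partial>mG)"
      using normalized_haar_pair_plancherel(3)[OF pair_G] fh unfolding G.plancherel_def by blast
    also have "ennreal (1 / \<mu>) * (ennreal (\<mu>\<^sup>2) * \<dots>) = ennreal \<mu> * \<dots>"
      using \<mu>_pos by (simp add: mult.assoc[symmetric] ennreal_mult[symmetric] power2_eq_square)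
    also have "\<dots> = (\<integral>\<^sup>+y. ennreal ((norm (f y))\<^sup>2) \<partial>m\<Gamma>)"
      by (rule haar.nn_integral_image[symmetric])
    finally show "(\<integral>\<^sup>+\<eta>. ennreal ((norm (fourier m\<Gamma> f \<eta>))\<^sup>2) \<partial>?\<nu>) = (\<integral>\<^sup>+y. ennreal ((norm (f y))\<^sup>2) \<partial>m\<Gamma>)" .
  qed
  then have "m\<Gamma>' = ?\<nu>"
    using normalized_haar_pair_plancherel(2,3)[OF pair_\<Gamma>] image(2) by (intro \<Gamma>.plancherel_measure_unique)
  with image(1) show "scaling_iso mG' m\<Gamma>' ?g (1 / \<mu>)" by simp
qed

lemma normalized_haar_iso_inverse: "normalized_haar_iso (inv h) m\<Gamma> mG (1 / \<mu>) m\<Gamma>' mG'"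
  using haar_iso_inverse pair_G pair_\<Gamma> by (simp add: normalized_haar_iso_def normalized_haar_iso_axioms_def)

lemma trans_density_push:
  "trans_density mG' N X t x = \<mu> * trans_density m\<Gamma>' N (\<lambda>t \<omega>. h (X t \<omega>)) t (h x)"
proof -
  have "inv h (- h x) = - x"
    by (simp flip: h_minus)
  then show ?thesis
    unfolding trans_density_def using \<mu>_pos
    by (subst dual.integral_image) (simp add: char_exponent_push)
qed

lemma dalang_push:
  assumes "dalang mG' N X"
  shows "dalang m\<Gamma>' N (\<lambda>t \<omega>. h (X t \<omega>))"
proof -
  obtain \<beta> where \<beta>: "\<beta> > 0" "(\<integral>\<^sup>+\<eta>. ennreal (1 / (\<beta> + Re (char_exponent N X \<eta>))) \<partial>mG') < \<infinity>"
    using assms by (auto simp: dalang_def)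
  have "(\<integral>\<^sup>+\<eta>. ennreal (1 / (\<beta> + Re (char_exponent N (\<lambda>t \<omega>. h (X t \<omega>)) \<eta>))) \<partial>m\<Gamma>') < \<infinity>"
    using \<beta>(2) by (subst dual.nn_integral_image) (simp add: char_exponent_push ennreal_mult_less_top)
  with \<beta>(1) show ?thesis
    by (auto simp: dalang_def)
qed

end


section \<open>The stochastic heat equation on an isomorphic group\<close>

theorem theorem11p10:
  fixes h :: "'g::lca_group \<Rightarrow> 'k::lca_group" and \<mu> :: real
    and mG :: "'g measure" and mG' :: "('g \<Rightarrow> complex) measure"
    and m\<Gamma> :: "'k measure" and m\<Gamma>' :: "('k \<Rightarrow> complex) measure"
    and M :: "'w measure" and N :: "'a measure"
    and X :: "real \<Rightarrow> 'a \<Rightarrow> 'g" and L :: "(('g \<Rightarrow> real) \<times> ('g \<Rightarrow> real)) set"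
    and \<sigma> :: "real \<Rightarrow> real" and lam :: real
    and \<xi> :: "(real \<times> 'g) set \<Rightarrow> 'w \<Rightarrow> real"
    and u0 :: "'g \<Rightarrow> real" and u :: "real \<Rightarrow> 'g \<Rightarrow> 'w \<Rightarrow> real"
  assumes "normalized_haar_pair mG mG'" and "normalized_haar_pair m\<Gamma> m\<Gamma>'"
    and "topological_isomorphism h" and "is_modulus mG m\<Gamma> h \<mu>"
    and "prob_space M" and "prob_space N"
    and "levy_process N X" and "L = L2_generator mG N X" and "dalang mG' N X"
    and "\<exists>C. C-lipschitz_on UNIV \<sigma>"
    and "compact (UNIV :: 'g set) \<or> \<sigma> 0 = 0"
    and "lam > 0"
    and "white_noise M mG \<xi>"
    and "u0 \<in> sq_integrable mG"
    and "the_mild_solution M mG mG' N X L \<sigma> lam \<xi> u0 u"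
  shows "levy_process N (\<lambda>t \<omega>. h (X t \<omega>)) \<and>
    dalang m\<Gamma>' N (\<lambda>t \<omega>. h (X t \<omega>)) \<and>
    white_noise M m\<Gamma> (push_noise h \<mu> \<xi>) \<and>
    the_mild_solution M m\<Gamma> m\<Gamma>' N (\<lambda>t \<omega>. h (X t \<omega>)) (L2_generator m\<Gamma> N (\<lambda>t \<omega>. h (X t \<omega>)))
      \<sigma> (lam * sqrt \<mu>) (push_noise h \<mu> \<xi>) (u0 \<circ> inv h) (\<lambda>t y. u t (inv h y))"
proof -
  have sets: "sets mG = sets borel" "sets m\<Gamma> = sets borel"
    using assms(1,2) by (simp_all add: normalized_haar_pair_def haar_measure_def sets_borel_of_euclidean)
  interpret normalized_haar_iso h mG m\<Gamma> \<mu> mG' m\<Gamma>'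
    by unfold_locales (rule assms sets)+
  interpret inv: normalized_haar_iso "inv h" m\<Gamma> mG "1 / \<mu>" m\<Gamma>' mG'
    by (rule normalized_haar_iso_inverse)
  let ?hX = "\<lambda>t \<omega>. h (X t \<omega>)" and ?v = "\<lambda>t y. u t (inv h y)"
  let ?mild = "mild_solution M m\<Gamma> m\<Gamma>' N ?hX (L2_generator m\<Gamma> N ?hX) \<sigma> (lam * sqrt \<mu>) (push_noise h \<mu> \<xi>) (u0 \<circ> inv h)"
  have u: "mild_solution M mG mG' N X L \<sigma> lam \<xi> u0 u" "exp_moment_bound M mG u"
    and unique: "\<And>u'. mild_solution M mG mG' N X L \<sigma> lam \<xi> u0 u' \<Longrightarrow> exp_moment_bound M mG u' \<Longrightarrow>
        modification M mG u u'"
    using assms(15) unfolding the_mild_solution_def by blast+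
  have "?mild ?v"
    by (rule mild_solution_push[OF trans_density_push u(1)])
  moreover have "exp_moment_bound M m\<Gamma> ?v"
    by (rule exp_moment_bound_push[OF u(2)])
  \<comment> \<open>A competing solution on \<open>\<Gamma>\<close> is pulled back to \<open>G\<close> and compared with \<open>u\<close> there.\<close>
  moreover have "modification M m\<Gamma> ?v v" if v: "?mild v" "exp_moment_bound M m\<Gamma> v" for v
  proof (rule modification_pull[OF unique])
    have "lam * sqrt \<mu> * sqrt (1 / \<mu>) = lam"
      using \<mu>_pos by (simp add: real_sqrt_divide)
    moreover have "(u0 \<circ> inv h) \<circ> h = u0"
      by (simp add: fun_eq_iff)
    then have "mild_solution M mG mG' N X L \<sigma> (lam * sqrt \<mu> * sqrt (1 / \<mu>)) \<xi> u0 (\<lambda>t x. v t (h x))"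
      using inv.mild_solution_push[OF inv.trans_density_push v(1)]
      by (simp add: push_noise_inverse inv_inv_eq[OF bij_h] assms(8) del: o_apply comp_apply)
    ultimately show "mild_solution M mG mG' N X L \<sigma> lam \<xi> u0 (\<lambda>t x. v t (h x))"
      by (simp only:)
    show "exp_moment_bound M mG (\<lambda>t x. v t (h x))"
      using inv.exp_moment_bound_push[OF v(2)] by (simp add: inv_inv_eq[OF bij_h])
  qed
  ultimately have "the_mild_solution M m\<Gamma> m\<Gamma>' N ?hX (L2_generator m\<Gamma> N ?hX) \<sigma> (lam * sqrt \<mu>)
      (push_noise h \<mu> \<xi>) (u0 \<circ> inv h) ?v"
    unfolding the_mild_solution_def by blast
  then show ?thesis
    using levy_process_image[OF assms(6,7)] dalang_push[OF assms(9)] white_noise_push[OF assms(13)] by blast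
qed

end
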